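(* Let $A,B,C$ be multiplicative characters of $\mathbb{F}_q$ such that $A^2\neq\varepsilon$, $B^2\neq\varepsilon$, $A^2\neq C$ and $B^2\neq C$. Put $$K=\frac{A B(4)\,g(\overline{A^2})\,g(AB\overline{C})\,g(\overline{A}\,\overline{B}C\varphi)}{g(\overline{B^2})\,g(B^2\overline{C})\,g(\overline{A^2}C)\,g(\varphi)},\qquad G=g(A^2)\,g(\overline{B^2})\,g(B^2\overline{C})\,g(\overline{A^2}C).$$ Then for every $x\in\mathbb{F}_q$ with $x\neq 1$, \begin{align*} &{}_2F_1(A^2,B^2;C\mid x)\,{}_2F_1(A^2,B^2;A^2B^2\overline{C}\mid x)\\ &= qK\,{}_4F_3(A^2,B^2,AB,AB\varphi;\,A^2B^2,C,A^2B^2\overline{C}\mid 4x(1-x))\\ &\quad-(q-1)K\Big[{}_3F_2(A^2,B^2,AB\varphi;\,A^2B^2,A^2B^2\overline{C}\mid 4x(1-x))\,\delta(AB\overline{C})\\ &\qquad\qquad+{}_3F_2(A^2,B^2,AB;\,A^2B^2,C\mid 4x(1-x))\,\delta(\overline{A}\,\overline{B}C\varphi)\Big]\\ &\quad+\frac{q\,(\overline{C}\,\overline{A^2})(1-x)\,(C\overline{B^2})(x)}{G}\,\delta\!\left(\frac{1-2x}{(1-x)^2}\right)\\ &\quad-\frac{(q-1)\,g(A\overline{B})\,g(\overline{A}B)\,(\overline{A}\,\overline{B})(x-x^2)}{q^2G}\Big[(q-1)\delta(AB)\delta(AB\overline{C})-q\,AB(-1)\,\delta(AB\overline{C})-q\,ABC(-1)\,\delta(AB)\Big]\\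 &\quad-\frac{(q-1)\,g(\overline{A}B\varphi)\,g(A\overline{B}\varphi)\,(\overline{A}\,\overline{B}\varphi)(x-x^2)}{q^2G}\Big[(q-1)\delta(AB\overline{C}\varphi)\delta(AB\varphi)-q\,AB\varphi(-1)\,\delta(AB\overline{C}\varphi)-q\,ABC\varphi(-1)\,\delta(AB\varphi)\Big]. \end{align*}
   Context: Let $p$ be an odd prime, $q=p^r$ ($r\ge1$), and $\mathbb{F}_q$ the field with $q$ elements. Multiplicative characters of $\mathbb{F}_q^\times$ are extended to $\mathbb{F}_q$ by $\chi(0)=0$ (including the trivial character $\varepsilon$). $\varphi$ denotes the quadratic character. Characters are multiplied pointwise, $\overline{A}$ is the inverse of $A$, $A^k$ is the $k$-th power of $A$, and an expression such as $(\overline{C}\,\overline{A^2})(1-x)$ or $AB(4)$ means the indicated product character evaluated at the indicated element of $\mathbb{F}_q$. For a character $A$, $\delta(A)=1$ if $A=\varepsilon$ and $0$ otherwise; for $x\in\mathbb{F}_q$, $\delta(x)=1$ if $x=0$ and $0$ otherwise. The Gauss sum is $g(\chi)=\sum_{x\in\mathbb{F}_q}\chi(x)\theta(x)$, where $\theta(\alpha)=\zeta_p^{\mathrm{tr}(\alpha)}$, $\zeta_p$ is a fixed primitive $p$-th root of unity and $\mathrm{tr}:\mathbb{F}_q\to\mathbb{F}_p$ is the trace. The binomial coefficient is $\binom{A}{B}=\frac{B(-1)}{q}\sum_{x\in\mathbb{F}_q}A(x)\overline{B}(1-x)$. Greene's Gaussian hypergeometric series is $${}_{n+1}F_n(A_0,A_1,\dots,A_n;\,B_1,\dots,B_n\mid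 x)=\frac{q}{q-1}\sum_{\chi}\binom{A_0\chi}{\chi}\binom{A_1\chi}{B_1\chi}\cdots\binom{A_n\chi}{B_n\chi}\chi(x),$$ the sum running over all multiplicative characters $\chi$ of $\mathbb{F}_q^\times$. *)

theory Defs
  imports
    Complex_Main
    "HOL-Computational_Algebra.Primes"
    "HOL-Library.Cardinality"
    "HOL-Library.Function_Division"
begin

text \<open>
  Characters are complex-valued functions on the field, so products, powers and inverses of
  characters are the pointwise operations of \<^theory>\<open>HOL-Library.Function_Division\<close>. Since
  \<open>inverse 0 = 0\<close> in the complex numbers, the pointwise inverse of a character again vanishes
  at \<open>0\<close>. The unit of the character group is \<open>\<epsilon>\<close> below, not the constant function \<open>1\<close>.
\<close>

definition mult_chars :: "('a::finite_field \<Rightarrow> complex) set" where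
  "mult_chars = {\<chi>. \<chi> 0 = 0 \<and> \<chi> 1 = 1 \<and> (\<forall>x y. \<chi> (x * y) = \<chi> x * \<chi> y)}"

definition triv_char :: "'a::finite_field \<Rightarrow> complex"  (\<open>\<epsilon>\<close>) where
  "\<epsilon> x = (if x = 0 then 0 else 1)"

definition quad_char :: "'a::finite_field \<Rightarrow> complex"  (\<open>\<phi>\<close>) where
  "\<phi> x = (if x = 0 then 0 else if \<exists>y. x = y ^ 2 then 1 else - 1)"

definition delta_char :: "('a::finite_field \<Rightarrow> complex) \<Rightarrow> complex" where
  "delta_char A = (if A = \<epsilon> then 1 else 0)"

definition delta_elt :: "'a::finite_field \<Rightarrow> complex" where
  "delta_elt x = (if x = 0 then 1 else 0)"

definition primitive_root_of_unity :: "nat \<Rightarrow> complex \<Rightarrow> bool" where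
  "primitive_root_of_unity n z \<longleftrightarrow> z ^ n = 1 \<and> (\<forall>k. 0 < k \<and> k < n \<longrightarrow> z ^ k \<noteq> 1)"

text \<open>
  The next three definitions are meant for a field with \<open>p ^ r\<close> elements, \<open>p\<close> prime.
  The trace then lies in the prime subfield, whose elements are \<open>of_nat k\<close> for a unique \<open>k < p\<close>;
  \<open>add_char\<close> uses this \<open>k\<close> as the exponent of \<open>\<zeta>\<close>.
\<close>

definition field_trace :: "nat \<Rightarrow> nat \<Rightarrow> 'a::finite_field \<Rightarrow> 'a" where
  "field_trace p r a = (\<Sum>i<r. a ^ (p ^ i))"

definition add_char :: "nat \<Rightarrow> nat \<Rightarrow> complex \<Rightarrow> 'a::finite_field \<Rightarrow> complex" where
  "add_char p r \<zeta> a = \<zeta> ^ (THE k. k < p \<and> of_nat k = field_trace p r a)"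

definition gauss_sum ::
  "nat \<Rightarrow> nat \<Rightarrow> complex \<Rightarrow> ('a::finite_field \<Rightarrow> complex) \<Rightarrow> complex" where
  "gauss_sum p r \<zeta> \<chi> = (\<Sum>x\<in>UNIV. \<chi> x * add_char p r \<zeta> x)"

definition char_binomial ::
  "('a::finite_field \<Rightarrow> complex) \<Rightarrow> ('a \<Rightarrow> complex) \<Rightarrow> complex" where
  "char_binomial A B = B (- 1) / of_nat CARD('a) * (\<Sum>x\<in>UNIV. A x * inverse B (1 - x))"

text \<open>
  \<open>greene_F A\<^sub>0 [A\<^sub>1, \<dots>, A\<^sub>n] [B\<^sub>1, \<dots>, B\<^sub>n] x\<close> is Greene's hypergeometric series; the two lists are
  meant to have the same length.
\<close>

definition greene_F ::
  "('a::finite_field \<Rightarrow> complex) \<Rightarrow> ('a \<Rightarrow> complex) list \<Rightarrow> ('a \<Rightarrow> complex) list \<Rightarrow> 'a \<Rightarrow> complex"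
where
  "greene_F A0 As Bs x =
     of_nat CARD('a) / (of_nat CARD('a) - 1) *
     (\<Sum>\<chi>\<in>mult_chars. char_binomial (A0 * \<chi>) \<chi> *
        (\<Prod>(A, B)\<leftarrow>zip As Bs. char_binomial (A * \<chi>) (B * \<chi>)) * \<chi> x)"

text \<open>A sum over an infinite set would be \<open>0\<close> by convention, so finiteness matters here.\<close>

lemma finite_mult_chars: "finite (mult_chars :: ('a::finite_field \<Rightarrow> complex) set)"
proof -
  define N where "N = card (UNIV - {0 :: 'a})"
  let ?S = "insert 0 {z::complex. z ^ N = 1}"
  have "1 \<in> UNIV - {0 :: 'a}"
    by simp
  hence "UNIV - {0 :: 'a} \<noteq> {}"
    by blast
  hence N: "N > 0"
    unfolding N_def by (subst card_gt_0_iff) simp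
  have fin: "finite ?S"
    using N finite_roots_unity[of N] by simp
  have root: "\<chi> a \<in> ?S" if \<chi>: "\<chi> \<in> mult_chars" for \<chi> and a :: 'a
  proof (cases "a = 0")
    case False
    have mult: "\<chi> (x * y) = \<chi> x * \<chi> y" for x y
      using \<chi> by (simp add: mult_chars_def)
    have nz: "\<chi> x \<noteq> 0" if "x \<noteq> 0" for x
      using mult[of x "inverse x"] that \<chi> by (auto simp: mult_chars_def)
    have bij: "bij_betw ((*) a) (UNIV - {0}) (UNIV - {0})"
      using False by (intro bij_betw_byWitness[where f' = "\<lambda>x. x / a"]) auto
    have "(\<Prod>x\<in>UNIV - {0}. \<chi> x) = (\<Prod>x\<in>UNIV - {0}. \<chi> (a * x))"
      using prod.reindex_bij_betw[OF bij, of \<chi>] by simp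
    also have "\<dots> = \<chi> a ^ N * (\<Prod>x\<in>UNIV - {0}. \<chi> x)"
      by (simp add: mult prod.distrib N_def)
    finally have "\<chi> a ^ N = 1"
      using nz by (simp add: prod_zero_iff)
    thus ?thesis by simp
  qed (use \<chi> in \<open>simp add: mult_chars_def\<close>)
  have "finite {\<chi>::'a \<Rightarrow> complex. \<forall>a. \<chi> a \<in> ?S}"
    using finite_set_of_finite_funs[OF finite fin, of "UNIV :: 'a set" 0] by simp
  thus ?thesis
    by (rule finite_subset[rotated]) (use root in blast)
qed

end

theory Submission
  imports Defs "HOL-Computational_Algebra.Polynomial" "HOL-Number_Theory.Residues"
begin

text \<open>
  Put \<open>a = A\<^sup>2\<close>, \<open>b = B\<^sup>2\<close>, \<open>d = b / C\<close> and \<open>z = x (1 - x)\<close>. By their integral representations the two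
  \<open>\<^sub>2F\<^sub>1\<close> factors are sums over \<open>y\<close> and \<open>w\<close>; the substitution \<open>u = (1 - x w) / y\<close>, \<open>v = (1 - x y) / w\<close>
  turns their product into a double sum over \<open>u, v\<close> involving \<open>x\<close> only through \<open>z\<close>. The exceptional curves of
  this substitution contribute nothing unless \<open>x = 1 / 2\<close>. The Mellin transform in \<open>z\<close> of the new sum
  is, after expanding \<open>d\<close> by Gauss sums, a product of two Gauss sums and of the transform of a product of two
  Bessel functions, which is elementary (a form of Barnes' first lemma). The duplication formula
  \<open>g \<chi> g (\<chi> \<phi>) = \<chi> (1/4) g (\<chi>\<^sup>2) g \<phi>\<close> identifies the result with the coefficients of the \<open>\<^sub>4F\<^sub>3\<close>; the two characters
  \<open>N\<close> with \<open>N\<^sup>2 A\<^sup>2 B\<^sup>2 = \<epsilon>\<close> are degenerate and give the last two terms of the formula.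
\<close>

section \<open>Multiplicative characters of a finite field\<close>

text \<open>The classical model is Bailey's factorisation of an Appell F4 function into two 2F1
  functions when c + c' = a + b + 1, followed by Burchnall's reduction of F4 on its diagonal to a
  4F3 at 4z. Here \<open>c' = a * b * inverse c\<close> replaces the relation between the
  parameters; the squares \<open>a = A * A\<close>, \<open>b = B * B\<close> supply the halved
  parameters \<open>A * B\<close> and \<open>A * B * \<phi>\<close> as well as the evenness
  \<open>a (- 1) = b (- 1) = 1\<close>. The difficulty lies in the exceptional terms. Characters
  vanish at 0, so a rational substitution loses whole curves; and the product of the Gauss sums of a
  character and its inverse has absolute value q, except for the trivial character, where it is 1.
  Identities are therefore kept in forms valid for all characters, with the defects recorded by
  delta terms. That a and b are nontrivial and differ from C removes these defects for the four
  Gauss sums in G; those of \<open>N * N * a * b\<close> and of the binomials attached to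
  \<open>A * B * inverse C\<close> and \<open>inverse A * inverse B * C * \<phi>\<close> remain and
  become the character deltas of the formula.\<close>

lemma mult_char_0: "\<chi> \<in> mult_chars \<Longrightarrow> \<chi> 0 = 0"
  and mult_char_1: "\<chi> \<in> mult_chars \<Longrightarrow> \<chi> 1 = 1"
  and mult_char_mult: "\<chi> \<in> mult_chars \<Longrightarrow> \<chi> (x * y) = \<chi> x * \<chi> y"
  by (auto simp: mult_chars_def)

lemma mult_char_nonzero:
  assumes "\<chi> \<in> mult_chars" "x \<noteq> 0"
  shows "\<chi> x \<noteq> 0"
  using mult_char_mult[OF assms(1), of x "inverse x"] mult_char_1[OF assms(1)] assms(2) by auto

lemma mult_char_eq_0_iff: "\<chi> \<in> mult_chars \<Longrightarrow> \<chi> x = 0 \<longleftrightarrow> x = 0"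
  using mult_char_nonzero mult_char_0 by metis

lemma mult_char_inverse: "\<chi> \<in> mult_chars \<Longrightarrow> \<chi> (inverse x) = inverse (\<chi> x)"
  by (cases "x = 0")
     (simp add: mult_char_0, metis inverse_unique mult_char_1 mult_char_mult right_inverse)

lemma mult_char_divide: "\<chi> \<in> mult_chars \<Longrightarrow> \<chi> (x / y) = \<chi> x / \<chi> y"
  by (simp add: divide_inverse mult_char_mult mult_char_inverse)

lemma mult_char_minus1_sq: "\<chi> \<in> mult_chars \<Longrightarrow> \<chi> (- 1) * \<chi> (- 1) = 1"
  using mult_char_mult[of \<chi> "- 1" "- 1"] mult_char_1[of \<chi>] by simp

lemma mult_char_minus: "\<chi> \<in> mult_chars \<Longrightarrow> \<chi> (- x) = \<chi> (- 1) * \<chi> x"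
  using mult_char_mult[of \<chi> "- 1" x] by simp

lemma inverse_mult_char_minus1: "\<chi> \<in> mult_chars \<Longrightarrow> inverse (\<chi> (- 1)) = \<chi> (- 1)"
  using mult_char_minus1_sq inverse_unique by blast

lemma triv_char_in: "\<epsilon> \<in> mult_chars"
  and times_char_in: "\<chi> \<in> mult_chars \<Longrightarrow> \<psi> \<in> mult_chars \<Longrightarrow> \<chi> * \<psi> \<in> mult_chars"
  and inverse_char_in: "\<chi> \<in> mult_chars \<Longrightarrow> inverse \<chi> \<in> mult_chars"
  by (auto simp: mult_chars_def triv_char_def)

lemmas mult_char_closed = triv_char_in times_char_in inverse_char_in

lemma triv_char_mult: "\<chi> \<in> mult_chars \<Longrightarrow> \<epsilon> * \<chi> = \<chi>"
  by (auto simp: fun_eq_iff triv_char_def mult_char_0)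

lemma inverse_char_mult: "\<chi> \<in> mult_chars \<Longrightarrow> inverse \<chi> * \<chi> = \<epsilon>"
  by (auto simp: fun_eq_iff triv_char_def mult_char_0 mult_char_nonzero)

lemma inverse_inverse_char: "inverse (inverse \<chi>) = (\<chi> :: 'a::finite_field \<Rightarrow> complex)"
  by (simp add: fun_eq_iff)

lemma inverse_char_distrib: "inverse (\<chi> * \<psi>) = inverse \<chi> * (inverse \<psi> :: 'a::finite_field \<Rightarrow> complex)"
  by (simp add: fun_eq_iff)

lemma inverse_triv_char: "inverse \<epsilon> = \<epsilon>"
  by (simp add: fun_eq_iff triv_char_def)

lemma inverse_char_eq_triv: "inverse \<chi> = \<epsilon> \<longleftrightarrow> \<chi> = \<epsilon>"
  by (metis inverse_inverse_char inverse_triv_char)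

lemma char_times_eq_triv_iff:
  assumes "\<chi> \<in> mult_chars" "\<psi> \<in> mult_chars"
  shows "\<chi> * \<psi> = \<epsilon> \<longleftrightarrow> \<chi> = inverse \<psi>"
proof
  assume "\<chi> * \<psi> = \<epsilon>"
  hence "\<chi> * \<psi> * inverse \<psi> = inverse \<psi>"
    using assms by (simp add: triv_char_mult mult_char_closed)
  thus "\<chi> = inverse \<psi>"
    using assms by (metis inverse_char_mult mult.commute mult.assoc triv_char_mult)
qed (use assms in \<open>simp add: inverse_char_mult\<close>)

lemma triv_char_apply: "x \<noteq> 0 \<Longrightarrow> \<epsilon> x = 1" and triv_char_0: "\<epsilon> 0 = 0"
  by (simp_all add: triv_char_def)

section \<open>Sums over the field and orthogonality of characters\<close>

lemma sum_scale:
  fixes f :: "'a::finite_field \<Rightarrow> complex"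
  assumes "s \<noteq> 0"
  shows "(\<Sum>x\<in>UNIV. f (s * x)) = (\<Sum>x\<in>UNIV. f x)"
  by (rule sum.reindex_bij_witness[of _ "\<lambda>x. x / s" "\<lambda>x. s * x"]) (use assms in auto)

lemma sum_uminus:
  fixes f :: "'a::finite_field \<Rightarrow> complex"
  shows "(\<Sum>x\<in>UNIV. f (- x)) = (\<Sum>x\<in>UNIV. f x)"
  by (rule sum.reindex_bij_witness[of _ uminus uminus]) auto

lemma sum_one_minus:
  fixes f :: "'a::finite_field \<Rightarrow> complex"
  shows "(\<Sum>x\<in>UNIV. f (1 - x)) = (\<Sum>x\<in>UNIV. f x)"
  by (rule sum.reindex_bij_witness[of _ "\<lambda>x. 1 - x" "\<lambda>x. 1 - x"]) auto

lemma sum_one_plus: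
  fixes f :: "'a::finite_field \<Rightarrow> complex"
  shows "(\<Sum>x\<in>UNIV. f (1 + x)) = (\<Sum>x\<in>UNIV. f x)"
  by (rule sum.reindex_bij_witness[of _ "\<lambda>x. x - 1" "\<lambda>x. 1 + x"]) auto

lemma sum_UNIV_remove:
  fixes f :: "'a::finite_field \<Rightarrow> complex"
  shows "(\<Sum>x\<in>UNIV. f x) = f a + (\<Sum>x\<in>UNIV - {a}. f x)"
  by (simp add: sum.remove)

lemma card_nonzero: "card (UNIV - {0 :: 'a::finite_field}) = CARD('a) - 1"
  by (simp add: card_Diff_singleton)

lemma card_gt_1: "CARD('a::finite_field) > 1"
proof -
  have "card {0, 1 :: 'a} \<le> CARD('a)"
    by (rule card_mono) auto
  thus ?thesis by simp
qed

lemma sum_triv_char: "(\<Sum>x\<in>UNIV. \<epsilon> (x :: 'a::finite_field)) = of_nat CARD('a) - 1"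
proof -
  have "(\<Sum>x\<in>UNIV. \<epsilon> (x :: 'a)) = (\<Sum>x\<in>UNIV - {0 :: 'a}. 1)"
    by (subst sum_UNIV_remove[of _ 0]) (simp add: triv_char_def)
  thus ?thesis
    using card_gt_1[where 'a = 'a] by (simp add: card_nonzero of_nat_diff)
qed

lemma sum_mult_char:
  fixes \<chi> :: "'a::finite_field \<Rightarrow> complex"
  assumes "\<chi> \<in> mult_chars"
  shows "(\<Sum>x\<in>UNIV. \<chi> x) = (of_nat CARD('a) - 1) * delta_char \<chi>"
proof (cases "\<chi> = \<epsilon>")
  case False
  then obtain y where y: "\<chi> y \<noteq> 1" "y \<noteq> 0"
    using assms by (auto simp: fun_eq_iff triv_char_def mult_char_0 split: if_splits)
  have "(\<Sum>x\<in>UNIV. \<chi> x) = \<chi> y * (\<Sum>x\<in>UNIV. \<chi> x)"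
    using sum_scale[OF y(2), of \<chi>] by (simp add: mult_char_mult assms sum_distrib_left)
  thus ?thesis using y False by (simp add: delta_char_def)
qed (simp add: sum_triv_char delta_char_def)

text \<open>Cyclicity of the multiplicative group is available for the record-based fields of
  HOL-Algebra, so the type is repackaged as the record \<open>R\<close> and the generator is carried
  back.\<close>

lemma finite_field_has_generator:
  obtains a :: "'a::finite_field" where "a \<noteq> 0" "\<And>x. x \<noteq> 0 \<Longrightarrow> \<exists>i::nat. x = a ^ i"
proof -
  define R where "R = \<lparr>carrier = (UNIV :: 'a set), monoid.mult = (*), one = (1 :: 'a), zero = (0 :: 'a), add = (+)\<rparr>"
  have cR: "cring R"
    by (intro cringI abelian_groupI comm_monoidI)
       (auto simp: R_def algebra_simps intro: exI[of _ "- x" for x])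
  have "Units R = carrier R - {\<zero>\<^bsub>R\<^esub>}"
    by (auto simp: R_def Units_def) (metis left_inverse right_inverse)
  hence R: "field R"
    by (rule cring.cring_fieldI[OF cR])
  interpret field R by (rule R)
  have pow: "a [^]\<^bsub>R\<^esub> (n::nat) = a ^ n" for a n
    by (induction n) (simp_all add: nat_pow_def R_def mult.commute)
  obtain a where a: "a \<in> carrier (mult_of R)" "carrier (mult_of R) = {a [^]\<^bsub>R\<^esub> i | i::nat. i \<in> UNIV}"
    using finite_field_mult_group_has_gen by (auto simp: R_def)
  show ?thesis
  proof (rule that[of a])
    show "a \<noteq> 0" using a(1) by (auto simp: R_def)
    show "\<exists>i::nat. x = a ^ i" if "x \<noteq> 0" for x
      using a(2) that unfolding pow by (auto simp: R_def)
  qed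
qed

text \<open>Sending a generator of the cyclic group of order n to a primitive n-th root of unity is
  injective, so this one character separates every x from 1.\<close>

lemma ex_char_separating:
  fixes x :: "'a::finite_field"
  assumes "x \<noteq> 0" "x \<noteq> 1"
  obtains \<chi> where "\<chi> \<in> mult_chars" "\<chi> x \<noteq> 1"
proof -
  obtain a :: 'a where a: "a \<noteq> 0" "\<And>x. x \<noteq> 0 \<Longrightarrow> \<exists>i::nat. x = a ^ i"
    by (rule finite_field_has_generator) blast
  define n where "n = CARD('a) - 1"
  have n: "n > 0" using card_gt_1[where 'a = 'a] by (simp add: n_def)
  have an: "a ^ n = 1"
  proof -
    have "a ^ Suc n = a" using finite_field_power_card_eq_same[of a] n by (simp add: n_def)
    thus ?thesis using a(1) by simp
  qed
  have amod: "a ^ i = a ^ (i mod n)" for i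
    by (metis an mult.left_neutral mod_mult_div_eq mult.commute power_add power_mult power_one)
  have img: "UNIV - {0} = (\<lambda>i. a ^ i) ` {..<n}"
  proof
    show "UNIV - {0} \<subseteq> (\<lambda>i. a ^ i) ` {..<n}"
    proof
      fix y :: 'a assume "y \<in> UNIV - {0}"
      then obtain i where "y = a ^ i" using a(2)[of y] by auto
      hence "y = a ^ (i mod n)" using amod[of i] by simp
      thus "y \<in> (\<lambda>i. a ^ i) ` {..<n}" using n by auto
    qed
  qed (use a(1) in auto)
  \<comment> \<open>The n exponents hit all n nonzero elements, and a surjection between finite sets
    of equal size is injective.\<close>
  have inj: "inj_on (\<lambda>i. a ^ i) {..<n}"
    using arg_cong[OF img, of card] by (intro eq_card_imp_inj_on) (simp_all add: card_nonzero n_def)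
  have eq_iff: "a ^ i = a ^ j \<longleftrightarrow> i mod n = j mod n" for i j
    using inj_onD[OF inj, of "i mod n" "j mod n"] n amod[of i] amod[of j] by auto
  define \<omega> where "\<omega> = cis (2 * pi / real n)"
  have wn: "\<omega> ^ n = 1"
    using n by (simp add: \<omega>_def DeMoivre)
  have wmod: "\<omega> ^ i = \<omega> ^ (i mod n)" for i
    by (metis wn mult.left_neutral mod_mult_div_eq mult.commute power_add power_mult power_one)
  \<comment> \<open>A discrete logarithm, determined only modulo the order of \<open>a\<close>; by
    \<open>w_eq\<close> the choice does not affect \<chi>.\<close>
  define L where "L y = (SOME i. y = a ^ i)" for y
  have L: "a ^ L y = y" if "y \<noteq> 0" for y
    using someI_ex[OF a(2)[OF that]] by (simp add: L_def)
  define \<chi> where "\<chi> y = (if y = 0 then 0 else \<omega> ^ L y)" for y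
  have w_eq: "\<omega> ^ i = \<omega> ^ j" if "a ^ i = a ^ j" for i j
    using that wmod[of i] wmod[of j] by (simp add: eq_iff)
  have "\<omega> ^ L 1 = 1"
    using w_eq[of "L 1" 0] L[of 1] by simp
  moreover have "\<omega> ^ L (y * z) = \<omega> ^ L y * \<omega> ^ L z" if "y \<noteq> 0" "z \<noteq> 0" for y z
    using w_eq[of "L (y * z)" "L y + L z"] L[of y] L[of z] L[of "y * z"] that by (simp add: power_add)
  ultimately have "\<chi> \<in> mult_chars"
    by (simp add: mult_chars_def \<chi>_def)
  moreover have "\<chi> x \<noteq> 1"
  proof
    assume "\<chi> x = 1"
    hence *: "\<omega> ^ (L x mod n) = 1" using assms wmod[of "L x"] by (simp add: \<chi>_def)
    define k where "k = L x mod n"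
    have k: "k < n" using n by (simp add: k_def)
    have "cis (2 * pi * real k / real n) = 1"
      using * by (simp add: \<omega>_def DeMoivre k_def mult_ac)
    hence "cis (2 * pi * real k / real n) = cis (2 * pi * real 0 / real n)" by simp
    hence "k = 0"
      using bij_betw_roots_unity[OF n] n k
      by (metis (no_types, lifting) bij_betw_imp_inj_on inj_on_eq_iff lessThan_iff)
    hence "a ^ L x = 1" using amod[of "L x"] by (simp add: k_def)
    thus False using L[of x] assms by simp
  qed
  ultimately show ?thesis by (rule that)
qed

lemma sum_times_char:
  assumes "\<psi> \<in> mult_chars"
  shows "(\<Sum>\<chi>\<in>mult_chars. F (\<psi> * \<chi>)) = (\<Sum>\<chi>\<in>mult_chars. F \<chi>)"
  by (rule sum.reindex_bij_witness[of _ "\<lambda>\<chi>. inverse \<psi> * \<chi>" "\<lambda>\<chi>. \<psi> * \<chi>"])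
     (use assms in \<open>auto simp: mult_char_closed simp flip: mult.assoc
        simp: triv_char_mult inverse_char_mult mult.commute[of \<psi> "inverse \<psi>"]\<close>)

text \<open>The number of characters comes for free: sum \<open>\<chi> x\<close> over all \<open>\<chi>\<close> and all \<open>x\<close>.\<close>

lemma sum_mult_chars:
  fixes x :: "'a::finite_field"
  shows "(\<Sum>\<chi>\<in>mult_chars. \<chi> x) = (if x = 1 then of_nat CARD('a) - 1 else 0)"
proof -
  have ne1: "(\<Sum>\<chi>\<in>mult_chars. \<chi> x) = 0" if "x \<noteq> 1" for x :: 'a
  proof (cases "x = 0")
    case True
    thus ?thesis by (simp add: mult_char_0)
  next
    case False
    then obtain \<psi> where \<psi>: "\<psi> \<in> mult_chars" "\<psi> x \<noteq> 1"
      by (rule ex_char_separating[OF _ \<open>x \<noteq> 1\<close>])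
    have "(\<Sum>\<chi>\<in>mult_chars. \<chi> x) = \<psi> x * (\<Sum>\<chi>\<in>mult_chars. \<chi> x)"
      using sum_times_char[OF \<psi>(1), of "\<lambda>\<chi>. \<chi> x"] by (simp add: sum_distrib_left)
    thus ?thesis using \<psi> by simp
  qed
  have "(\<Sum>\<chi>\<in>mult_chars. \<chi> (1 :: 'a)) = (\<Sum>x\<in>(UNIV :: 'a set). \<Sum>\<chi>\<in>mult_chars. \<chi> x)"
    by (subst sum_UNIV_remove[of _ 1]) (simp add: ne1)
  also have "\<dots> = (\<Sum>\<chi>\<in>mult_chars. \<Sum>x\<in>(UNIV :: 'a set). \<chi> x)"
    by (rule sum.swap)
  also have "\<dots> = (\<Sum>\<chi>\<in>mult_chars. if \<chi> = (\<epsilon> :: 'a \<Rightarrow> complex) then of_nat CARD('a) - 1 else 0)"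
    by (intro sum.cong refl) (simp add: sum_mult_char delta_char_def)
  also have "\<dots> = of_nat CARD('a) - 1"
    by (simp add: finite_mult_chars triv_char_in)
  finally show ?thesis using ne1 by simp
qed

text \<open>Orthogonality over \<chi> selects u = z. The summand u = 0 needs no separate treatment,
  because z / 0 = 0 and characters vanish there.\<close>

lemma mellin_inversion:
  fixes f :: "'a::finite_field \<Rightarrow> complex"
  assumes "z \<noteq> 0"
  shows "(\<Sum>\<chi>\<in>mult_chars. \<chi> z * (\<Sum>u\<in>UNIV. inverse \<chi> u * f u)) = (of_nat CARD('a) - 1) * f z"
proof -
  have "(\<Sum>\<chi>\<in>mult_chars. \<chi> z * (\<Sum>u\<in>UNIV. inverse \<chi> u * f u)) =
        (\<Sum>u\<in>UNIV. f u * (\<Sum>\<chi>\<in>mult_chars. \<chi> (z / u)))"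
    unfolding sum_distrib_left
    by (subst sum.swap) (intro sum.cong refl, simp add: mult_char_divide field_simps)
  also have "\<dots> = (\<Sum>u\<in>UNIV. if u = z then (of_nat CARD('a) - 1) * f z else 0)"
    by (intro sum.cong refl) (use assms in \<open>auto simp: sum_mult_chars\<close>)
  finally show ?thesis by simp
qed

section \<open>The quadratic character\<close>

lemma two_nonzero:
  assumes "odd CARD('a::finite_field)"
  shows "(2 :: 'a) \<noteq> 0"
proof
  assume "(2 :: 'a) = 0"
  hence "CHAR('a) dvd 2"
    using of_nat_eq_0_iff_char_dvd[of 2, where 'a = 'a] by simp
  hence "CHAR('a) = 2"
    using primes_dvd_imp_eq two_is_prime_nat CHAR_prime by blast
  thus False
    using CHAR_dvd_CARD[where 'a = 'a] assms by simp
qed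

lemma four_nonzero:
  assumes "odd CARD('a::finite_field)"
  shows "(4 :: 'a) \<noteq> 0"
proof -
  have "(4 :: 'a) = 2 * 2" by simp
  thus ?thesis using two_nonzero[OF assms] by (metis no_zero_divisors)
qed

lemma minus_eq_self_iff:
  assumes "odd CARD('a)"
  shows "- x = x \<longleftrightarrow> x = (0 :: 'a::finite_field)"
proof -
  have "- x = x \<longleftrightarrow> 2 * x = 0" by (metis add_eq_0_iff mult_2)
  thus ?thesis using two_nonzero[OF assms] by simp
qed

text \<open>A non-square is an odd power of a generator, and two odd exponents add up to an even
  one.\<close>

lemma not_square_mult:
  fixes x y :: "'a::finite_field"
  assumes odd: "odd CARD('a)" and x: "\<nexists>z. x = z\<^sup>2" and y: "\<nexists>z. y = z\<^sup>2"
  shows "\<exists>z. x * y = z\<^sup>2"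
proof -
  obtain a :: 'a where a: "a \<noteq> 0" "\<And>x. x \<noteq> 0 \<Longrightarrow> \<exists>i::nat. x = a ^ i"
    by (rule finite_field_has_generator) blast
  have "x \<noteq> 0" "y \<noteq> 0" using x y by (metis zero_power2)+
  then obtain i j where ij: "x = a ^ i" "y = a ^ j" using a(2) by metis
  have "odd i" "odd j"
    using x y ij by (metis dvd_div_mult_self power_mult)+
  hence "even (i + j)" by simp
  thus ?thesis
    unfolding ij power_add[symmetric] by (metis dvd_div_mult_self power_mult)
qed

lemma quad_char_in:
  assumes "odd CARD('a::finite_field)"
  shows "(\<phi> :: 'a \<Rightarrow> complex) \<in> mult_chars"
proof -
  have 1: "\<phi> (1 :: 'a) = 1" by (auto simp: quad_char_def intro: exI[of _ 1])
  have "\<phi> (x * y) = \<phi> x * \<phi> y" for x y :: 'a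
  proof (cases "x = 0 \<or> y = 0")
    case False
    have **: "\<exists>z. b = z\<^sup>2" if "\<exists>z. c = z\<^sup>2" "\<exists>z. c * b = z\<^sup>2" "c \<noteq> 0" for b c :: 'a
    proof -
      from that(1,2) obtain u v where "c = u\<^sup>2" "c * b = v\<^sup>2" by blast
      hence "b = (v / u)\<^sup>2" using \<open>c \<noteq> 0\<close> by (simp add: power_divide field_simps)
      thus ?thesis by blast
    qed
    have *: "\<exists>z. b * c = z\<^sup>2" if "\<exists>z. b = z\<^sup>2" "\<exists>z. c = z\<^sup>2" for b c :: 'a
      using that by (metis power_mult_distrib)
    have "(\<exists>z. x * y = z\<^sup>2) \<longleftrightarrow> ((\<exists>z. x = z\<^sup>2) \<longleftrightarrow> (\<exists>z. y = z\<^sup>2))"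
      using not_square_mult[OF assms] *[of x y] **[of x y] **[of y x] False
      by (metis mult.commute)
    thus ?thesis using False by (simp add: quad_char_def)
  qed (auto simp: quad_char_def)
  thus ?thesis using 1 by (simp add: mult_chars_def quad_char_def)
qed

lemma quad_char_square: "x \<noteq> 0 \<Longrightarrow> \<phi> (x\<^sup>2) = 1"
  by (auto simp: quad_char_def)

lemma quad_char_sq: "(\<phi> * \<phi> :: 'a::finite_field \<Rightarrow> complex) = \<epsilon>"
  by (auto simp: fun_eq_iff quad_char_def triv_char_def)

lemma inverse_quad_char: "inverse \<phi> = (\<phi> :: 'a::finite_field \<Rightarrow> complex)"
  by (auto simp: fun_eq_iff quad_char_def)

lemma card_square_roots:
  fixes t :: "'a::finite_field"
  assumes "odd CARD('a)"
  shows "of_nat (card {s. s\<^sup>2 = t}) = 1 + \<phi> t"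
proof -
  consider "t = 0" | y where "t = y\<^sup>2" "y \<noteq> 0" | "t \<noteq> 0" "\<nexists>y. t = y\<^sup>2" by fastforce
  thus ?thesis
  proof cases
    case (2 y)
    have "{s. s\<^sup>2 = t} = {y, - y}" using 2 by (auto simp: power2_eq_iff)
    moreover have "y \<noteq> - y" using minus_eq_self_iff[OF assms, of y] 2 by auto
    ultimately show ?thesis using 2 by (simp add: quad_char_square)
  qed (auto simp: quad_char_def)
qed

lemma sum_squares_eq:
  fixes F :: "'a::finite_field \<Rightarrow> complex"
  assumes "odd CARD('a)"
  shows "(\<Sum>s\<in>UNIV. F (s\<^sup>2)) = (\<Sum>t\<in>UNIV. F t * (1 + \<phi> t))"
proof -
  have "(\<Sum>s\<in>UNIV. F (s\<^sup>2)) = (\<Sum>t\<in>UNIV. \<Sum>s\<in>{s. s\<^sup>2 = t}. F (s\<^sup>2))"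
    using sum.group[of "UNIV :: 'a set" "UNIV :: 'a set" "\<lambda>s. s\<^sup>2" "\<lambda>s. F (s\<^sup>2)"] by simp
  also have "\<dots> = (\<Sum>t\<in>UNIV. F t * (1 + \<phi> t))"
    by (simp add: card_square_roots[OF assms, symmetric] mult.commute)
  finally show ?thesis .
qed

text \<open>Taking F = 1 in \<open>sum_squares_eq\<close> counts the field; a trivial \<phi> would
  give q = q + (q - 1), hence q = 1.\<close>

lemma quad_char_neq_triv:
  assumes "odd CARD('a::finite_field)"
  shows "(\<phi> :: 'a \<Rightarrow> complex) \<noteq> \<epsilon>"
proof
  assume eq: "(\<phi> :: 'a \<Rightarrow> complex) = \<epsilon>"
  have "of_nat CARD('a) = (\<Sum>t\<in>(UNIV :: 'a set). 1 + \<phi> t :: complex)"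
    using sum_squares_eq[OF assms, of "\<lambda>_. 1"] by simp
  also have "\<dots> = of_nat CARD('a) + (of_nat CARD('a) - 1)"
    unfolding eq by (simp add: sum.distrib sum_triv_char)
  finally have "CARD('a) = 1"
    by (metis add_diff_cancel_left' diff_self of_nat_eq_1_iff right_minus_eq)
  thus False using card_gt_1[where 'a = 'a] by simp
qed

text \<open>Such a \<chi> is 1 on nonzero squares and -1 at some x, which must be a non-square. For
  any other non-square y the product x y is a square, so the value -1 at x forces -1 at y.\<close>

lemma char_square_eq_triv:
  fixes \<chi> :: "'a::finite_field \<Rightarrow> complex"
  assumes odd: "odd CARD('a)" and \<chi>: "\<chi> \<in> mult_chars" and sq: "\<chi> * \<chi> = \<epsilon>" and ne: "\<chi> \<noteq> \<epsilon>"
  shows "\<chi> = \<phi>"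
proof -
  have sq': "\<chi> x * \<chi> x = 1" if "x \<noteq> 0" for x
    using sq that by (metis times_fun_apply triv_char_apply)
  have square: "\<chi> (y\<^sup>2) = 1" if "y \<noteq> 0" for y
    using sq' that by (simp add: power2_eq_square mult_char_mult \<chi>)
  obtain x where x: "x \<noteq> 0" "\<chi> x \<noteq> 1"
    using ne \<chi> by (auto simp: fun_eq_iff triv_char_def mult_char_0 split: if_splits)
  have x1: "\<chi> x = - 1" using sq'[OF x(1)] x(2) by (simp add: square_eq_1_iff)
  have nsq: "\<nexists>z. x = z\<^sup>2" using x square by (metis zero_power2)
  have "\<chi> y = \<phi> y" for y
  proof -
    consider "y = 0" | u where "y = u\<^sup>2" "u \<noteq> 0" | "y \<noteq> 0" "\<nexists>u. y = u\<^sup>2" by fastforce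
    thus ?thesis
    proof cases
      case 3
      then obtain z where z: "x * y = z\<^sup>2" using not_square_mult[OF odd nsq] by blast
      have "z \<noteq> 0" using z x 3 by auto
      hence "\<chi> x * \<chi> y = 1" using square[of z] z by (metis \<chi> mult_char_mult)
      thus ?thesis using 3 x1 by (auto simp: quad_char_def minus_equation_iff)
    qed (auto simp: quad_char_square square mult_char_0 \<chi>, simp add: quad_char_def)
  qed
  thus ?thesis by blast
qed

section \<open>Jacobi sums and Gauss sums\<close>

definition jacobi_sum :: "('a::finite_field \<Rightarrow> complex) \<Rightarrow> ('a \<Rightarrow> complex) \<Rightarrow> complex" where
  "jacobi_sum A B = (\<Sum>x\<in>UNIV. A x * B (1 - x))"

lemma char_binomial_jacobi:
  fixes A B :: "'a::finite_field \<Rightarrow> complex"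
  shows "char_binomial A B = B (- 1) / of_nat CARD('a) * jacobi_sum A (inverse B)"
  by (simp add: char_binomial_def jacobi_sum_def)

lemma jacobi_sum_commute: "jacobi_sum A B = jacobi_sum B A"
  unfolding jacobi_sum_def
  by (subst sum_one_minus[symmetric]) (simp add: mult.commute)

text \<open>The map x to x / (1 - x) carries the field without 1 onto the field without -1, so what
  appears is a complete character sum lacking its value at -1.\<close>

lemma jacobi_sum_inverse:
  fixes A :: "'a::finite_field \<Rightarrow> complex"
  assumes A: "A \<in> mult_chars"
  shows "jacobi_sum A (inverse A) = (of_nat CARD('a) - 1) * delta_char A - A (- 1)"
proof -
  have "jacobi_sum A (inverse A) = (\<Sum>x\<in>UNIV - {1}. A (x / (1 - x)))"
    unfolding jacobi_sum_def
    by (subst sum_UNIV_remove[of _ 1]) (simp add: mult_char_divide mult_char_0 A, simp add: divide_inverse)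
  also have "\<dots> = (\<Sum>y\<in>UNIV - {- 1}. A y)"
    by (rule sum.reindex_bij_witness[of _ "\<lambda>y. y / (1 + y)" "\<lambda>x. x / (1 - x)"])
       (auto simp: divide_simps add_eq_0_iff)
  also have "\<dots> = (\<Sum>y\<in>UNIV. A y) - A (- 1)"
    by (simp add: sum_UNIV_remove[of A "- 1"])
  finally show ?thesis by (simp add: sum_mult_char A)
qed

lemma jacobi_sum_triv:
  fixes A :: "'a::finite_field \<Rightarrow> complex"
  assumes "A \<in> mult_chars"
  shows "jacobi_sum A \<epsilon> = (of_nat CARD('a) - 1) * delta_char A - 1"
proof -
  have "jacobi_sum A \<epsilon> = (\<Sum>x\<in>UNIV. A x) - A 1"
    unfolding jacobi_sum_def
    by (subst (1 2) sum_UNIV_remove[of _ 1]) (auto simp: triv_char_def intro!: sum.cong)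
  thus ?thesis by (simp add: sum_mult_char mult_char_1 assms)
qed

text \<open>Completing the square: x = (1 + s) / 2 turns x (1 - x) into (1 - s^2) / 4, and counting
  the roots of s^2 = t introduces \<phi>. The summand without \<phi> is a full character sum and
  vanishes.\<close>

lemma jacobi_sum_duplication:
  fixes \<chi> :: "'a::finite_field \<Rightarrow> complex"
  assumes odd: "odd CARD('a)" and \<chi>: "\<chi> \<in> mult_chars" "\<chi> \<noteq> \<epsilon>"
  shows "jacobi_sum \<chi> \<chi> = inverse (\<chi> 4) * jacobi_sum \<phi> \<chi>"
proof -
  note 2 = two_nonzero[OF odd]
  define h where "h = inverse (2 :: 'a)"
  have "2 * h = 1" using 2 by (simp add: h_def)
  hence hh: "h + h = 1" by (simp only: mult_2)
  have "inverse (2 * 2 :: 'a) = h * h" unfolding h_def by (rule inverse_mult_distrib)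
  hence h4: "h * h = inverse 4" by simp
  have "jacobi_sum \<chi> \<chi> = (\<Sum>x\<in>UNIV. \<chi> (x * (1 - x)))"
    by (simp add: jacobi_sum_def mult_char_mult \<chi>)
  also have "\<dots> = (\<Sum>s\<in>UNIV. \<chi> (h * s * (1 - h * s)))"
    by (rule sum_scale[symmetric, of h]) (use 2 in \<open>simp add: h_def\<close>)
  also have "\<dots> = (\<Sum>s\<in>UNIV. \<chi> (h * (1 + s) * (1 - h * (1 + s))))"
    by (rule sum_one_plus[symmetric])
  also have "\<dots> = (\<Sum>s\<in>UNIV. \<chi> ((1 - s\<^sup>2) / 4))"
  proof (intro sum.cong refl arg_cong[of _ _ \<chi>])
    fix s :: 'a
    have "1 - h * (1 + s) = h + h - h * (1 + s)" by (simp only: hh)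
    also have "\<dots> = h * (1 - s)" by (simp add: algebra_simps)
    finally have "h * (1 + s) * (1 - h * (1 + s)) = h * (1 + s) * (h * (1 - s))"
      by (simp only:)
    also have "\<dots> = (h * h) * (1 - s\<^sup>2)"
      by (simp add: power2_eq_square algebra_simps)
    finally show "h * (1 + s) * (1 - h * (1 + s)) = (1 - s\<^sup>2) / 4"
      by (simp only: h4 divide_inverse mult.commute)
  qed
  also have "\<dots> = inverse (\<chi> 4) * (\<Sum>s\<in>UNIV. \<chi> (1 - s\<^sup>2))"
    by (simp only: sum_distrib_left mult_char_divide[OF \<chi>(1)]) (simp only: divide_inverse mult.commute)
  also have "(\<Sum>s\<in>UNIV. \<chi> (1 - s\<^sup>2)) = (\<Sum>t\<in>UNIV. \<chi> (1 - t) * (1 + \<phi> t))"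
    by (rule sum_squares_eq[OF odd, of "\<lambda>t. \<chi> (1 - t)"])
  also have "\<dots> = (\<Sum>t\<in>UNIV. \<chi> (1 - t)) + jacobi_sum \<phi> \<chi>"
    by (simp add: jacobi_sum_def sum.distrib algebra_simps)
  also have "(\<Sum>t\<in>UNIV. \<chi> (1 - t)) = 0"
    by (subst sum_one_minus) (simp add: sum_mult_char \<chi> delta_char_def)
  finally show ?thesis by simp
qed

text \<open>These three properties are all that is used of the additive character until the trace
  and \<zeta> return in the last section.\<close>

locale additive_character =
  fixes \<theta> :: "'a::finite_field \<Rightarrow> complex"
  assumes theta_add: "\<theta> (x + y) = \<theta> x * \<theta> y"
    and sum_theta: "(\<Sum>x\<in>UNIV. \<theta> x) = 0"
    and theta_0: "\<theta> 0 = 1"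
begin

definition g :: "('a \<Rightarrow> complex) \<Rightarrow> complex" where
  "g \<chi> = (\<Sum>x\<in>UNIV. \<chi> x * \<theta> x)"

lemma gauss_triv: "g \<epsilon> = - 1"
proof -
  have "g \<epsilon> = (\<Sum>x\<in>UNIV. \<theta> x) - \<theta> 0"
    unfolding g_def by (subst (1 2) sum_UNIV_remove[of _ 0]) (auto simp: triv_char_def intro!: sum.cong)
  thus ?thesis by (simp add: sum_theta theta_0)
qed

text \<open>Rescaling x yields the first summand when t is nonzero. At t = 0 that summand is 0 by
  \<open>inverse 0 = 0\<close>, and the plain character sum that is left is recorded by the deltas;
  this matters later, where t is a product that can vanish.\<close>

lemma gauss_twist:
  assumes \<chi>: "\<chi> \<in> mult_chars"
  shows "(\<Sum>x\<in>UNIV. \<chi> x * \<theta> (x * t)) =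
           g \<chi> * inverse (\<chi> t) + (of_nat CARD('a) - 1) * delta_char \<chi> * delta_elt t"
proof (cases "t = 0")
  case True
  thus ?thesis
    using sum_mult_char[OF \<chi>] by (simp add: theta_0 mult_char_0 \<chi> delta_elt_def)
next
  case False
  have "\<chi> t * (\<Sum>x\<in>UNIV. \<chi> x * \<theta> (x * t)) = (\<Sum>x\<in>UNIV. \<chi> (t * x) * \<theta> (t * x))"
    by (simp add: sum_distrib_left mult_char_mult \<chi> mult_ac)
  also have "\<dots> = g \<chi>"
    unfolding g_def by (rule sum_scale[OF False, of "\<lambda>x. \<chi> x * \<theta> x"])
  finally show ?thesis
    using False by (simp add: delta_elt_def field_simps mult_char_nonzero \<chi>)
qed

text \<open>The double sum is grouped by s = x + y. Fibres with nonzero s are rescaled copies of the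
  Jacobi sum; the fibre s = 0 is a sum of A B and gives the delta term.\<close>

lemma gauss_mult:
  assumes A: "A \<in> mult_chars" and B: "B \<in> mult_chars"
  shows "g A * g B = jacobi_sum A B * g (A * B) + (of_nat CARD('a) - 1) * B (- 1) * delta_char (A * B)"
proof -
  let ?I = "\<lambda>s. \<Sum>x\<in>UNIV. A x * B (s - x)"
  have "g A * g B = (\<Sum>x\<in>UNIV. \<Sum>y\<in>UNIV. A x * \<theta> x * (B y * \<theta> y))"
    by (simp add: g_def sum_product)
  also have "\<dots> = (\<Sum>x\<in>UNIV. \<Sum>s\<in>UNIV. A x * B (s - x) * \<theta> s)"
  proof (rule sum.cong[OF refl])
    fix x :: 'a
    show "(\<Sum>y\<in>UNIV. A x * \<theta> x * (B y * \<theta> y)) = (\<Sum>s\<in>UNIV. A x * B (s - x) * \<theta> s)"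
      by (rule sum.reindex_bij_witness[of _ "\<lambda>s. s - x" "\<lambda>y. x + y"]) (auto simp: theta_add)
  qed
  also have "\<dots> = (\<Sum>s\<in>UNIV. ?I s * \<theta> s)"
    by (subst sum.swap) (simp add: sum_distrib_right)
  also have "\<dots> = ?I 0 + (\<Sum>s\<in>UNIV - {0}. ?I s * \<theta> s)"
    by (subst sum_UNIV_remove[of _ 0]) (simp add: theta_0)
  also have "?I 0 = B (- 1) * (\<Sum>x\<in>UNIV. (A * B) x)"
    unfolding sum_distrib_left
  proof (rule sum.cong[OF refl])
    fix x :: 'a
    show "A x * B (0 - x) = B (- 1) * (A * B) x" using mult_char_minus[OF B, of x] by simp
  qed
  also have "(\<Sum>s\<in>UNIV - {0}. ?I s * \<theta> s) = (\<Sum>s\<in>UNIV - {0}. jacobi_sum A B * ((A * B) s * \<theta> s))"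
  proof (rule sum.cong[OF refl])
    fix s :: 'a assume s: "s \<in> UNIV - {0}"
    have "?I s = (\<Sum>x\<in>UNIV. A (s * x) * B (s - s * x))"
      using s by (intro sum_scale[symmetric]) auto
    also have "\<dots> = (A * B) s * jacobi_sum A B"
      unfolding jacobi_sum_def sum_distrib_left
    proof (rule sum.cong[OF refl])
      fix x :: 'a
      have "s - s * x = s * (1 - x)" by (simp add: algebra_simps)
      thus "A (s * x) * B (s - s * x) = (A * B) s * (A x * B (1 - x))"
        by (simp only: mult_char_mult A B times_fun_apply mult_ac)
    qed
    finally show "?I s * \<theta> s = jacobi_sum A B * ((A * B) s * \<theta> s)" by (simp add: mult_ac)
  qed
  also have "\<dots> = jacobi_sum A B * g (A * B)"
    unfolding g_def sum_distrib_left
    by (subst sum_UNIV_remove[of _ 0]) (simp add: mult_char_0 A)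
  finally show ?thesis
    by (simp add: sum_mult_char[OF times_char_in[OF A B]] del: times_fun_apply)
qed

lemma gauss_inverse:
  assumes A: "A \<in> mult_chars"
  shows "g A * g (inverse A) = A (- 1) * (of_nat CARD('a) - (of_nat CARD('a) - 1) * delta_char A)"
proof -
  have "A * inverse A = \<epsilon>" using inverse_char_mult[OF A] by (simp add: mult.commute)
  thus ?thesis
    using gauss_mult[OF A inverse_char_in[OF A]]
    by (auto simp: jacobi_sum_inverse A gauss_triv inverse_mult_char_minus1 delta_char_def triv_char_def
          algebra_simps)
qed

lemma gauss_inverse_nontriv:
  "A \<in> mult_chars \<Longrightarrow> A \<noteq> \<epsilon> \<Longrightarrow> g A * g (inverse A) = of_nat CARD('a) * A (- 1)"
  by (simp add: gauss_inverse delta_char_def)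

lemma gauss_nonzero:
  assumes A: "A \<in> mult_chars"
  shows "g A \<noteq> 0"
proof (cases "A = \<epsilon>")
  case False
  hence "g A * g (inverse A) \<noteq> 0"
    using mult_char_nonzero[OF A, of "- 1"] by (simp add: gauss_inverse_nontriv A)
  thus ?thesis by auto
qed (simp add: gauss_triv)

lemma jacobi_sum_gauss:
  assumes A: "A \<in> mult_chars" and B: "B \<in> mult_chars" and ne: "A * B \<noteq> \<epsilon>"
  shows "jacobi_sum A B = g A * g B / g (A * B)"
  using gauss_mult[OF A B] ne gauss_nonzero[OF times_char_in[OF A B]] by (simp add: delta_char_def)

text \<open>Replacing \<open>1 / g (A * B)\<close> by \<open>g (inverse (A * B)) * (A * B) (- 1) / q\<close> covers the case
  \<open>A * B = \<epsilon>\<close> as well.\<close>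

lemma jacobi_sum_gauss':
  assumes A: "A \<in> mult_chars" and B: "B \<in> mult_chars" and ne: "B \<noteq> \<epsilon>"
  shows "jacobi_sum A B = g A * g B * g (inverse (A * B)) * (A * B) (- 1) / of_nat CARD('a)"
proof (cases "A * B = \<epsilon>")
  case True
  hence *: "A = inverse B" by (simp add: char_times_eq_triv_iff A B)
  have "jacobi_sum A B = - B (- 1)"
    using jacobi_sum_inverse[OF B] ne unfolding * by (simp add: jacobi_sum_commute delta_char_def)
  moreover have "g A * g B = of_nat CARD('a) * B (- 1)"
    using gauss_inverse_nontriv[OF B ne] unfolding * by (simp add: mult.commute)
  ultimately show ?thesis
    by (simp add: True inverse_triv_char gauss_triv triv_char_def)
next
  case False
  have "g (A * B) * g (inverse (A * B)) = of_nat CARD('a) * (A * B) (- 1)"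
    by (rule gauss_inverse_nontriv) (use A B False in \<open>simp_all add: times_char_in\<close>)
  moreover have "(A * B) (- 1) * (A * B) (- 1) = 1"
    by (rule mult_char_minus1_sq[OF times_char_in[OF A B]])
  ultimately have "of_nat CARD('a) = g (A * B) * g (inverse (A * B)) * (A * B) (- 1)"
    by (metis mult.assoc mult.right_neutral)
  moreover have "(of_nat CARD('a) :: complex) \<noteq> 0" by simp
  ultimately have "1 / g (A * B) = g (inverse (A * B)) * (A * B) (- 1) / of_nat CARD('a)"
    using gauss_nonzero[OF times_char_in[OF A B]] by (simp add: field_simps del: times_fun_apply)
  thus ?thesis
    using jacobi_sum_gauss[OF A B False] by (simp add: divide_inverse mult.assoc)
qed

text \<open>The Hasse-Davenport relation for the quadratic character. Generically it is
  \<open>jacobi_sum_duplication\<close> written in Gauss sums; \<chi> = \<epsilon> and \<chi> =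
  \<phi>, where a product of characters in these quotients becomes trivial, are checked
  directly.\<close>

lemma gauss_duplication:
  assumes odd: "odd CARD('a)" and \<chi>: "\<chi> \<in> mult_chars"
  shows "g \<chi> * g (\<chi> * \<phi>) = inverse (\<chi> 4) * g (\<chi> * \<chi>) * g \<phi>"
proof -
  note \<phi> = quad_char_in[OF odd]
  have 4: "(4 :: 'a) = 2\<^sup>2" by (simp add: power2_eq_square)
  have "(2 :: 'a) \<noteq> 0" by (rule two_nonzero[OF odd])
  consider "\<chi> = \<epsilon>" | "\<chi> = \<phi>" | "\<chi> \<noteq> \<epsilon>" "\<chi> * \<chi> \<noteq> \<epsilon>" "\<chi> * \<phi> \<noteq> \<epsilon>"
    using char_square_eq_triv[OF odd \<chi>] \<chi>
    by (metis \<phi> char_times_eq_triv_iff inverse_quad_char)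
  thus ?thesis
  proof cases
    case 1
    have "\<epsilon> (4 :: 'a) = 1" by (rule triv_char_apply[OF four_nonzero[OF odd]])
    thus ?thesis unfolding 1 by (simp add: triv_char_mult triv_char_in \<phi>)
  next
    case 2
    have "\<phi> (4 :: 'a) = 1" unfolding 4 by (rule quad_char_square) fact
    thus ?thesis unfolding 2 by (simp add: quad_char_sq mult.commute)
  next
    case 3
    have "g \<chi> * g \<chi> / g (\<chi> * \<chi>) = inverse (\<chi> 4) * (g \<phi> * g \<chi> / g (\<chi> * \<phi>))"
      using jacobi_sum_duplication[OF odd \<chi> 3(1)] 3 \<chi> \<phi>
      by (simp add: jacobi_sum_gauss mult.commute)
    thus ?thesis
      using gauss_nonzero[OF \<chi>] gauss_nonzero[OF times_char_in[OF \<chi> \<chi>]]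
        gauss_nonzero[OF times_char_in[OF \<chi> \<phi>]] mult_char_nonzero[OF \<chi> four_nonzero[OF odd]]
      by (simp add: field_simps)
  qed
qed

end

section \<open>The product of two integrals\<close>

definition pair_sum :: "('a::finite_field \<Rightarrow> complex) \<Rightarrow> ('a \<Rightarrow> complex) \<Rightarrow> ('a \<Rightarrow> complex) \<Rightarrow> 'a \<Rightarrow> complex" where
  "pair_sum a b d z = (\<Sum>(u, v)\<in>UNIV. inverse (b u) * inverse (a v) *
     d (u * v - u + z) * inverse (d (u * v - v + z)))"

text \<open>Bookkeeping for a change of variables that matches only \<open>R\<close> with
  \<open>D\<close>: the other sets hold the rest of the two supports, and their sums are to be
  compared afterwards.\<close>

lemma sum_subst_exceptional:
  fixes T U :: "'b::finite \<Rightarrow> complex"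
  assumes "{p. T p \<noteq> 0} \<subseteq> R \<union> R'" "R \<inter> R' = {}"
    and "{p. U p \<noteq> 0} \<subseteq> D \<union> (D1 \<union> D2 \<union> D3)" "D \<inter> (D1 \<union> D2 \<union> D3) = {}"
    and "D1 \<inter> D2 = {}" "(D1 \<union> D2) \<inter> D3 = {}"
    and "sum T R = sum U D"
  shows "sum T UNIV - sum T R' = sum U UNIV - (sum U D1 + sum U D2 + sum U D3)"
proof -
  have "sum T UNIV = sum T (R \<union> R')"
    by (rule sum.mono_neutral_right) (use assms(1) in auto)
  also have "\<dots> = sum T R + sum T R'"
    by (rule sum.union_disjoint) (use assms(2) in auto)
  finally have 1: "sum T UNIV = sum T R + sum T R'" .
  have "sum U UNIV = sum U (D \<union> (D1 \<union> D2 \<union> D3))"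
    by (rule sum.mono_neutral_right) (use assms(3) in auto)
  also have "\<dots> = sum U D + (sum U D1 + sum U D2 + sum U D3)"
    using assms(4-6) by (simp add: sum.union_disjoint)
  finally show ?thesis using 1 assms(7) by simp
qed

lemma substitution_num:
  fixes x y w :: "'a::field"
  assumes "y \<noteq> 0" "w \<noteq> 0"
  shows "(1 - x * w) / y * ((1 - x * y) / w) - (1 - x * w) / y + x * (1 - x) =
         (1 - w) * (1 - x * w - x * y) / (y * w)"
  using assms by (simp add: divide_simps) (simp add: algebra_simps)

text \<open>With u and v as in the substitution, y and w solve the linear system u y + x w = 1, x y
  + v w = 1. Its determinant is u v - x^2, so this identity governs where the substitution can be
  inverted.\<close>

lemma substitution_det:
  fixes x y w :: "'a::field"
  assumes "y \<noteq> 0" "w \<noteq> 0"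
  shows "(1 - x * w) / y * ((1 - x * y) / w) - x * x = (1 - x * w - x * y) / (y * w)"
  using assms by (simp add: divide_simps) (simp add: algebra_simps)

lemma sum_char_except:
  fixes \<chi> :: "'a::finite_field \<Rightarrow> complex"
  assumes "\<chi> \<in> mult_chars" "\<chi> \<noteq> \<epsilon>"
  shows "(\<Sum>u\<in>UNIV - {0, x}. \<chi> u) = - \<chi> x"
proof -
  have "(\<Sum>u\<in>UNIV. \<chi> u) = 0" using assms by (simp add: sum_mult_char delta_char_def)
  moreover have "(\<Sum>u\<in>UNIV. \<chi> u) = (\<Sum>u\<in>UNIV - {x}. \<chi> u) + \<chi> x"
    using sum_UNIV_remove[of \<chi> x] by simp
  moreover have "(\<Sum>u\<in>UNIV - {x}. \<chi> u) = (\<Sum>u\<in>UNIV - {0, x}. \<chi> u)"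
    by (rule sum.mono_neutral_right) (use assms in \<open>auto simp: mult_char_0\<close>)
  ultimately show ?thesis by (simp add: eq_neg_iff_add_eq_0)
qed

text \<open>The contribution of the exceptional line \<open>x * w + x * y = 1\<close> below, where \<open>k = 1 / x - 1\<close>;
  the constant case \<open>k = 1\<close>, that is \<open>x = 1 / 2\<close>, produces the isolated term of the product formula.\<close>

lemma sum_moebius_char:
  fixes d :: "'a::finite_field \<Rightarrow> complex"
  assumes d: "d \<in> mult_chars" "d \<noteq> \<epsilon>" and k: "k \<noteq> 0"
  shows "(\<Sum>y\<in>UNIV. d (y - k) * inverse (d (1 - y))) =
     (of_nat CARD('a) * delta_elt (1 - k) - 1) * d (- 1)"
proof -
  have *: "(\<Sum>y\<in>UNIV. d (y - k) * inverse (d (1 - y))) = (\<Sum>y\<in>UNIV - {1}. d ((y - k) / (1 - y)))"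
    by (subst sum_UNIV_remove[of _ 1]) (simp add: mult_char_0 d mult_char_divide, simp add: divide_inverse)
  show ?thesis
  proof (cases "k = 1")
    case True
    have "(\<Sum>y\<in>UNIV - {1}. d ((y - k) / (1 - y))) = (\<Sum>y\<in>UNIV - {1 :: 'a}. d (- 1))"
    proof (intro sum.cong refl arg_cong[of _ _ d])
      fix y :: 'a assume "y \<in> UNIV - {1}"
      hence "1 - y \<noteq> 0" by auto
      moreover have "y - k = - (1 - y)" using True by simp
      ultimately show "(y - k) / (1 - y) = - 1" by (metis minus_divide_left divide_self)
    qed
    thus ?thesis
      using True card_gt_1[where 'a = 'a] unfolding *
      by (simp add: delta_elt_def card_Diff_singleton of_nat_diff)
  next
    case False
    \<comment> \<open>For k \<noteq> 1 this is a Moebius transformation. It sends 1 to infinity and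
      infinity to -1, so -1 is the only value missed.\<close>
    have "(\<Sum>y\<in>UNIV - {1}. d ((y - k) / (1 - y))) = (\<Sum>t\<in>UNIV - {- 1}. d t)"
    proof (rule sum.reindex_bij_witness[of _ "\<lambda>t. (t + k) / (t + 1)" "\<lambda>y. (y - k) / (1 - y)"])
      fix y assume "y \<in> UNIV - {1 :: 'a}"
      hence y: "1 - y \<noteq> 0" by auto
      have 1: "(y - k) / (1 - y) + 1 = (1 - k) / (1 - y)"
        using y by (simp add: divide_simps)
      have 2: "(y - k) / (1 - y) + k = y * (1 - k) / (1 - y)"
        using y by (simp add: divide_simps) (simp add: algebra_simps)
      show "((y - k) / (1 - y) + k) / ((y - k) / (1 - y) + 1) = y"
        unfolding 1 2 using y False by simp
      show "(y - k) / (1 - y) \<in> UNIV - {- 1}"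
        using 1 y False by (auto simp: eq_neg_iff_add_eq_0)
    next
      fix t assume "t \<in> UNIV - {- 1 :: 'a}"
      hence t: "t + 1 \<noteq> 0" by (auto simp: eq_neg_iff_add_eq_0)
      have 1: "1 - (t + k) / (t + 1) = (1 - k) / (t + 1)"
        using t by (simp add: divide_simps)
      have 2: "(t + k) / (t + 1) - k = t * (1 - k) / (t + 1)"
        using t by (simp add: divide_simps) (simp add: algebra_simps)
      show "((t + k) / (t + 1) - k) / (1 - (t + k) / (t + 1)) = t"
        unfolding 1 2 using t False by simp
      show "(t + k) / (t + 1) \<in> UNIV - {1}"
        using 1 t False by auto
    qed simp
    also have "\<dots> = - d (- 1)"
      using sum_UNIV_remove[of d "- 1"] sum_mult_char[OF d(1)] d(2)
      by (simp add: delta_char_def eq_neg_iff_add_eq_0 add.commute)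
    finally show ?thesis using False unfolding * by (simp add: delta_elt_def)
  qed
qed

text \<open>The substitution is a bijection away from the line \<open>x * w + x * y = 1\<close> on one side and from the
  curves \<open>u = x\<close>, \<open>v = x\<close>, \<open>u * v = x\<^sup>2\<close> on the other.\<close>

lemma integral_product:
  fixes a b d :: "'a::finite_field \<Rightarrow> complex"
  assumes a: "a \<in> mult_chars" "a \<noteq> \<epsilon>" and b: "b \<in> mult_chars" "b \<noteq> \<epsilon>"
    and d: "d \<in> mult_chars" "d \<noteq> \<epsilon>"
    and adb: "a * d \<noteq> b" and x0: "x \<noteq> 0" and x1: "x \<noteq> 1"
  shows "(\<Sum>y\<in>UNIV. b y * inverse (d (1 - y)) * inverse (a (1 - x * y))) *
         (\<Sum>w\<in>UNIV. a w * d (1 - w) * inverse (b (1 - x * w))) =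
         pair_sum a b d (x * (1 - x)) +
         of_nat CARD('a) * d (- 1) * inverse (a x) * inverse (b x) * delta_elt (1 - 2 * x)"
proof -
  note nz = mult_char_eq_0_iff[OF a(1)] mult_char_eq_0_iff[OF b(1)] mult_char_eq_0_iff[OF d(1)]
  define T where "T = (\<lambda>(y, w). b y * inverse (d (1 - y)) * inverse (a (1 - x * y)) *
      (a w * d (1 - w) * inverse (b (1 - x * w))))"
  define U where "U = (\<lambda>(u, v). inverse (b u) * inverse (a v) *
      d (u * v - u + x * (1 - x)) * inverse (d (u * v - v + x * (1 - x))))"
  define R where "R = {(y, w). y \<noteq> 0 \<and> w \<noteq> 0 \<and> 1 - x * y \<noteq> 0 \<and> 1 - x * w \<noteq> 0 \<and> 1 - x * w - x * y \<noteq> 0}"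
  define R' where "R' = {(y, w). y \<noteq> 0 \<and> w \<noteq> 0 \<and> 1 - x * w - x * y = 0}"
  define D where "D = {(u, v). u \<noteq> 0 \<and> v \<noteq> 0 \<and> u \<noteq> x \<and> v \<noteq> x \<and> u * v - x * x \<noteq> 0}"
  \<comment> \<open>The common point u = v = x is left out of all three curves: both arguments of
    \<open>d\<close> vanish there.\<close>
  define D1 where "D1 = {(u, v). u \<noteq> 0 \<and> u \<noteq> x \<and> v = x}"
  define D2 where "D2 = {(u, v). v \<noteq> 0 \<and> v \<noteq> x \<and> u = x}"
  define D3 where "D3 = {(u, v). u \<noteq> 0 \<and> u \<noteq> x \<and> v = x * x / u}"
  have TU: "T (y, w) = U ((1 - x * w) / y, (1 - x * y) / w)" if "(y, w) \<in> R" for y w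
  proof -
    have ne: "y \<noteq> 0" "w \<noteq> 0" "1 - x * w - x * y \<noteq> 0" using that by (auto simp: R_def)
    have 1: "(1 - x * w) / y * ((1 - x * y) / w) - (1 - x * w) / y + x * (1 - x) =
         (1 - w) * (1 - x * w - x * y) / (y * w)"
      by (rule substitution_num) fact+
    have 2: "(1 - x * w) / y * ((1 - x * y) / w) - (1 - x * y) / w + x * (1 - x) =
         (1 - y) * (1 - x * w - x * y) / (y * w)"
    proof -
      have "1 - x * y - x * w = 1 - x * w - x * y" by simp
      thus ?thesis
        using substitution_num[OF ne(2,1), of x]
        by (simp only: mult.commute[of "(1 - x * y) / w"] mult.commute[of w y])
    qed
    \<comment> \<open>Both arguments contain the factor (1 - x w - x y) / (y w), which is nonzero on
      \<open>R\<close> and cancels in the quotient.\<close>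
    have "d ((1 - w) * (1 - x * w - x * y) / (y * w)) * inverse (d ((1 - y) * (1 - x * w - x * y) / (y * w)))
        = d (1 - w) * inverse (d (1 - y))"
      using ne by (simp add: mult_char_mult mult_char_divide d divide_simps nz)
    moreover have "inverse (b ((1 - x * w) / y)) * inverse (a ((1 - x * y) / w)) =
        b y * inverse (b (1 - x * w)) * (a w * inverse (a (1 - x * y)))"
      by (simp add: mult_char_divide a b divide_simps)
    ultimately show ?thesis
      unfolding T_def U_def prod.case 1 2 by (simp add: mult_ac)
  qed
  have RD: "sum T R = sum U D"
  proof (rule sum.reindex_bij_witness[of _ "\<lambda>(u, v). ((v - x) / (u * v - x * x), (u - x) / (u * v - x * x))"
        "\<lambda>(y, w). ((1 - x * w) / y, (1 - x * y) / w)"]; safe)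
    fix y w assume R: "(y, w) \<in> R"
    hence ne: "y \<noteq> 0" "w \<noteq> 0" "1 - x * w - x * y \<noteq> 0" "1 - x * y \<noteq> 0" "1 - x * w \<noteq> 0"
      by (auto simp: R_def)
    note det = substitution_det[OF ne(1,2), of x]
    have u: "(1 - x * w) / y - x = (1 - x * w - x * y) / y"
      and v: "(1 - x * y) / w - x = (1 - x * w - x * y) / w"
      using ne by (simp_all add: divide_simps)
    show "((1 - x * y) / w - x) / ((1 - x * w) / y * ((1 - x * y) / w) - x * x) = y"
      "((1 - x * w) / y - x) / ((1 - x * w) / y * ((1 - x * y) / w) - x * x) = w"
      unfolding det u v using ne by simp_all
    have "(1 - x * w) / y - x \<noteq> 0" "(1 - x * y) / w - x \<noteq> 0"
      unfolding u v using ne by simp_all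
    moreover have "(1 - x * w) / y * ((1 - x * y) / w) - x * x \<noteq> 0"
      unfolding det using ne by simp
    ultimately show "((1 - x * w) / y, (1 - x * y) / w) \<in> D"
      unfolding D_def using ne by (auto simp: mult.commute[of w y])
    show "U ((1 - x * w) / y, (1 - x * y) / w) = T (y, w)"
      by (rule TU[OF R, symmetric])
  next
    fix u v assume "(u, v) \<in> D"
    define e where "e = u * v - x * x"
    have ne: "u \<noteq> 0" "v \<noteq> 0" "u - x \<noteq> 0" "v - x \<noteq> 0" "e \<noteq> 0"
      using \<open>(u, v) \<in> D\<close> by (auto simp: D_def e_def)
    have 1: "1 - x * ((u - x) / e) = u * (v - x) / e" "1 - x * ((v - x) / e) = v * (u - x) / e"
      using ne(5) by (simp_all add: divide_simps) (simp_all add: e_def algebra_simps)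
    have 2: "1 - x * ((u - x) / e) - x * ((v - x) / e) = (u - x) * (v - x) / e"
      using ne(5) by (simp add: divide_simps) (simp add: e_def algebra_simps)
    show "(1 - x * ((u - x) / (u * v - x * x))) / ((v - x) / (u * v - x * x)) = u"
      "(1 - x * ((v - x) / (u * v - x * x))) / ((u - x) / (u * v - x * x)) = v"
      unfolding e_def[symmetric] 1 using ne by simp_all
    show "((v - x) / (u * v - x * x), (u - x) / (u * v - x * x)) \<in> R"
      unfolding R_def e_def[symmetric] mem_Collect_eq prod.case 2 unfolding 1 using ne by simp
  qed
  have disj: "{p. T p \<noteq> 0} \<subseteq> R \<union> R'" "R \<inter> R' = {}"
    "{p. U p \<noteq> 0} \<subseteq> D \<union> (D1 \<union> D2 \<union> D3)" "D \<inter> (D1 \<union> D2 \<union> D3) = {}"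
    "D1 \<inter> D2 = {}" "(D1 \<union> D2) \<inter> D3 = {}"
  proof -
    show "{p. T p \<noteq> 0} \<subseteq> R \<union> R'"
      by (auto simp: T_def R_def R'_def nz)
    show "{p. U p \<noteq> 0} \<subseteq> D \<union> (D1 \<union> D2 \<union> D3)"
      by (auto simp: U_def D_def D1_def D2_def D3_def nz algebra_simps nonzero_eq_divide_eq)
    show "D \<inter> (D1 \<union> D2 \<union> D3) = {}" "(D1 \<union> D2) \<inter> D3 = {}"
      using x0 by (auto simp: D_def D1_def D2_def D3_def nonzero_divide_eq_eq)
  qed (auto simp: R_def R'_def D1_def D2_def)
  note split = sum_subst_exceptional[OF disj RD]
  define k where "k = 1 / x - 1"
  have k: "k \<noteq> 0" using x0 x1 by (simp add: k_def)
  define ab where "ab = inverse (a x) * inverse (b x)"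
  \<comment> \<open>On v = x the two arguments of \<open>d\<close> have the constant quotient -k, so
    only a character sum over u remains, without its value at x. The curve u = x gives the
    reciprocal constant.\<close>
  have sumD1: "sum U D1 = - ab * d (- k)"
  proof -
    have "sum U D1 = (\<Sum>u\<in>UNIV - {0, x}. inverse b u * (inverse (a x) * d (- k)))"
    proof (rule sum.reindex_bij_witness[of _ "\<lambda>u. (u, x)" fst])
      fix p assume "p \<in> D1"
      then obtain u where p: "p = (u, x)" "u \<noteq> 0" "u \<noteq> x" by (auto simp: D1_def)
      have 1: "u * x - u + x * (1 - x) = - k * (x * (u - x))" "u * x - x + x * (1 - x) = x * (u - x)"
        using x0 by (simp_all add: k_def algebra_simps)
      have "d (- k * (x * (u - x))) * inverse (d (x * (u - x))) = d (- k)"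
        using p(3) x0 unfolding mult_char_mult[OF d(1), of "- k"] by (simp add: nz)
      thus "inverse b (fst p) * (inverse (a x) * d (- k)) = U p"
        unfolding p(1) U_def prod.case 1 by simp
    qed (auto simp: D1_def)
    also have "\<dots> = - inverse b x * (inverse (a x) * d (- k))"
      unfolding sum_distrib_right[symmetric]
      by (subst sum_char_except) (use b in \<open>auto simp: inverse_char_in inverse_char_eq_triv\<close>)
    finally show ?thesis by (simp add: ab_def)
  qed
  have sumD2: "sum U D2 = - ab * inverse (d (- k))"
  proof -
    have "sum U D2 = (\<Sum>v\<in>UNIV - {0, x}. inverse a v * (inverse (b x) * inverse (d (- k))))"
    proof (rule sum.reindex_bij_witness[of _ "\<lambda>v. (x, v)" snd])
      fix p assume "p \<in> D2"
      then obtain v where p: "p = (x, v)" "v \<noteq> 0" "v \<noteq> x" by (auto simp: D2_def)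
      have 1: "x * v - v + x * (1 - x) = - k * (x * (v - x))" "x * v - x + x * (1 - x) = x * (v - x)"
        using x0 by (simp_all add: k_def algebra_simps)
      have "d (x * (v - x)) * inverse (d (- k * (x * (v - x)))) = inverse (d (- k))"
        using p(3) x0 unfolding mult_char_mult[OF d(1), of "- k"] by (simp add: nz)
      thus "inverse a (snd p) * (inverse (b x) * inverse (d (- k))) = U p"
        unfolding p(1) U_def prod.case 1 by simp
    qed (auto simp: D2_def)
    also have "\<dots> = - inverse a x * (inverse (b x) * inverse (d (- k)))"
      unfolding sum_distrib_right[symmetric]
      by (subst sum_char_except) (use a in \<open>auto simp: inverse_char_in inverse_char_eq_triv\<close>)
    finally show ?thesis by (simp add: ab_def)
  qed
  have sumD3: "sum U D3 = - ab * d (- 1)"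
  proof -
    \<comment> \<open>On u v = x^2 the arguments of \<open>d\<close> are -(u - x) and x (u - x) / u.
      Their quotient is a multiple of u, so the summand is a constant times \<open>c u\<close>; the
      hypothesis \<open>a * d \<noteq> b\<close> makes \<open>c\<close> nontrivial.\<close>
    define c where "c = a * d * inverse b"
    have c: "c \<in> mult_chars" "c \<noteq> \<epsilon>"
      using adb a b d by (simp_all add: c_def mult_char_closed char_times_eq_triv_iff inverse_inverse_char)
    have "sum U D3 = (\<Sum>u\<in>UNIV - {0, x}. c u * (inverse (a x) * inverse (a x) * inverse (d x) * d (- 1)))"
    proof (rule sum.reindex_bij_witness[of _ "\<lambda>u. (u, x * x / u)" fst])
      fix p assume "p \<in> D3"
      then obtain u where p: "p = (u, x * x / u)" "u \<noteq> 0" "u \<noteq> x" by (auto simp: D3_def)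
      have 1: "u * (x * x / u) - u + x * (1 - x) = - 1 * (u - x)"
        "u * (x * x / u) - x * x / u + x * (1 - x) = x * (u - x) / u"
        using p(2) by (simp_all add: divide_simps) (simp_all add: algebra_simps)
      have 2: "inverse (a (x * x / u)) = a u * inverse (a x) * inverse (a x)"
        by (simp add: mult_char_divide[OF a(1)] mult_char_mult[OF a(1)]) (simp add: divide_inverse)
      have 3: "c u = a u * d u * inverse (b u)" by (simp add: c_def)
      have 4: "d (- 1 * (u - x)) * inverse (d (x * (u - x) / u)) = d (- 1) * d u * inverse (d x)"
        using p by (simp only: mult_char_mult[OF d(1)] mult_char_divide[OF d(1)])
           (simp add: nz divide_simps)
      show "c (fst p) * (inverse (a x) * inverse (a x) * inverse (d x) * d (- 1)) = U p"
        unfolding p(1) U_def prod.case 1 fst_conv 2 3 by (simp only: mult.assoc 4) (simp only: mult_ac)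
    qed (auto simp: D3_def)
    also have "\<dots> = - c x * (inverse (a x) * inverse (a x) * inverse (d x) * d (- 1))"
      unfolding sum_distrib_right[symmetric] by (subst sum_char_except[OF c]) simp
    also have "\<dots> = - ab * d (- 1)"
      using x0 by (simp add: c_def ab_def nz divide_simps)
    finally show ?thesis .
  qed
  \<comment> \<open>Since 1 / x = 1 + k, the line is w = 1 + k - y, and on it the factors from
    \<open>a\<close> and \<open>b\<close> collapse to the constant \<open>ab\<close>. The excluded
    points y = 0 and w = 0 produce \<open>d (- k)\<close> and its inverse, which match
    \<open>D1\<close> and \<open>D2\<close>; the -1 in \<open>sum_moebius_char\<close> matches
    \<open>D3\<close>. Only the multiple of q survives the comparison.\<close>
  have sumR': "sum T R' = ab * ((of_nat CARD('a) * delta_elt (1 - k) - 1) * d (- 1) - d (- k) - inverse (d (- k)))"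
  proof -
    have "sum T R' = (\<Sum>y\<in>UNIV - {0, 1 + k}. ab * (d (y - k) * inverse (d (1 - y))))"
    proof (rule sum.reindex_bij_witness[of _ "\<lambda>y. (y, 1 + k - y)" fst])
      fix p assume "p \<in> R'"
      then obtain y w where p: "p = (y, w)" "y \<noteq> 0" "w \<noteq> 0" "1 - x * w - x * y = 0"
        by (auto simp: R'_def)
      have w: "w = 1 + k - y"
        using p(4) x0 by (simp add: k_def field_simps)
      have e: "1 - x * w = x * y" "1 - x * y = x * w" using p(4) by (simp_all add: algebra_simps)
      show "(fst p, 1 + k - fst p) = p" by (simp add: p(1) w)
      show "fst p \<in> UNIV - {0, 1 + k}" using p(1-3) w by auto
      have "1 - w = y - k" by (simp add: w)
      thus "ab * (d (fst p - k) * inverse (d (1 - fst p))) = T p"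
        unfolding p(1) T_def prod.case e fst_conv
        using p(2,3) x0 by (simp add: ab_def nz mult_char_mult a b divide_simps)
    next
      fix y assume "y \<in> UNIV - {0, 1 + k}"
      moreover have "1 - x * (1 + k - y) - x * y = 0" using x0 by (simp add: k_def algebra_simps)
      ultimately show "(y, 1 + k - y) \<in> R'" by (auto simp: R'_def)
    qed simp
    also have "(\<Sum>y\<in>UNIV - {0, 1 + k}. ab * (d (y - k) * inverse (d (1 - y)))) =
        ab * (\<Sum>y\<in>UNIV - {0} - {1 + k}. d (y - k) * inverse (d (1 - y)))"
      unfolding sum_distrib_left by (rule sum.cong) auto
    also have "(\<Sum>y\<in>UNIV - {0} - {1 + k}. d (y - k) * inverse (d (1 - y))) =
        (\<Sum>y\<in>UNIV. d (y - k) * inverse (d (1 - y))) - d (- k) - inverse (d (- k))"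
    proof -
      have "1 + k \<noteq> 0" using x0 by (simp add: k_def)
      hence "(\<Sum>y\<in>UNIV - {0}. d (y - k) * inverse (d (1 - y))) = inverse (d (- k)) +
        (\<Sum>y\<in>UNIV - {0} - {1 + k}. d (y - k) * inverse (d (1 - y)))"
        by (subst sum.remove[of _ "1 + k"]) (simp_all add: mult_char_1[OF d(1)])
      moreover have "(\<Sum>y\<in>UNIV. d (y - k) * inverse (d (1 - y))) =
          d (- k) + (\<Sum>y\<in>UNIV - {0}. d (y - k) * inverse (d (1 - y)))"
        by (subst sum_UNIV_remove[of _ 0]) (simp add: mult_char_1[OF d(1)])
      ultimately show ?thesis by (simp only: add_diff_cancel_left')
    qed
    also have "(\<Sum>y\<in>UNIV. d (y - k) * inverse (d (1 - y))) =
        (of_nat CARD('a) * delta_elt (1 - k) - 1) * d (- 1)"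
      by (rule sum_moebius_char[OF d k])
    finally show ?thesis .
  qed
  have "1 - k = 0 \<longleftrightarrow> 1 - 2 * x = 0"
  proof -
    have "x * (1 - k) = - (1 - 2 * x)" using x0 by (simp add: k_def algebra_simps)
    thus ?thesis using x0 by (metis mult_eq_0_iff neg_equal_0_iff_equal)
  qed
  hence delta: "delta_elt (1 - k) = delta_elt (1 - 2 * x)"
    by (simp add: delta_elt_def)
  have "sum T UNIV = sum U UNIV + of_nat CARD('a) * d (- 1) * ab * delta_elt (1 - 2 * x)"
    using split unfolding sumD1 sumD2 sumD3 sumR' delta by (simp add: algebra_simps)
  moreover have "sum U UNIV = pair_sum a b d (x * (1 - x))"
    by (simp add: U_def pair_sum_def)
  moreover have "(\<Sum>y\<in>UNIV. b y * inverse (d (1 - y)) * inverse (a (1 - x * y))) *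
         (\<Sum>w\<in>UNIV. a w * d (1 - w) * inverse (b (1 - x * w))) = sum T UNIV"
    unfolding T_def sum_product by (simp add: sum.cartesian_product)
  ultimately show ?thesis by (simp add: ab_def mult_ac)
qed

section \<open>The Mellin transform of the product\<close>

lemma sum_rotate4:
  "(\<Sum>s\<in>A. \<Sum>t\<in>B. \<Sum>v\<in>C. \<Sum>w\<in>D. F s t v w) = (\<Sum>v\<in>C. \<Sum>w\<in>D. \<Sum>s\<in>A. \<Sum>t\<in>B. F s t v w)"
proof -
  have "(\<Sum>s\<in>A. \<Sum>t\<in>B. \<Sum>v\<in>C. \<Sum>w\<in>D. F s t v w) = (\<Sum>s\<in>A. \<Sum>v\<in>C. \<Sum>w\<in>D. \<Sum>t\<in>B. F s t v w)"
    by (rule sum.cong[OF refl], subst sum.swap, rule sum.cong[OF refl], rule sum.swap)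
  also have "\<dots> = (\<Sum>v\<in>C. \<Sum>w\<in>D. \<Sum>s\<in>A. \<Sum>t\<in>B. F s t v w)"
    by (subst sum.swap, rule sum.cong[OF refl], rule sum.swap)
  finally show ?thesis .
qed

lemma sum_char_one_plus:
  fixes \<psi> :: "'a::finite_field \<Rightarrow> complex"
  assumes "\<psi> \<in> mult_chars"
  shows "(\<Sum>k\<in>UNIV. \<psi> k * \<mu> (1 + k)) = \<psi> (- 1) * jacobi_sum \<psi> \<mu>"
proof -
  have "(\<Sum>k\<in>UNIV. \<psi> k * \<mu> (1 + k)) = (\<Sum>k\<in>UNIV. \<psi> (- k) * \<mu> (1 + - k))"
    by (rule sum_uminus[symmetric])
  also have "\<dots> = \<psi> (- 1) * jacobi_sum \<psi> \<mu>"
    unfolding jacobi_sum_def sum_distrib_left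
    by (rule sum.cong[OF refl]) (subst mult_char_minus[OF assms], simp)
  finally show ?thesis .
qed

text \<open>Evenness of a and b makes the sign change of both variables free. The all-plus form is
  the one that comes out of exponents of \<theta>.\<close>

lemma pair_sum_uminus:
  fixes a b d :: "'a::finite_field \<Rightarrow> complex"
  assumes a: "a \<in> mult_chars" "a (- 1) = 1" and b: "b \<in> mult_chars" "b (- 1) = 1"
  shows "pair_sum a b d z = (\<Sum>u\<in>UNIV. \<Sum>v\<in>UNIV. inverse (b u) * inverse (a v) *
     d (u * v + u + z) * inverse (d (u * v + v + z)))"
proof -
  have even: "a (- v) = a v" "b (- v) = b v" for v
    using mult_char_minus[OF a(1), of v] mult_char_minus[OF b(1), of v] a(2) b(2) by simp_all
  have "pair_sum a b d z = (\<Sum>u\<in>UNIV. \<Sum>v\<in>UNIV. inverse (b u) * inverse (a v) *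
     d (u * v - u + z) * inverse (d (u * v - v + z)))"
    by (simp add: pair_sum_def sum.cartesian_product)
  also have "\<dots> = (\<Sum>u\<in>UNIV. \<Sum>v\<in>UNIV. inverse (b (- u)) * inverse (a (- v)) *
     d (- u * - v - - u + z) * inverse (d (- u * - v - - v + z)))"
    by (subst sum_uminus[symmetric], rule sum.cong[OF refl], rule sum_uminus[symmetric])
  also have "\<dots> = (\<Sum>u\<in>UNIV. \<Sum>v\<in>UNIV. inverse (b u) * inverse (a v) *
     d (u * v + u + z) * inverse (d (u * v + v + z)))"
    by (simp add: even)
  finally show ?thesis .
qed

context additive_character
begin

text \<open>\<open>bessel_pair c c' u\<close> is the product of the finite field Bessel functions (twisted Kloosterman sums) of
  \<open>c\<close> and \<open>c'\<close> at \<open>u\<close>, and \<open>bessel_transform\<close> the resulting Appell \<open>F\<^sub>4\<close> function on the diagonal.\<close>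

definition bessel_pair :: "('a \<Rightarrow> complex) \<Rightarrow> ('a \<Rightarrow> complex) \<Rightarrow> 'a \<Rightarrow> complex" where
  "bessel_pair c c' u = (\<Sum>v\<in>UNIV. \<Sum>w\<in>UNIV. inverse (c v) * inverse (c' w) * \<theta> (v + u / v + w + u / w))"

definition bessel_transform ::
  "('a \<Rightarrow> complex) \<Rightarrow> ('a \<Rightarrow> complex) \<Rightarrow> ('a \<Rightarrow> complex) \<Rightarrow> ('a \<Rightarrow> complex) \<Rightarrow> 'a \<Rightarrow> complex" where
  "bessel_transform a b c c' z =
     (\<Sum>s\<in>UNIV. \<Sum>t\<in>UNIV. b s * a t * \<theta> (s + t) * bessel_pair c c' (s * t * z))"

text \<open>Replacing v by s v and w by t w makes the whole exponent linear in s and t, and the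
  choice of c' makes the characters of s and t mutually inverse. The sums over s and t are then
  twisted Gauss sums of \<open>d\<close> and \<open>inverse d\<close>, without delta terms as
  \<open>d \<noteq> \<epsilon>\<close>. Clearing the denominators w and v of their arguments gives
  the two arguments in \<open>pair_sum\<close>.\<close>

lemma pair_sum_bessel:
  fixes a b c c' d :: "'a \<Rightarrow> complex"
  assumes a: "a \<in> mult_chars" "a (- 1) = 1" and b: "b \<in> mult_chars" "b (- 1) = 1"
    and c: "c \<in> mult_chars" and c': "c' = a * b * inverse c" and d: "d = b * inverse c"
    and ne: "d \<noteq> \<epsilon>" and z: "z \<noteq> 0"
  shows "of_nat CARD('a) * c (- 1) * pair_sum a b d z = bessel_transform a b c c' z"
proof -
  note cm = a(1) b(1) c
  have d_in: "d \<in> mult_chars" "inverse d \<in> mult_chars" and c'_in: "c' \<in> mult_chars"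
    by (simp_all add: c' d mult_char_closed cm)
  note nz = mult_char_eq_0_iff[OF a(1)] mult_char_eq_0_iff[OF b(1)] mult_char_eq_0_iff[OF c]
  have d1: "d (- 1) = c (- 1)"
    by (simp add: d b inverse_mult_char_minus1 c)
  have delta: "delta_char d = 0" "delta_char (inverse d) = 0"
    using ne by (simp_all add: delta_char_def inverse_char_eq_triv)
  define P where "P v w = 1 + v + z / w" for v w :: 'a
  have "bessel_transform a b c c' z = (\<Sum>s\<in>UNIV. \<Sum>t\<in>UNIV. \<Sum>v\<in>UNIV. \<Sum>w\<in>UNIV.
      inverse (c v) * inverse (c' w) * ((d s * \<theta> (s * P v w)) * (inverse d t * \<theta> (t * P w v))))"
    unfolding bessel_transform_def
  proof (intro sum.cong refl)
    fix s t :: 'a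
    show "b s * a t * \<theta> (s + t) * bessel_pair c c' (s * t * z) = (\<Sum>v\<in>UNIV. \<Sum>w\<in>UNIV.
      inverse (c v) * inverse (c' w) * ((d s * \<theta> (s * P v w)) * (inverse d t * \<theta> (t * P w v))))"
    proof (cases "s = 0 \<or> t = 0")
      case True
      thus ?thesis
        using mult_char_0[OF a(1)] mult_char_0[OF b(1)] mult_char_0[OF d_in(1)] by auto
    next
      case False
      have "bessel_pair c c' (s * t * z) = (\<Sum>v\<in>UNIV. \<Sum>w\<in>UNIV.
          inverse (c (s * v)) * inverse (c' (t * w)) * \<theta> (s * v + s * t * z / (s * v) + t * w + s * t * z / (t * w)))"
      proof -
        have "bessel_pair c c' (s * t * z) = (\<Sum>v\<in>UNIV. \<Sum>w\<in>UNIV.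
          inverse (c (s * v)) * inverse (c' w) * \<theta> (s * v + s * t * z / (s * v) + w + s * t * z / w))"
          unfolding bessel_pair_def using False by (intro sum_scale[symmetric]) auto
        also have "\<dots> = (\<Sum>v\<in>UNIV. \<Sum>w\<in>UNIV.
          inverse (c (s * v)) * inverse (c' (t * w)) * \<theta> (s * v + s * t * z / (s * v) + t * w + s * t * z / (t * w)))"
          using False by (intro sum.cong[OF refl] sum_scale[symmetric]) auto
        finally show ?thesis .
      qed
      moreover have "b s * a t * \<theta> (s + t) * (inverse (c (s * v)) * inverse (c' (t * w)) *
          \<theta> (s * v + s * t * z / (s * v) + t * w + s * t * z / (t * w))) =
          inverse (c v) * inverse (c' w) * ((d s * \<theta> (s * P v w)) * (inverse d t * \<theta> (t * P w v)))" for v w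
      proof -
        have "s + t + (s * v + s * t * z / (s * v) + t * w + s * t * z / (t * w)) = s * P v w + t * P w v"
          using False by (simp add: P_def algebra_simps)
        hence th: "\<theta> (s + t) * \<theta> (s * v + s * t * z / (s * v) + t * w + s * t * z / (t * w)) =
            \<theta> (s * P v w) * \<theta> (t * P w v)"
          by (simp only: theta_add[symmetric])
        have ch: "b s * a t * (inverse (c (s * v)) * inverse (c' (t * w))) =
            inverse (c v) * inverse (c' w) * (d s * inverse d t)"
        proof -
          have inv: "inverse (a t * b t * inverse (c t)) = inverse (a t) * inverse (b t) * c t"
            "inverse (b t * inverse (c t)) = inverse (b t) * c t" "a t * inverse (a t) = 1"
            using False by (simp_all add: nz)
          have "b s * a t * (inverse (c s) * inverse (c' t)) =
              (a t * inverse (a t)) * (b s * inverse (c s) * (inverse (b t) * c t))"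
            unfolding c' times_fun_apply inverse_fun_apply inv(1) by (simp only: mult_ac)
          also have "\<dots> = d s * inverse d t"
            unfolding d times_fun_apply inverse_fun_apply inv(2,3) by simp
          finally have 1: "b s * a t * (inverse (c s) * inverse (c' t)) = d s * inverse d t" .
          have "b s * a t * (inverse (c (s * v)) * inverse (c' (t * w))) =
              inverse (c v) * inverse (c' w) * (b s * a t * (inverse (c s) * inverse (c' t)))"
            unfolding mult_char_mult[OF c] mult_char_mult[OF c'_in] inverse_mult_distrib
            by (simp only: mult_ac)
          thus ?thesis by (simp only: 1)
        qed
        have ms: "b s * a t * \<theta> (s + t) * (inverse (c (s * v)) * inverse (c' (t * w)) * Th) =
            (b s * a t * (inverse (c (s * v)) * inverse (c' (t * w)))) * (\<theta> (s + t) * Th)" for Th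
          by (simp only: mult_ac)
        show ?thesis unfolding ms ch th by (simp only: mult_ac)
      qed
      ultimately show ?thesis by (simp only: sum_distrib_left)
    qed
  qed
  also have "\<dots> = (\<Sum>v\<in>UNIV. \<Sum>w\<in>UNIV. inverse (c v) * inverse (c' w) *
      ((\<Sum>s\<in>UNIV. d s * \<theta> (s * P v w)) * (\<Sum>t\<in>UNIV. inverse d t * \<theta> (t * P w v))))"
    unfolding sum_product unfolding sum_distrib_left by (rule sum_rotate4)
  also have "\<dots> = (\<Sum>v\<in>UNIV. \<Sum>w\<in>UNIV. g d * g (inverse d) *
      (inverse (b v) * inverse (a w) * d (v * w + v + z) * inverse (d (v * w + w + z))))"
  proof (intro sum.cong refl)
    fix v w :: 'a
    have tw: "(\<Sum>s\<in>UNIV. d s * \<theta> (s * P v w)) = g d * inverse (d (P v w))"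
      "(\<Sum>t\<in>UNIV. inverse d t * \<theta> (t * P w v)) = g (inverse d) * d (P w v)"
      using gauss_twist[OF d_in(1), of "P v w"] gauss_twist[OF d_in(2), of "P w v"]
      by (simp_all only: delta mult_zero_left mult_zero_right add_0_right inverse_fun_apply inverse_inverse_eq)
    have ch: "inverse (c v) * inverse (c' w) * (inverse (d (P v w)) * d (P w v)) =
        inverse (b v) * inverse (a w) * d (v * w + v + z) * inverse (d (v * w + w + z))"
    proof (cases "v = 0 \<or> w = 0")
      case True
      thus ?thesis
        using mult_char_0[OF a(1)] mult_char_0[OF b(1)] mult_char_0[OF c] mult_char_0[OF c'_in] by auto
    next
      case False
      hence hP: "P v w = (v * w + w + z) / w" "P w v = (v * w + v + z) / v"
        by (simp_all add: P_def field_simps)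
      have "inverse (d (P v w)) * d (P w v) =
          d w * inverse (d v) * (d (v * w + v + z) * inverse (d (v * w + w + z)))"
        unfolding hP mult_char_divide[OF d_in(1)] by (simp add: divide_inverse mult_ac)
      moreover have "inverse (c v) * inverse (c' w) * (d w * inverse (d v)) = inverse (b v) * inverse (a w)"
        using False by (simp add: d c' nz field_simps)
      ultimately show ?thesis by (metis mult.assoc)
    qed
    show "inverse (c v) * inverse (c' w) *
        ((\<Sum>s\<in>UNIV. d s * \<theta> (s * P v w)) * (\<Sum>t\<in>UNIV. inverse d t * \<theta> (t * P w v))) =
        g d * g (inverse d) * (inverse (b v) * inverse (a w) * d (v * w + v + z) * inverse (d (v * w + w + z)))"
      unfolding tw ch[symmetric] by (simp only: mult_ac)
  qed
  also have "\<dots> = g d * g (inverse d) * pair_sum a b d z"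
    by (simp only: pair_sum_uminus[OF a b] sum_distrib_left)
  also have "g d * g (inverse d) = of_nat CARD('a) * c (- 1)"
    by (simp only: gauss_inverse_nontriv[OF d_in(1) ne] d1)
  finally show ?thesis ..
qed

text \<open>The Bessel product depends on s, t, z only through s t z. Rescaling z therefore moves N
  s and N t to the outer sums, where they complete the two Gauss sums.\<close>

lemma mellin_bessel_transform:
  fixes a b c c' N :: "'a \<Rightarrow> complex"
  assumes a: "a \<in> mult_chars" and b: "b \<in> mult_chars" and N: "N \<in> mult_chars"
  shows "(\<Sum>z\<in>UNIV. inverse N z * bessel_transform a b c c' z) =
     g (a * N) * g (b * N) * (\<Sum>u\<in>UNIV. inverse N u * bessel_pair c c' u)"
proof -
  let ?H = "\<Sum>u\<in>UNIV. inverse N u * bessel_pair c c' u"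
  have "(\<Sum>z\<in>UNIV. inverse N z * bessel_transform a b c c' z) =
      (\<Sum>s\<in>UNIV. \<Sum>t\<in>UNIV. b s * a t * \<theta> (s + t) * (\<Sum>z\<in>UNIV. inverse N z * bessel_pair c c' (s * t * z)))"
    unfolding bessel_transform_def sum_distrib_left
    by (subst sum.swap, rule sum.cong[OF refl], subst sum.swap) (simp add: mult_ac)
  also have "\<dots> = (\<Sum>s\<in>UNIV. \<Sum>t\<in>UNIV. ((b * N) s * \<theta> s) * ((a * N) t * \<theta> t) * ?H)"
  proof (intro sum.cong refl)
    fix s t :: 'a
    show "b s * a t * \<theta> (s + t) * (\<Sum>z\<in>UNIV. inverse N z * bessel_pair c c' (s * t * z)) =
       ((b * N) s * \<theta> s) * ((a * N) t * \<theta> t) * ?H"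
    proof (cases "s = 0 \<or> t = 0")
      case True
      thus ?thesis using mult_char_0[OF a] mult_char_0[OF b] by auto
    next
      case False
      have "?H = (\<Sum>z\<in>UNIV. inverse N (s * t * z) * bessel_pair c c' (s * t * z))"
        using False by (intro sum_scale[symmetric]) auto
      hence "N s * N t * ?H = (\<Sum>z\<in>UNIV. inverse N z * bessel_pair c c' (s * t * z))"
        using False mult_char_nonzero[OF N] by (simp add: mult_char_mult N sum_distrib_left field_simps)
      thus ?thesis by (simp add: theta_add mult_ac)
    qed
  qed
  also have "\<dots> = g (a * N) * g (b * N) * ?H"
  proof -
    have "g (a * N) * g (b * N) = (\<Sum>s\<in>UNIV. \<Sum>t\<in>UNIV. ((b * N) s * \<theta> s) * ((a * N) t * \<theta> t))"
      unfolding g_def by (subst mult.commute) (rule sum_product)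
    thus ?thesis by (simp only: sum_distrib_right)
  qed
  finally show ?thesis .
qed

text \<open>Substituting \<open>u = v * w * m\<close> factors the exponent as \<open>(v + w) * (1 + m)\<close>, and \<open>v = w * k\<close> then isolates
  one Gauss sum; what remains is a product of two Jacobi sums in \<open>k\<close> and \<open>m\<close>.\<close>

lemma mellin_bessel_pair:
  fixes c c' N :: "'a \<Rightarrow> complex"
  assumes c: "c \<in> mult_chars" and c': "c' \<in> mult_chars" and N: "N \<in> mult_chars"
    and \<psi>: "\<psi> = inverse (N * c)" and \<eta>: "\<eta> = inverse (N * N * c * c')"
  shows "(\<Sum>u\<in>UNIV. inverse N u * bessel_pair c c' u) =
     (\<Sum>k\<in>UNIV. \<Sum>m\<in>UNIV. \<psi> k * inverse N m * (g \<eta> * inverse (\<eta> ((1 + k) * (1 + m))) +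
        (of_nat CARD('a) - 1) * delta_char \<eta> * delta_elt ((1 + k) * (1 + m))))"
proof -
  note cm = c c' N
  have \<eta>_in: "\<eta> \<in> mult_chars" by (simp add: \<eta> mult_char_closed cm)
  have "(\<Sum>u\<in>UNIV. inverse N u * bessel_pair c c' u) =
      (\<Sum>w\<in>UNIV. \<Sum>v\<in>UNIV. \<Sum>u\<in>UNIV. inverse N u * (inverse (c v) * inverse (c' w) * \<theta> (v + u / v + w + u / w)))"
  proof -
    have "(\<Sum>u\<in>UNIV. inverse N u * bessel_pair c c' u) =
      (\<Sum>v\<in>UNIV. \<Sum>w\<in>UNIV. \<Sum>u\<in>UNIV. inverse N u * (inverse (c v) * inverse (c' w) * \<theta> (v + u / v + w + u / w)))"
      unfolding bessel_pair_def sum_distrib_left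
      by (subst sum.swap, rule sum.cong[OF refl], rule sum.swap)
    also have "\<dots> = (\<Sum>w\<in>UNIV. \<Sum>v\<in>UNIV. \<Sum>u\<in>UNIV. inverse N u * (inverse (c v) * inverse (c' w) * \<theta> (v + u / v + w + u / w)))"
      by (rule sum.swap)
    finally show ?thesis .
  qed
  also have "\<dots> = (\<Sum>w\<in>UNIV. \<Sum>k\<in>UNIV. \<Sum>m\<in>UNIV. \<psi> k * inverse N m * (\<eta> w * \<theta> (w * ((1 + k) * (1 + m)))))"
  proof (rule sum.cong[OF refl])
    fix w :: 'a
    show "(\<Sum>v\<in>UNIV. \<Sum>u\<in>UNIV. inverse N u * (inverse (c v) * inverse (c' w) * \<theta> (v + u / v + w + u / w))) =
      (\<Sum>k\<in>UNIV. \<Sum>m\<in>UNIV. \<psi> k * inverse N m * (\<eta> w * \<theta> (w * ((1 + k) * (1 + m)))))"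
    proof (cases "w = 0")
      case True
      thus ?thesis by (simp add: mult_char_0[OF c'] mult_char_0[OF \<eta>_in])
    next
      case w: False
      have "(\<Sum>v\<in>UNIV. \<Sum>u\<in>UNIV. inverse N u * (inverse (c v) * inverse (c' w) * \<theta> (v + u / v + w + u / w))) =
        (\<Sum>k\<in>UNIV. \<Sum>u\<in>UNIV. inverse N u *
          (inverse (c (w * k)) * inverse (c' w) * \<theta> (w * k + u / (w * k) + w + u / w)))"
        using w by (rule sum_scale[symmetric])
      also have "\<dots> = (\<Sum>k\<in>UNIV. \<Sum>m\<in>UNIV. \<psi> k * inverse N m * (\<eta> w * \<theta> (w * ((1 + k) * (1 + m)))))"
      proof (rule sum.cong[OF refl])
        fix k :: 'a
        show "(\<Sum>u\<in>UNIV. inverse N u *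
          (inverse (c (w * k)) * inverse (c' w) * \<theta> (w * k + u / (w * k) + w + u / w))) =
          (\<Sum>m\<in>UNIV. \<psi> k * inverse N m * (\<eta> w * \<theta> (w * ((1 + k) * (1 + m)))))"
        proof (cases "k = 0")
          case True
          thus ?thesis by (simp add: \<psi> mult_char_0[OF c])
        next
          case k: False
          have "(\<Sum>u\<in>UNIV. inverse N u *
            (inverse (c (w * k)) * inverse (c' w) * \<theta> (w * k + u / (w * k) + w + u / w))) =
            (\<Sum>m\<in>UNIV. inverse N (w * k * w * m) * (inverse (c (w * k)) * inverse (c' w) *
              \<theta> (w * k + w * k * w * m / (w * k) + w + w * k * w * m / w)))"
            using w k by (intro sum_scale[symmetric]) auto
          also have "\<dots> = (\<Sum>m\<in>UNIV. \<psi> k * inverse N m * (\<eta> w * \<theta> (w * ((1 + k) * (1 + m)))))"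
          proof (rule sum.cong[OF refl])
            fix m :: 'a
            have "w * k + w * k * w * m / (w * k) + w + w * k * w * m / w = w * ((1 + k) * (1 + m))"
              using w k by (simp add: field_simps)
            thus "inverse N (w * k * w * m) * (inverse (c (w * k)) * inverse (c' w) *
              \<theta> (w * k + w * k * w * m / (w * k) + w + w * k * w * m / w)) =
              \<psi> k * inverse N m * (\<eta> w * \<theta> (w * ((1 + k) * (1 + m))))"
              by (simp add: \<psi> \<eta> mult_char_mult cm mult_ac)
          qed
          finally show ?thesis .
        qed
      qed
      finally show ?thesis .
    qed
  qed
  also have "\<dots> = (\<Sum>k\<in>UNIV. \<Sum>m\<in>UNIV. \<psi> k * inverse N m * (\<Sum>w\<in>UNIV. \<eta> w * \<theta> (w * ((1 + k) * (1 + m)))))"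
    unfolding sum_distrib_left by (subst sum.swap, rule sum.cong[OF refl], rule sum.swap)
  finally show ?thesis by (simp only: gauss_twist[OF \<eta>_in])
qed

end

section \<open>Evaluation of the Mellin coefficients, including the degenerate characters\<close>

lemma char_eqI:
  assumes "f \<in> mult_chars" "h \<in> mult_chars" "\<And>x. x \<noteq> 0 \<Longrightarrow> f x = h x"
  shows "f = h"
proof
  show "f x = h x" for x using assms by (cases "x = 0") (simp_all add: mult_char_0)
qed

lemma delta_inverse_char: "delta_char (inverse \<chi>) = delta_char \<chi>"
  by (simp add: delta_char_def inverse_char_eq_triv)

text \<open>\<open>D\<close> and \<open>E\<close> stand for \<open>delta_char N\<close> and
  \<open>delta_char (N * c)\<close>. The left side is the Mellin coefficient computed directly in
  the degenerate case; the right side is the generic Gauss product over q plus a correction, which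
  is thus exactly the error of the generic formula.\<close>

lemma degenerate_identity:
  fixes q e D E :: complex
  assumes "q \<noteq> 0"
  shows "(q - 1) * (q - 1)\<^sup>2 * (e * (D * E)) - q * (e * (((q - 1) * E - 1) * ((q - 1) * D - 1))) =
    - (e * ((q - (q - 1) * E) * (q - (q - 1) * D))) / q + e * (q - 1)\<^sup>2 * (D + E - (q - 1) / q * D * E)"
  using assms by (simp add: field_simps power2_eq_square)

context additive_character
begin

text \<open>If \<open>N * N * a * b\<close> is nontrivial, the double sum of
  \<open>mellin_bessel_pair\<close> separates into two Jacobi sums, and
  \<open>jacobi_sum_gauss'\<close> keeps the result free of further exceptions. If it is trivial,
  the delta term of \<open>gauss_twist\<close> enters as well, and the generic product fails by the
  last summand.\<close>

lemma mellin_bessel_pair_eval: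
  fixes a b c c' N :: "'a \<Rightarrow> complex"
  assumes a: "a \<in> mult_chars" "a (- 1) = 1" and b: "b \<in> mult_chars" "b (- 1) = 1"
    and c: "c \<in> mult_chars" and c': "c' = a * b * inverse c" and N: "N \<in> mult_chars"
  shows "(\<Sum>u\<in>UNIV. inverse N u * bessel_pair c c' u) =
    g (inverse (N * c)) * g (inverse (N * c')) * g (inverse N) * g (inverse (N * a * b)) * g (N * N * a * b)
      / of_nat CARD('a)
    + (if N * N * a * b = \<epsilon> then c (- 1) * (of_nat CARD('a) - 1)\<^sup>2 *
        (delta_char N + delta_char (N * c)
         - (of_nat CARD('a) - 1) / of_nat CARD('a) * delta_char N * delta_char (N * c)) else 0)"
    (is "?H = ?M / ?q + ?corr")
proof -
  note cm = a(1) b(1) c N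
  note nz = mult_char_nonzero[OF a(1)] mult_char_nonzero[OF b(1)] mult_char_nonzero[OF c] mult_char_nonzero[OF N]
  define \<mu> where "\<mu> = N * N * a * b"
  define \<psi> where "\<psi> = inverse (N * c)"
  define n where "n = N (- 1)"
  define e where "e = c (- 1)"
  have n: "n * n = 1" "inverse n = n" and e: "e * e = 1" "inverse e = e"
    by (simp_all add: n_def e_def mult_char_minus1_sq inverse_mult_char_minus1 cm)
  have c'_in: "c' \<in> mult_chars" by (simp add: c' mult_char_closed cm)
  have in_mc: "\<mu> \<in> mult_chars" "\<psi> \<in> mult_chars" "inverse N \<in> mult_chars" "N * c \<in> mult_chars"
    by (simp_all add: \<mu>_def \<psi>_def mult_char_closed cm)
  have \<eta>: "inverse \<mu> = inverse (N * N * c * c')"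
    by (rule char_eqI) (simp_all add: \<mu>_def c' mult_char_closed cm nz)
  have q0: "?q \<noteq> 0" by simp
  have H: "?H = (\<Sum>k\<in>UNIV. \<Sum>m\<in>UNIV. \<psi> k * inverse N m * (g (inverse \<mu>) * inverse (inverse \<mu> ((1 + k) * (1 + m))) +
        (?q - 1) * delta_char (inverse \<mu>) * delta_elt ((1 + k) * (1 + m))))"
    by (rule mellin_bessel_pair[OF c c'_in N \<psi>_def \<eta>])
  have "\<psi> (- 1) = n * e" "inverse N (- 1) = n" "\<mu> (- 1) = 1"
    by (simp_all add: \<psi>_def \<mu>_def a b n e flip: n_def e_def)
  hence signs: "\<psi> (- 1) = n * e" "inverse N (- 1) = n" "\<mu> (- 1) = 1" "(\<psi> * \<mu>) (- 1) = n * e"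
    "(inverse N * \<mu>) (- 1) = n"
    by simp_all
  show ?thesis
  proof (cases "\<mu> = \<epsilon>")
    case False
    have g\<mu>: "g \<mu> * g (inverse \<mu>) = ?q"
      using gauss_inverse_nontriv[OF in_mc(1) False] by (simp only: signs mult_1_right)
    have "?H = g (inverse \<mu>) * ((\<Sum>k\<in>UNIV. \<psi> k * \<mu> (1 + k)) * (\<Sum>m\<in>UNIV. inverse N m * \<mu> (1 + m)))"
    proof -
      have "\<psi> k * inverse N m * (g (inverse \<mu>) * inverse (inverse \<mu> ((1 + k) * (1 + m))) +
          (?q - 1) * delta_char (inverse \<mu>) * delta_elt ((1 + k) * (1 + m))) =
          g (inverse \<mu>) * ((\<psi> k * \<mu> (1 + k)) * (inverse N m * \<mu> (1 + m)))" for k m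
        by (simp add: delta_char_def inverse_char_eq_triv False mult_char_mult in_mc mult_ac)
      thus ?thesis unfolding H sum_product by (simp only: sum_distrib_left)
    qed
    also have "\<dots> = g (inverse \<mu>) * (n * e * jacobi_sum \<psi> \<mu> * (n * jacobi_sum (inverse N) \<mu>))"
      by (simp only: sum_char_one_plus in_mc signs)
    also have "jacobi_sum \<psi> \<mu> = g \<psi> * g \<mu> * g (inverse (N * c')) * (n * e) / ?q"
    proof -
      have "inverse (\<psi> * \<mu>) = inverse (N * c')"
        by (rule char_eqI) (simp_all add: \<psi>_def \<mu>_def c' mult_char_closed cm nz)
      thus ?thesis using jacobi_sum_gauss'[OF in_mc(2,1) False] by (simp only: signs)
    qed
    also have "jacobi_sum (inverse N) \<mu> = g (inverse N) * g \<mu> * g (inverse (N * a * b)) * n / ?q"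
    proof -
      have "inverse (inverse N * \<mu>) = inverse (N * a * b)"
        by (rule char_eqI) (simp_all add: \<mu>_def mult_char_closed cm nz)
      thus ?thesis using jacobi_sum_gauss'[OF in_mc(3,1) False] by (simp only: signs)
    qed
    also have "g (inverse \<mu>) * (n * e * (g \<psi> * g \<mu> * g (inverse (N * c')) * (n * e) / ?q) *
        (n * (g (inverse N) * g \<mu> * g (inverse (N * a * b)) * n / ?q))) =
        (n * n) * (n * n) * (e * e) * (g \<mu> * g (inverse \<mu>)) *
        (g \<psi> * g (inverse (N * c')) * g (inverse N) * g (inverse (N * a * b)) * g \<mu>) / (?q * ?q)"
      by (simp only: times_divide_eq_left times_divide_eq_right divide_divide_eq_left mult_ac)
    also have "\<dots> = g \<psi> * g (inverse (N * c')) * g (inverse N) * g (inverse (N * a * b)) * g \<mu> / ?q"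
      unfolding n e g\<mu> using q0 by simp
    finally show ?thesis
      using False by (simp add: \<psi>_def \<mu>_def)
  next
    case True
    define D where "D = delta_char N"
    define E where "E = delta_char (N * c)"
    \<comment> \<open>A nonzero \<open>D\<close> means N = \<epsilon>, so the sign n is 1; a nonzero
      \<open>E\<close> means N c = \<epsilon>, so n e is 1.\<close>
    have ND: "n * D = D" "n * e * E = E"
      by (auto simp: D_def E_def delta_char_def n_def e_def triv_char_def fun_eq_iff)
    have deltas: "delta_char \<psi> = E" "delta_char (inverse N) = D"
      by (simp_all only: \<psi>_def delta_inverse_char D_def E_def)
    have "?H = (\<Sum>k\<in>UNIV. \<Sum>m\<in>UNIV. (?q - 1) * (\<psi> k * inverse N m) -
        ?q * ((\<psi> k * \<epsilon> (1 + k)) * (inverse N m * \<epsilon> (1 + m))))"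
    proof -
      have triv: "g (inverse \<epsilon>) * inverse (inverse \<epsilon> (y * z)) + (?q - 1) * delta_char (inverse \<epsilon>) * delta_elt (y * z) =
          (?q - 1) - ?q * (\<epsilon> y * \<epsilon> z)" for y z :: 'a
        by (cases "y = 0"; cases "z = 0") (simp_all add: inverse_triv_char gauss_triv triv_char_def delta_elt_def delta_char_def)
      show ?thesis unfolding H True triv by (simp only: right_diff_distrib mult_ac)
    qed
    also have "\<dots> = (?q - 1) * ((\<Sum>k\<in>UNIV. \<psi> k) * (\<Sum>m\<in>UNIV. inverse N m)) -
        ?q * ((\<Sum>k\<in>UNIV. \<psi> k * \<epsilon> (1 + k)) * (\<Sum>m\<in>UNIV. inverse N m * \<epsilon> (1 + m)))"
      by (simp only: sum_subtractf sum_product) (simp only: sum_distrib_left)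
    also have "\<dots> = (?q - 1) * (((?q - 1) * E) * ((?q - 1) * D)) -
        ?q * ((n * e * ((?q - 1) * E - 1)) * (n * ((?q - 1) * D - 1)))"
      by (simp only: sum_mult_char sum_char_one_plus jacobi_sum_triv in_mc signs deltas)
    finally have HH: "?H = (?q - 1) * (((?q - 1) * E) * ((?q - 1) * D)) -
        ?q * ((n * e * ((?q - 1) * E - 1)) * (n * ((?q - 1) * D - 1)))" .
    have \<mu>1: "N x * N x * a x * b x = 1" if "x \<noteq> 0" for x
      using True that by (simp add: \<mu>_def fun_eq_iff triv_char_def)
    \<comment> \<open>In the degenerate case the four remaining Gauss sums pair up into two products
      of a character's Gauss sum with that of its inverse.\<close>
    have "inverse (N * c') = N * c" "inverse (N * a * b) = N"
    proof (rule_tac [!] char_eqI)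
      fix x :: 'a assume x: "x \<noteq> 0"
      show "inverse (N * c') x = (N * c) x" "inverse (N * a * b) x = N x"
        using \<mu>1[OF x] nz[OF x] by (simp_all add: c' field_simps)
    qed (simp_all add: mult_char_closed c' cm)
    hence "?M = - (g (N * c) * g (inverse (N * c))) * (g N * g (inverse N))"
      unfolding \<mu>_def[symmetric] True gauss_triv by (simp only: mult_ac mult_minus_left mult_minus_right mult_1_left mult_1_right)
    also have "\<dots> = - (n * e * (?q - (?q - 1) * E)) * (n * (?q - (?q - 1) * D))"
      by (simp only: gauss_inverse in_mc N times_fun_apply n_def e_def D_def E_def)
    finally have MM: "?M = - (n * e * (?q - (?q - 1) * E)) * (n * (?q - (?q - 1) * D))" .
    have corr: "?corr = e * (?q - 1)\<^sup>2 * (D + E - (?q - 1) / ?q * D * E)"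
      using True by (simp add: \<mu>_def D_def E_def e_def)
    have nn: "n * e * s * (n * t) = e * (s * t)" for s t :: complex
      using n by (simp add: mult_ac)
    have eDE: "e * (D * E) = D * E"
      using ND by (metis mult.assoc mult.left_commute mult.commute)
    have "?H = (?q - 1) * (?q - 1)\<^sup>2 * (D * E) - ?q * (e * (((?q - 1) * E - 1) * ((?q - 1) * D - 1)))"
      unfolding HH nn by (simp add: power2_eq_square mult_ac)
    moreover have "?M = - (e * ((?q - (?q - 1) * E) * (?q - (?q - 1) * D)))"
      unfolding MM by (simp only: mult_minus_left nn)
    moreover have "(?q - 1) * (?q - 1)\<^sup>2 * (e * (D * E)) - ?q * (e * (((?q - 1) * E - 1) * ((?q - 1) * D - 1))) =
        - (e * ((?q - (?q - 1) * E) * (?q - (?q - 1) * D))) / ?q +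
        e * (?q - 1)\<^sup>2 * (D + E - (?q - 1) / ?q * D * E)"
      by (rule degenerate_identity[OF q0])
    ultimately show ?thesis
      by (simp only: corr eDE)
  qed
qed

end

section \<open>Hypergeometric series\<close>

lemma greene_F_0: "greene_F A As Bs (0 :: 'a::finite_field) = 0"
  by (simp add: greene_F_def mult_char_0)

text \<open>Orthogonality leaves the solutions u of u v x = (1 - u) (1 - v): a single one,
  \<open>u0\<close>, if 1 - v + v x is nonzero, and none otherwise. In the latter case the right
  side is 0 because \<open>inverse 0 = 0\<close>.\<close>

lemma sum_char_condition:
  fixes a :: "'a::finite_field \<Rightarrow> complex"
  assumes a: "a \<in> mult_chars" and v: "v \<noteq> 0" "v \<noteq> 1" and x: "x \<noteq> 0"
  shows "(\<Sum>u\<in>UNIV. a u * (\<Sum>\<chi>\<in>mult_chars. \<chi> (u * v * x / ((1 - u) * (1 - v))))) =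
    (of_nat CARD('a) - 1) * (a (1 - v) * inverse (a (1 - v + v * x)))"
proof -
  let ?q = "of_nat CARD('a) :: complex"
  define u0 where "u0 = (1 - v) / (1 - v + v * x)"
  have iff: "u * v * x / ((1 - u) * (1 - v)) = 1 \<longleftrightarrow> u = u0 \<and> 1 - v + v * x \<noteq> 0" for u
  proof (cases "u = 1")
    case True
    have "1 = u0 \<Longrightarrow> 1 - v + v * x \<noteq> 0 \<Longrightarrow> False"
      using v x by (simp add: u0_def nonzero_eq_divide_eq)
    thus ?thesis using True by auto
  next
    case False
    hence "u * v * x / ((1 - u) * (1 - v)) = 1 \<longleftrightarrow> u * v * x = (1 - u) * (1 - v)"
      using v by (simp add: nonzero_divide_eq_eq)
    also have "\<dots> \<longleftrightarrow> u * (1 - v + v * x) = 1 - v"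
      by (auto simp: algebra_simps)
    also have "\<dots> \<longleftrightarrow> u = u0 \<and> 1 - v + v * x \<noteq> 0"
      using v unfolding u0_def by (cases "1 - v + v * x = 0") (simp_all add: nonzero_eq_divide_eq)
    finally show ?thesis .
  qed
  have "(\<Sum>u\<in>UNIV. a u * (\<Sum>\<chi>\<in>mult_chars. \<chi> (u * v * x / ((1 - u) * (1 - v))))) =
    (\<Sum>u\<in>UNIV. if u = u0 then (if 1 - v + v * x \<noteq> 0 then (?q - 1) * a u0 else 0) else 0)"
    unfolding sum_mult_chars iff by (intro sum.cong refl) auto
  also have "\<dots> = (if 1 - v + v * x \<noteq> 0 then (?q - 1) * a u0 else 0)"
    by simp
  also have "\<dots> = (?q - 1) * (a (1 - v) * inverse (a (1 - v + v * x)))"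
    unfolding u0_def mult_char_divide[OF a] by (cases "1 - v + v * x = 0") (simp_all add: mult_char_0 a divide_inverse)
  finally show ?thesis .
qed

text \<open>The finite field Euler integral. With both binomials written as sums, the signs
  \<chi>(-1) cancel, the sum over \<chi> fixes one variable, and a Pfaff-type substitution brings
  the other sum into standard form.\<close>

lemma greene_2F1_integral:
  fixes a b c :: "'a::finite_field \<Rightarrow> complex"
  assumes a: "a \<in> mult_chars" and b: "b \<in> mult_chars" and c: "c \<in> mult_chars" and x: "x \<noteq> 0"
  shows "greene_F a [b] [c] x = b (- 1) * c (- 1) / of_nat CARD('a) *
    (\<Sum>y\<in>UNIV. b y * inverse ((b * inverse c) (1 - y)) * inverse (a (1 - x * y)))"
proof -
  let ?q = "of_nat CARD('a) :: complex"
  have q1: "?q - 1 \<noteq> 0" using card_gt_1[where 'a = 'a] by simp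
  have "(\<Sum>\<chi>\<in>mult_chars. char_binomial (a * \<chi>) \<chi> * char_binomial (b * \<chi>) (c * \<chi>) * \<chi> x) =
      (\<Sum>\<chi>\<in>mult_chars. \<Sum>v\<in>UNIV. \<Sum>u\<in>UNIV. c (- 1) / ?q\<^sup>2 * (b v * inverse (c (1 - v)) *
        (a u * \<chi> (u * v * x / ((1 - u) * (1 - v))))))"
  proof (rule sum.cong[OF refl])
    fix \<chi> :: "'a \<Rightarrow> complex" assume \<chi>: "\<chi> \<in> mult_chars"
    have "char_binomial (a * \<chi>) \<chi> * char_binomial (b * \<chi>) (c * \<chi>) * \<chi> x =
      (\<chi> (- 1) * \<chi> (- 1)) * (c (- 1) / ?q\<^sup>2) *
      ((\<Sum>v\<in>UNIV. (b * \<chi>) v * inverse (c * \<chi>) (1 - v)) * (\<Sum>u\<in>UNIV. (a * \<chi>) u * inverse \<chi> (1 - u))) * \<chi> x"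
      by (simp add: char_binomial_def power2_eq_square mult_ac)
    also have "\<dots> = (\<Sum>v\<in>UNIV. \<Sum>u\<in>UNIV. c (- 1) / ?q\<^sup>2 *
        (((b * \<chi>) v * inverse (c * \<chi>) (1 - v)) * ((a * \<chi>) u * inverse \<chi> (1 - u))) * \<chi> x)"
      by (simp only: mult_char_minus1_sq[OF \<chi>] mult_1_left sum_product)
         (simp only: sum_distrib_left sum_distrib_right)
    also have "\<dots> = (\<Sum>v\<in>UNIV. \<Sum>u\<in>UNIV. c (- 1) / ?q\<^sup>2 * (b v * inverse (c (1 - v)) *
        (a u * \<chi> (u * v * x / ((1 - u) * (1 - v))))))"
      by (intro sum.cong refl)
         (simp only: mult_char_mult[OF \<chi>] mult_char_divide[OF \<chi>],
          simp only: divide_inverse times_fun_apply inverse_fun_apply inverse_mult_distrib mult_ac)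
    finally show "char_binomial (a * \<chi>) \<chi> * char_binomial (b * \<chi>) (c * \<chi>) * \<chi> x =
      (\<Sum>v\<in>UNIV. \<Sum>u\<in>UNIV. c (- 1) / ?q\<^sup>2 * (b v * inverse (c (1 - v)) *
        (a u * \<chi> (u * v * x / ((1 - u) * (1 - v))))))" .
  qed
  also have "\<dots> = (\<Sum>v\<in>UNIV. c (- 1) / ?q\<^sup>2 * (b v * inverse (c (1 - v)) *
        (\<Sum>u\<in>UNIV. a u * (\<Sum>\<chi>\<in>mult_chars. \<chi> (u * v * x / ((1 - u) * (1 - v)))))))"
    unfolding sum_distrib_left by (subst sum.swap, rule sum.cong[OF refl], rule sum.swap)
  also have "\<dots> = (\<Sum>v\<in>UNIV. c (- 1) / ?q\<^sup>2 * (b v * inverse (c (1 - v)) *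
        ((?q - 1) * (a (1 - v) * inverse (a (1 - v + v * x))))))"
  proof (rule sum.cong[OF refl])
    fix v :: 'a
    show "c (- 1) / ?q\<^sup>2 * (b v * inverse (c (1 - v)) *
        (\<Sum>u\<in>UNIV. a u * (\<Sum>\<chi>\<in>mult_chars. \<chi> (u * v * x / ((1 - u) * (1 - v)))))) =
      c (- 1) / ?q\<^sup>2 * (b v * inverse (c (1 - v)) *
        ((?q - 1) * (a (1 - v) * inverse (a (1 - v + v * x)))))"
      by (cases "v = 0 \<or> v = 1") (auto simp: sum_char_condition[OF a _ _ x] mult_char_0[OF b] mult_char_0[OF c])
  qed
  also have "\<dots> = c (- 1) * (?q - 1) / ?q\<^sup>2 *
      (\<Sum>v\<in>UNIV. b v * inverse (c (1 - v)) * (a (1 - v) * inverse (a (1 - v + v * x))))"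
    by (simp add: sum_distrib_left mult_ac)
  also have "(\<Sum>v\<in>UNIV. b v * inverse (c (1 - v)) * (a (1 - v) * inverse (a (1 - v + v * x)))) =
      (\<Sum>v\<in>UNIV - {1}. b v * inverse (c (1 - v)) * (a (1 - v) * inverse (a (1 - v + v * x))))"
    by (subst sum_UNIV_remove[of _ 1]) (simp add: mult_char_0 a)
  \<comment> \<open>The map v to -v / (1 - v) is an involution of the field without 1, hence its own
    witness. It turns 1 - v + v x into (1 - x y) / (1 - y).\<close>
  also have "\<dots> = (\<Sum>y\<in>UNIV - {1}. b (- 1) * (b y * inverse ((b * inverse c) (1 - y)) * inverse (a (1 - x * y))))"
  proof (rule sum.reindex_bij_witness[of _ "\<lambda>y. - y / (1 - y)" "\<lambda>v. - v / (1 - v)"])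
    have inv: "1 - - y / (1 - y) = 1 / (1 - y)" "- (- y / (1 - y)) / (1 - - y / (1 - y)) = y" if "y \<noteq> 1" for y :: 'a
    proof -
      have y: "1 - y \<noteq> 0" using that by simp
      show 1: "1 - - y / (1 - y) = 1 / (1 - y)" using y by (simp add: divide_simps)
      show "- (- y / (1 - y)) / (1 - - y / (1 - y)) = y" unfolding 1 using y by simp
    qed
    fix v assume v: "v \<in> UNIV - {1 :: 'a}"
    thus "- (- v / (1 - v)) / (1 - - v / (1 - v)) = v" by (intro inv) auto
    show "- (- v / (1 - v)) / (1 - - v / (1 - v)) = v" using v by (intro inv) auto
    have v1: "1 - v \<noteq> 0" using v by auto
    have ne: "- v / (1 - v) \<noteq> 1"
    proof
      assume "- v / (1 - v) = 1"
      hence "- v = 1 - v" using nonzero_divide_eq_eq[OF v1, of "- v" 1] by simp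
      thus False by simp
    qed
    thus "- v / (1 - v) \<in> UNIV - {1}" "- v / (1 - v) \<in> UNIV - {1}" by auto
    have i: "1 - - v / (1 - v) = 1 / (1 - v)" using inv(1) v by auto
    have ii: "1 - x * (- v / (1 - v)) = (1 - v + v * x) / (1 - v)"
      using v1 by (simp add: divide_simps)
    have "b (- v / (1 - v)) = b (- 1) * b v * inverse (b (1 - v))"
      using mult_char_divide[OF b, of "- v" "1 - v"] mult_char_minus[OF b, of v] by (simp only: divide_inverse)
    hence "b (- 1) * (b (- v / (1 - v)) * inverse ((b * inverse c) (1 - - v / (1 - v))) * inverse (a (1 - x * (- v / (1 - v)))))
      = (b (- 1) * b (- 1)) * (inverse (b (1 - v)) * b (1 - v)) *
        (b v * inverse (c (1 - v)) * (a (1 - v) * inverse (a (1 - v + v * x))))"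
      unfolding i ii times_fun_apply inverse_fun_apply mult_char_divide[OF a] mult_char_divide[OF b]
        mult_char_divide[OF c] mult_char_1[OF b] mult_char_1[OF c]
      by (simp only: divide_inverse inverse_mult_distrib inverse_inverse_eq mult_1_left mult_ac)
    thus "b (- 1) * (b (- v / (1 - v)) * inverse ((b * inverse c) (1 - - v / (1 - v))) * inverse (a (1 - x * (- v / (1 - v)))))
      = b v * inverse (c (1 - v)) * (a (1 - v) * inverse (a (1 - v + v * x)))"
      using v1 by (simp add: mult_char_minus1_sq b mult_char_nonzero)
  qed
  also have "\<dots> = (\<Sum>y\<in>UNIV. b (- 1) * (b y * inverse ((b * inverse c) (1 - y)) * inverse (a (1 - x * y))))"
    by (subst sum_UNIV_remove[of _ 1]) (simp add: mult_char_0 b c)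
  finally have S: "(\<Sum>\<chi>\<in>mult_chars. char_binomial (a * \<chi>) \<chi> * char_binomial (b * \<chi>) (c * \<chi>) * \<chi> x) =
    c (- 1) * (?q - 1) / ?q\<^sup>2 * (b (- 1) * (\<Sum>y\<in>UNIV. b y * inverse ((b * inverse c) (1 - y)) * inverse (a (1 - x * y))))"
    by (simp only: sum_distrib_left)
  have "greene_F a [b] [c] x = ?q / (?q - 1) *
      (\<Sum>\<chi>\<in>mult_chars. char_binomial (a * \<chi>) \<chi> * char_binomial (b * \<chi>) (c * \<chi>) * \<chi> x)"
    by (simp add: greene_F_def)
  also have "\<dots> = b (- 1) * c (- 1) / ?q *
    (\<Sum>y\<in>UNIV. b y * inverse ((b * inverse c) (1 - y)) * inverse (a (1 - x * y)))"
    unfolding S using q1 by (simp add: power2_eq_square mult_ac)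
  finally show ?thesis .
qed

context additive_character
begin

text \<open>Multiplying by \<open>g E\<close> instead of writing a quotient isolates the defect at A
  = B as a single constant, independent of A.\<close>

lemma char_binomial_gauss:
  fixes A B E :: "'a \<Rightarrow> complex"
  assumes A: "A \<in> mult_chars" and B: "B \<in> mult_chars" and E: "E = A * inverse B"
  shows "char_binomial A B * g E = B (- 1) * (g A * g (inverse B)) / of_nat CARD('a) -
    (of_nat CARD('a) - 1) / of_nat CARD('a) * delta_char E"
proof -
  let ?q = "of_nat CARD('a) :: complex"
  have "B (- 1) * (g A * g (inverse B)) =
      B (- 1) * jacobi_sum A (inverse B) * g E + (B (- 1) * B (- 1)) * ((?q - 1) * delta_char E)"
    unfolding gauss_mult[OF A inverse_char_in[OF B]] E inverse_fun_apply inverse_mult_char_minus1[OF B]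
    by (simp only: distrib_left mult_ac)
  hence "B (- 1) * jacobi_sum A (inverse B) * g E = B (- 1) * (g A * g (inverse B)) - (?q - 1) * delta_char E"
    by (simp only: mult_char_minus1_sq[OF B]) simp
  thus ?thesis
    unfolding char_binomial_jacobi by (simp add: diff_divide_distrib left_diff_distrib)
qed

text \<open>Once multiplied by these Gauss sums, each product of binomials is symmetric in a and b;
  the hypotheses remove the delta terms of \<open>char_binomial_gauss\<close>. The swap is needed
  because the second integral of \<open>integral_product\<close> has the roles of a and b
  exchanged.\<close>

lemma greene_2F1_swap:
  fixes a b c :: "'a \<Rightarrow> complex"
  assumes a: "a \<in> mult_chars" "a \<noteq> \<epsilon>" and b: "b \<in> mult_chars" "b \<noteq> \<epsilon>" and c: "c \<in> mult_chars"
    and ac: "a \<noteq> c" and bc: "b \<noteq> c"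
  shows "g a * g (b * inverse c) * greene_F a [b] [c] x = g b * g (a * inverse c) * greene_F b [a] [c] x"
proof -
  let ?q = "of_nat CARD('a) :: complex"
  have bin: "char_binomial (A * \<chi>) \<chi> * g A = \<chi> (- 1) * (g (A * \<chi>) * g (inverse \<chi>)) / ?q"
    "char_binomial (B * \<chi>) (c * \<chi>) * g (B * inverse c) = (c * \<chi>) (- 1) * (g (B * \<chi>) * g (inverse (c * \<chi>))) / ?q"
    if "\<chi> \<in> mult_chars" "A \<in> mult_chars" "A \<noteq> \<epsilon>" "B \<in> mult_chars" "B \<noteq> c" for A B \<chi> :: "'a \<Rightarrow> complex"
  proof -
    have "A = A * \<chi> * inverse \<chi>" "B * inverse c = B * \<chi> * inverse (c * \<chi>)"
      by (rule_tac [!] char_eqI) (use that c in \<open>simp_all add: mult_char_closed mult_char_nonzero\<close>)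
    moreover have "B * inverse c \<noteq> \<epsilon>"
      using that c by (simp add: char_times_eq_triv_iff mult_char_closed inverse_inverse_char)
    ultimately show "char_binomial (A * \<chi>) \<chi> * g A = \<chi> (- 1) * (g (A * \<chi>) * g (inverse \<chi>)) / ?q"
      "char_binomial (B * \<chi>) (c * \<chi>) * g (B * inverse c) = (c * \<chi>) (- 1) * (g (B * \<chi>) * g (inverse (c * \<chi>))) / ?q"
      using char_binomial_gauss[of "A * \<chi>" \<chi> A] char_binomial_gauss[of "B * \<chi>" "c * \<chi>" "B * inverse c"] that c
      by (simp_all add: mult_char_closed delta_char_def)
  qed
  have "g a * g (b * inverse c) * (char_binomial (a * \<chi>) \<chi> * char_binomial (b * \<chi>) (c * \<chi>)) =
      g b * g (a * inverse c) * (char_binomial (b * \<chi>) \<chi> * char_binomial (a * \<chi>) (c * \<chi>))"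
    if \<chi>: "\<chi> \<in> mult_chars" for \<chi>
  proof -
    have "g a * g (b * inverse c) * (char_binomial (a * \<chi>) \<chi> * char_binomial (b * \<chi>) (c * \<chi>)) =
      (char_binomial (a * \<chi>) \<chi> * g a) * (char_binomial (b * \<chi>) (c * \<chi>) * g (b * inverse c))"
      by (simp only: mult_ac)
    also have "\<dots> = (char_binomial (b * \<chi>) \<chi> * g b) * (char_binomial (a * \<chi>) (c * \<chi>) * g (a * inverse c))"
      unfolding bin(1)[OF \<chi> a b(1) bc] bin(1)[OF \<chi> b a(1) ac] bin(2)[OF \<chi> a b(1) bc] bin(2)[OF \<chi> b a(1) ac]
      by (simp only: times_divide_eq_left times_divide_eq_right mult_ac)
    finally show ?thesis by (simp only: mult_ac)
  qed
  hence S: "g a * g (b * inverse c) * (\<Sum>\<chi>\<in>mult_chars. char_binomial (a * \<chi>) \<chi> * char_binomial (b * \<chi>) (c * \<chi>) * \<chi> x) =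
    g b * g (a * inverse c) * (\<Sum>\<chi>\<in>mult_chars. char_binomial (b * \<chi>) \<chi> * char_binomial (a * \<chi>) (c * \<chi>) * \<chi> x)"
    unfolding sum_distrib_left mult.assoc[symmetric]
    by (intro sum.cong refl) (simp only: mult.assoc[symmetric])
  define k where "k = ?q / (?q - 1)"
  have F: "greene_F A [B] [c] x =
      k * (\<Sum>\<chi>\<in>mult_chars. char_binomial (A * \<chi>) \<chi> * char_binomial (B * \<chi>) (c * \<chi>) * \<chi> x)" for A B
    by (simp add: greene_F_def k_def)
  show ?thesis
    unfolding F mult.left_commute[of _ k] S ..
qed

end

section \<open>The product formula\<close>

context additive_character
begin

lemma greene_2F1_product:
  fixes a b c c' :: "'a \<Rightarrow> complex"
  assumes a: "a \<in> mult_chars" "a (- 1) = 1" "a \<noteq> \<epsilon>" and b: "b \<in> mult_chars" "b (- 1) = 1" "b \<noteq> \<epsilon>"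
    and c: "c \<in> mult_chars" and c': "c' = a * b * inverse c" and ac: "a \<noteq> c" and bc: "b \<noteq> c"
    and x: "x \<noteq> 0" "x \<noteq> 1"
  shows "g a * g (inverse b) * g (b * inverse c) * g (inverse a * c) *
      (greene_F a [b] [c] x * greene_F a [b] [c'] x) =
    (\<Sum>N\<in>mult_chars. N (x * (1 - x)) * (g (a * N) * g (b * N) * (\<Sum>u\<in>UNIV. inverse N u * bessel_pair c c' u))) /
      (of_nat CARD('a) * (of_nat CARD('a) - 1)) +
    of_nat CARD('a) * inverse (a x) * inverse (b x) * delta_elt (1 - 2 * x)"
proof -
  let ?q = "of_nat CARD('a) :: complex"
  define d where "d = b * inverse c"
  define e where "e = c (- 1)"
  have e: "e * e = 1" "inverse e = e"
    by (simp_all add: e_def mult_char_minus1_sq inverse_mult_char_minus1 c)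
  have q0: "?q \<noteq> 0" and q1: "?q - 1 \<noteq> 0" using card_gt_1[where 'a = 'a] by simp_all
  note cm = a(1) b(1) c
  note nz = mult_char_nonzero[OF a(1)] mult_char_nonzero[OF b(1)] mult_char_nonzero[OF c]
  have d_in: "d \<in> mult_chars" and c'_in: "c' \<in> mult_chars"
    by (simp_all add: d_def c' mult_char_closed cm)
  have d1: "d (- 1) = e" "c' (- 1) = e"
    using e(2) by (simp_all add: d_def c' a b flip: e_def)
  have d_ne: "d \<noteq> \<epsilon>"
    using bc by (simp add: d_def char_times_eq_triv_iff mult_char_closed cm inverse_inverse_char)
  \<comment> \<open>The relation between c and c' makes \<open>inverse d\<close> the third character
    of the second integral, which is the shape that \<open>integral_product\<close>
    requires.\<close>
  have eqs: "a * inverse c' = inverse d" "b * inverse c' = inverse a * c"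
    by (rule_tac [!] char_eqI) (simp_all add: d_def c' mult_char_closed cm nz)
  have adb: "a * d \<noteq> b"
  proof
    assume *: "a * d = b"
    have "a = c"
    proof (rule char_eqI)
      fix y :: 'a assume "y \<noteq> 0"
      moreover have "a y * (b y * inverse (c y)) = b y" using * by (simp add: d_def fun_eq_iff)
      ultimately show "a y = c y" using nz[of y] by (simp add: field_simps)
    qed (use cm in auto)
    thus False using ac by simp
  qed
  have c'_ne: "a \<noteq> c'" "b \<noteq> c'"
  proof -
    have "inverse d \<noteq> \<epsilon>" using d_ne by (simp add: inverse_char_eq_triv)
    thus "a \<noteq> c'" using eqs(1) inverse_char_mult[OF a(1)] by (metis mult.commute)
    have "inverse a * c \<noteq> \<epsilon>"
      using ac by (simp add: mult.commute[of "inverse a"] char_times_eq_triv_iff mult_char_closed cm inverse_inverse_char)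
    thus "b \<noteq> c'" using eqs(2) inverse_char_mult[OF b(1)] by (metis mult.commute)
  qed
  define I1 where "I1 = (\<Sum>y\<in>UNIV. b y * inverse (d (1 - y)) * inverse (a (1 - x * y)))"
  define I2 where "I2 = (\<Sum>w\<in>UNIV. a w * d (1 - w) * inverse (b (1 - x * w)))"
  have F1: "greene_F a [b] [c] x = e / ?q * I1"
    using greene_2F1_integral[OF cm x(1)] by (simp add: I1_def b flip: e_def d_def)
  have "greene_F b [a] [c'] x = e / ?q * I2"
  proof -
    have "(\<Sum>y\<in>UNIV. a y * inverse ((a * inverse c') (1 - y)) * inverse (b (1 - x * y))) = I2"
      unfolding I2_def eqs by simp
    thus ?thesis using greene_2F1_integral[OF b(1) a(1) c'_in x(1)] by (simp add: a d1)
  qed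
  hence F2: "g a * g (inverse a * c) * greene_F a [b] [c'] x = g b * g (inverse d) * (e / ?q * I2)"
    using greene_2F1_swap[OF a(1,3) b(1,3) c'_in c'_ne, of x] unfolding eqs by simp
  have gb: "g b * g (inverse b) = ?q" "g d * g (inverse d) = ?q * e"
    using gauss_inverse_nontriv[OF b(1,3)] gauss_inverse_nontriv[OF d_in d_ne] b d1 by simp_all
  \<comment> \<open>This explains the constant G: two of its Gauss sums pay for the swap, the other
    two are the partners of \<open>g b\<close> and \<open>g (inverse d)\<close> that the swap
    creates. The resulting powers of q cancel those of the two integrals.\<close>
  have "g a * g (inverse b) * g d * g (inverse a * c) * (greene_F a [b] [c] x * greene_F a [b] [c'] x) =
      g (inverse b) * g d * greene_F a [b] [c] x * (g a * g (inverse a * c) * greene_F a [b] [c'] x)"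
    by (simp only: mult_ac)
  also have "\<dots> = (g b * g (inverse b)) * (g d * g (inverse d)) * (e / ?q) * (e / ?q) * (I1 * I2)"
    unfolding F1 F2 by (simp only: mult_ac)
  also have "\<dots> = e * (e * e) * (I1 * I2)"
    unfolding gb using q0 by simp
  also have "I1 * I2 = pair_sum a b d (x * (1 - x)) + ?q * e * inverse (a x) * inverse (b x) * delta_elt (1 - 2 * x)"
    unfolding I1_def I2_def using integral_product[OF a(1,3) b(1,3) d_in d_ne adb x] by (simp only: d1)
  also have "e * (e * e) * \<dots> = e * pair_sum a b d (x * (1 - x)) +
      ?q * inverse (a x) * inverse (b x) * delta_elt (1 - 2 * x)"
  proof -
    have "e * (?q * e * inverse (a x) * inverse (b x) * delta_elt (1 - 2 * x)) =
        (e * e) * (?q * inverse (a x) * inverse (b x) * delta_elt (1 - 2 * x))"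
      by (simp only: mult_ac)
    thus ?thesis by (simp only: e(1) distrib_left mult_1_left mult_1_right)
  qed
  also have "e * pair_sum a b d (x * (1 - x)) = bessel_transform a b c c' (x * (1 - x)) / ?q"
  proof -
    have "x * (1 - x) \<noteq> 0" using x by simp
    from pair_sum_bessel[OF a(1,2) b(1,2) c c' d_def d_ne this] show ?thesis
      using q0 by (simp add: e_def field_simps)
  qed
  also have "bessel_transform a b c c' (x * (1 - x)) =
    (\<Sum>N\<in>mult_chars. N (x * (1 - x)) * (g (a * N) * g (b * N) * (\<Sum>u\<in>UNIV. inverse N u * bessel_pair c c' u))) / (?q - 1)"
  proof -
    have "x * (1 - x) \<noteq> 0" using x by simp
    from mellin_inversion[OF this, of "bessel_transform a b c c'"]
    have "(?q - 1) * bessel_transform a b c c' (x * (1 - x)) =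
      (\<Sum>N\<in>mult_chars. N (x * (1 - x)) * (\<Sum>u\<in>UNIV. inverse N u * bessel_transform a b c c' u))" ..
    also have "\<dots> = (\<Sum>N\<in>mult_chars. N (x * (1 - x)) *
        (g (a * N) * g (b * N) * (\<Sum>u\<in>UNIV. inverse N u * bessel_pair c c' u)))"
      by (rule sum.cong[OF refl]) (simp only: mellin_bessel_transform[OF a(1) b(1)])
    finally show ?thesis using q1 by (simp add: field_simps)
  qed
  finally show ?thesis
    unfolding d_def by (simp only: divide_divide_eq_left mult.commute[of ?q])
qed

text \<open>This is q times the coefficient of N in the Mellin expansion, without the correction at
  degenerate characters.\<close>

definition gauss_product ::
  "('a \<Rightarrow> complex) \<Rightarrow> ('a \<Rightarrow> complex) \<Rightarrow> ('a \<Rightarrow> complex) \<Rightarrow> ('a \<Rightarrow> complex) \<Rightarrow> ('a \<Rightarrow> complex) \<Rightarrow> complex" where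
  "gauss_product a b c c' N = g (a * N) * g (b * N) * g (inverse (N * c)) * g (inverse (N * c')) *
     g (inverse N) * g (inverse (N * a * b)) * g (N * N * a * b)"

text \<open>A binomial \<open>char_binomial A B\<close> with \<open>A = B\<close> differs from its Gauss sum quotient by a constant; the two
  lower order terms cancel exactly these constants.\<close>

lemma greene_4F3_gauss:
  fixes A B C :: "'a \<Rightarrow> complex"
  assumes odd: "odd CARD('a)"
    and A: "A \<in> mult_chars" and B: "B \<in> mult_chars" and C: "C \<in> mult_chars"
    and a: "a = A * A" "a \<noteq> \<epsilon>" and b: "b = B * B" and c': "c' = a * b * inverse C"
    and K: "K = (A * B) 4 * g (inverse a) * g (A * B * inverse C) * g (inverse A * inverse B * C * \<phi>) /
                (g (inverse b) * g (b * inverse C) * g (inverse a * C) * g \<phi>)"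
    and G: "G = g a * g (inverse b) * g (b * inverse C) * g (inverse a * C)"
  shows "of_nat CARD('a) * K * greene_F a [b, A * B, A * B * \<phi>] [a * b, C, c'] (4 * z)
     - (of_nat CARD('a) - 1) * K *
         (greene_F a [b, A * B * \<phi>] [a * b, c'] (4 * z) * delta_char (A * B * inverse C)
          + greene_F a [b, A * B] [a * b, C] (4 * z) * delta_char (inverse A * inverse B * C * \<phi>)) =
     (\<Sum>N\<in>mult_chars. N z * gauss_product a b C c' N) / (of_nat CARD('a) ^ 2 * (of_nat CARD('a) - 1) * G)"
proof -
  let ?q = "of_nat CARD('a) :: complex"
  note \<phi> = quad_char_in[OF odd]
  note cm = A B C \<phi>
  note nz = mult_char_nonzero[OF A] mult_char_nonzero[OF B] mult_char_nonzero[OF C] mult_char_nonzero[OF \<phi>]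
  have q0: "?q \<noteq> 0" and q1: "?q - 1 \<noteq> 0" using card_gt_1[where 'a = 'a] by simp_all
  define E3 where "E3 = A * B * inverse C"
  define E4 where "E4 = inverse A * inverse B * C * \<phi>"
  define \<delta>3 where "\<delta>3 = delta_char E3"
  define \<delta>4 where "\<delta>4 = delta_char E4"
  have ab_in: "a \<in> mult_chars" "b \<in> mult_chars" "c' \<in> mult_chars" "inverse a \<noteq> \<epsilon>"
    using a(2) by (simp_all add: a(1) b c' mult_char_closed cm inverse_char_eq_triv)
  have E_in: "E3 \<in> mult_chars" "E4 \<in> mult_chars" by (simp_all add: E3_def E4_def mult_char_closed cm)
  \<comment> \<open>\<open>E3\<close> and \<open>E4\<close> multiply to \<phi>, so they are never
    both trivial.\<close>
  have E34: "\<delta>3 * \<delta>4 = 0" "g E3 * \<delta>3 = - \<delta>3" "g E4 * \<delta>4 = - \<delta>4"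
  proof -
    have "E3 * E4 = \<phi>"
      by (rule char_eqI) (simp_all add: E3_def E4_def mult_char_closed cm nz field_simps)
    hence "E4 = \<phi>" if "E3 = \<epsilon>" using that by (metis triv_char_mult E_in(2))
    thus "\<delta>3 * \<delta>4 = 0"
      using quad_char_neq_triv[OF odd] by (auto simp: \<delta>3_def \<delta>4_def delta_char_def)
  qed (auto simp: \<delta>3_def \<delta>4_def delta_char_def gauss_triv)
  define b1 where "b1 = (\<lambda>N :: 'a \<Rightarrow> complex. char_binomial (a * N) N)"
  define b2 where "b2 = (\<lambda>N :: 'a \<Rightarrow> complex. char_binomial (b * N) (a * b * N))"
  define b3 where "b3 = (\<lambda>N :: 'a \<Rightarrow> complex. char_binomial (A * B * N) (C * N))"
  define b4 where "b4 = (\<lambda>N :: 'a \<Rightarrow> complex. char_binomial (A * B * \<phi> * N) (c' * N))"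
  \<comment> \<open>\<open>K\<close> without \<open>g E3\<close> and \<open>g E4\<close>: these two
    are the multipliers that the binomials \<open>b3\<close> and \<open>b4\<close> need in
    \<open>char_binomial_gauss\<close>.\<close>
  define K' where "K' = (A * B) 4 * g (inverse a) / (g (inverse b) * g (b * inverse C) * g (inverse a * C) * g \<phi>)"
  have KK: "K = K' * (g E3 * g E4)"
    by (simp add: K K'_def E3_def E4_def mult_ac)
  have main: "K' * (?q * (g E3 * g E4) * (b1 N * b2 N * b3 N * b4 N) -
      (?q - 1) * (g E3 * g E4) * (b1 N * b2 N * b4 N * \<delta>3 + b1 N * b2 N * b3 N * \<delta>4)) * N (4 * z) =
      N z * gauss_product a b C c' N / (?q ^ 3 * G)" if N: "N \<in> mult_chars" for N
  proof -
    note nzN = mult_char_nonzero[OF N]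
    define P1 where "P1 = N (- 1) * (g (a * N) * g (inverse N)) / ?q"
    define P2 where "P2 = (a * b * N) (- 1) * (g (b * N) * g (inverse (a * b * N))) / ?q"
    define P3 where "P3 = (C * N) (- 1) * (g (A * B * N) * g (inverse (C * N))) / ?q"
    define P4 where "P4 = (c' * N) (- 1) * (g (A * B * \<phi> * N) * g (inverse (c' * N))) / ?q"
    have B1: "b1 N * g a = P1"
    proof -
      have "a = a * N * inverse N"
        by (rule char_eqI) (simp_all add: mult_char_closed ab_in N nzN)
      thus ?thesis using char_binomial_gauss[of "a * N" N a] a(2)
        by (simp add: b1_def P1_def mult_char_closed ab_in N delta_char_def)
    qed
    have B2: "b2 N * g (inverse a) = P2"
    proof -
      have "inverse a = b * N * inverse (a * b * N)"
        by (rule char_eqI) (simp_all add: mult_char_closed a(1) b cm N nzN nz field_simps)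
      thus ?thesis using char_binomial_gauss[of "b * N" "a * b * N" "inverse a"] ab_in(4)
        by (simp add: b2_def P2_def mult_char_closed ab_in N delta_char_def)
    qed
    have B3: "b3 N * g E3 = P3 - (?q - 1) / ?q * \<delta>3"
    proof -
      have "E3 = A * B * N * inverse (C * N)"
        by (rule char_eqI) (simp_all add: E3_def mult_char_closed cm N nzN nz)
      thus ?thesis using char_binomial_gauss[of "A * B * N" "C * N" E3]
        by (simp add: b3_def P3_def \<delta>3_def mult_char_closed cm N)
    qed
    have B4: "b4 N * g E4 = P4 - (?q - 1) / ?q * \<delta>4"
    proof -
      have "E4 = A * B * \<phi> * N * inverse (c' * N)"
        by (rule char_eqI) (simp_all add: E4_def a(1) b c' mult_char_closed cm N nzN nz field_simps)
      thus ?thesis using char_binomial_gauss[of "A * B * \<phi> * N" "c' * N" E4]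
        by (simp add: b4_def P4_def \<delta>4_def mult_char_closed cm ab_in N)
    qed
    have "?q * (g E3 * g E4) * (b1 N * b2 N * b3 N * b4 N) -
      (?q - 1) * (g E3 * g E4) * (b1 N * b2 N * b4 N * \<delta>3 + b1 N * b2 N * b3 N * \<delta>4) =
      b1 N * b2 N * (?q * ((b3 N * g E3) * (b4 N * g E4)) -
        (?q - 1) * ((g E3 * \<delta>3) * (b4 N * g E4) + (g E4 * \<delta>4) * (b3 N * g E3)))"
      by (simp add: algebra_simps)
    \<comment> \<open>Since a trivial character has Gauss sum -1, the terms linear in \<delta>3 or
      \<delta>4 cancel; the mixed term left over is 0.\<close>
    also have "\<dots> = b1 N * b2 N * (?q * P3 * P4 - (?q - 1) * ((?q - 1) / ?q) * (\<delta>3 * \<delta>4))"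
      unfolding B3 B4 E34(2,3) using q0 by (simp add: field_simps)
    finally have 1: "?q * (g E3 * g E4) * (b1 N * b2 N * b3 N * b4 N) -
      (?q - 1) * (g E3 * g E4) * (b1 N * b2 N * b4 N * \<delta>3 + b1 N * b2 N * b3 N * \<delta>4) = b1 N * b2 N * (?q * P3 * P4)"
      by (simp add: E34)
    have dup0: "g (A * B * N) * g (A * B * \<phi> * N) = inverse ((A * B * N) 4) * g (N * N * a * b) * g \<phi>"
    proof -
      have eqs: "(A * B * N) * \<phi> = A * B * \<phi> * N" "(A * B * N) * (A * B * N) = N * N * a * b"
        by (simp_all only: a(1) b mult_ac)
      have "A * B * N \<in> mult_chars" by (simp add: mult_char_closed cm N)
      from gauss_duplication[OF odd this] show ?thesis unfolding eqs .
    qed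
    \<comment> \<open>Duplication costs a factor \<open>inverse ((A * B * N) 4)\<close>. It is
      compensated by the constant \<open>(A * B) 4\<close> in K and by the 4 in the argument
      4z.\<close>
    have dup: "g (A * B * N) * g (A * B * \<phi> * N) * (A * B) 4 * N (4 * z) = g (N * N * a * b) * g \<phi> * N z"
    proof -
      have "(A * B * N) 4 \<noteq> 0"
        using four_nonzero[OF odd] by (simp add: nz nzN)
      moreover have "(A * B) 4 * N (4 * z) = (A * B * N) 4 * N z" by (simp add: mult_char_mult N)
      ultimately have 4: "inverse ((A * B * N) 4) * ((A * B) 4 * N (4 * z)) = N z" by (simp del: times_fun_apply)
      have "inverse ((A * B * N) 4) * s * t * (A * B) 4 * N (4 * z) =
          s * t * (inverse ((A * B * N) 4) * ((A * B) 4 * N (4 * z)))" for s t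
        by (simp only: mult_ac)
      thus ?thesis unfolding dup0 4 .
    qed
    have sgn: "N (- 1) * (a * b * N) (- 1) * (C * N) (- 1) * (c' * N) (- 1) = 1"
    proof -
      have 1: "C (- 1) * inverse (C (- 1)) = 1" using nz(3)[of "- 1"] by simp
      have 2: "(a * b * N) (- 1) = N (- 1)" "(c' * N) (- 1) = inverse (C (- 1)) * N (- 1)"
        "(C * N) (- 1) = C (- 1) * N (- 1)"
        by (simp_all add: a(1) b c' mult_char_minus1_sq A B)
      have "N (- 1) * (a * b * N) (- 1) * (C * N) (- 1) * (c' * N) (- 1) =
          (N (- 1) * N (- 1)) * (N (- 1) * N (- 1)) * (C (- 1) * inverse (C (- 1)))"
        unfolding 2 by (simp only: mult_ac)
      thus ?thesis by (simp only: 1 mult_char_minus1_sq[OF N] mult_1_left)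
    qed
    have perm: "inverse (a * b * N) = inverse (N * a * b)" "inverse (C * N) = inverse (N * C)"
      "inverse (c' * N) = inverse (N * c')"
      by (simp_all only: mult_ac)
    have gnz: "g a \<noteq> 0" "g (inverse a) \<noteq> 0" "g \<phi> \<noteq> 0"
      by (intro gauss_nonzero; simp add: mult_char_closed ab_in \<phi>)+
    have K'G: "K' * g \<phi> * G = (A * B) 4 * g a * g (inverse a)"
    proof -
      define Y where "Y = g (inverse b) * g (b * inverse C) * g (inverse a * C) * g \<phi>"
      have Y: "Y \<noteq> 0" unfolding Y_def by (simp add: gauss_nonzero mult_char_closed ab_in C \<phi>)
      have GY: "g \<phi> * G = g a * Y" unfolding Y_def G by (simp only: mult_ac)
      have "K' = (A * B) 4 * g (inverse a) / Y" by (simp only: K'_def Y_def)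
      thus ?thesis using Y unfolding mult.assoc GY by simp
    qed
    have "K' * (b1 N * b2 N * (?q * P3 * P4)) * N (4 * z) * (g a * g (inverse a) * g \<phi> * G) =
       (K' * g \<phi> * G) * (?q * (P1 * P2 * P3 * P4)) * N (4 * z)"
      unfolding B1[symmetric] B2[symmetric] by (simp only: mult_ac)
    also have "\<dots> = (g a * g (inverse a)) * (?q * (P1 * P2 * P3 * P4) * (A * B) 4 * N (4 * z))"
      unfolding K'G by (simp only: mult_ac)
    also have "?q * (P1 * P2 * P3 * P4) * (A * B) 4 * N (4 * z) =
      ?q * ((N (- 1) * (a * b * N) (- 1) * (C * N) (- 1) * (c' * N) (- 1)) *
      (g (a * N) * g (inverse N) * g (b * N) * g (inverse (a * b * N)) * g (inverse (C * N)) * g (inverse (c' * N))) *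
      (g (A * B * N) * g (A * B * \<phi> * N) * (A * B) 4 * N (4 * z))) / (?q * ?q * ?q * ?q)"
      unfolding P1_def P2_def P3_def P4_def
      by (simp only: times_divide_eq_left times_divide_eq_right divide_divide_eq_left mult_ac)
    also have "\<dots> = g \<phi> * (N z * gauss_product a b C c' N) / ?q ^ 3"
      unfolding sgn dup perm gauss_product_def using q0 by (simp add: power3_eq_cube mult_ac)
    finally have eq: "(g a * g (inverse a) * g \<phi>) * (K' * (b1 N * b2 N * (?q * P3 * P4)) * N (4 * z) * G) =
        (g a * g (inverse a) * g \<phi>) * (N z * gauss_product a b C c' N / ?q ^ 3)"
      by (simp only: mult_ac times_divide_eq_right)
    have "g a * g (inverse a) * g \<phi> \<noteq> 0"
      using gnz by simp
    from mult_left_cancel[THEN iffD1, OF this eq]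
    have "K' * (b1 N * b2 N * (?q * P3 * P4)) * N (4 * z) * G = N z * gauss_product a b C c' N / ?q ^ 3" .
    moreover have "G \<noteq> 0"
      unfolding G by (simp add: gauss_nonzero mult_char_closed ab_in C)
    ultimately show ?thesis
      unfolding 1 using q0 by (simp add: field_simps)
  qed
  have F: "greene_F a [b, A * B, A * B * \<phi>] [a * b, C, c'] y = ?q / (?q - 1) * (\<Sum>N\<in>mult_chars. b1 N * b2 N * b3 N * b4 N * N y)"
    "greene_F a [b, A * B * \<phi>] [a * b, c'] y = ?q / (?q - 1) * (\<Sum>N\<in>mult_chars. b1 N * b2 N * b4 N * N y)"
    "greene_F a [b, A * B] [a * b, C] y = ?q / (?q - 1) * (\<Sum>N\<in>mult_chars. b1 N * b2 N * b3 N * N y)" for y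
    by (simp_all add: greene_F_def b1_def b2_def b3_def b4_def mult.assoc)
  have "?q * K * greene_F a [b, A * B, A * B * \<phi>] [a * b, C, c'] (4 * z)
     - (?q - 1) * K * (greene_F a [b, A * B * \<phi>] [a * b, c'] (4 * z) * \<delta>3
          + greene_F a [b, A * B] [a * b, C] (4 * z) * \<delta>4) =
     ?q / (?q - 1) * (\<Sum>N\<in>mult_chars. K' * (?q * (g E3 * g E4) * (b1 N * b2 N * b3 N * b4 N) -
      (?q - 1) * (g E3 * g E4) * (b1 N * b2 N * b4 N * \<delta>3 + b1 N * b2 N * b3 N * \<delta>4)) * N (4 * z))"
  proof -
    let ?E = "g E3 * g E4"
    have "K' * (?q * ?E * (b1 N * b2 N * b3 N * b4 N) -
      (?q - 1) * ?E * (b1 N * b2 N * b4 N * \<delta>3 + b1 N * b2 N * b3 N * \<delta>4)) * N (4 * z) =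
      K' * ?E * ?q * (b1 N * b2 N * b3 N * b4 N * N (4 * z)) -
      K' * ?E * (?q - 1) * \<delta>3 * (b1 N * b2 N * b4 N * N (4 * z)) -
      K' * ?E * (?q - 1) * \<delta>4 * (b1 N * b2 N * b3 N * N (4 * z))" for N
      by (simp only: right_diff_distrib left_diff_distrib distrib_left distrib_right mult_ac) simp
    hence "(\<Sum>N\<in>mult_chars. K' * (?q * ?E * (b1 N * b2 N * b3 N * b4 N) -
      (?q - 1) * ?E * (b1 N * b2 N * b4 N * \<delta>3 + b1 N * b2 N * b3 N * \<delta>4)) * N (4 * z)) =
      K' * ?E * ?q * (\<Sum>N\<in>mult_chars. b1 N * b2 N * b3 N * b4 N * N (4 * z)) -
      K' * ?E * (?q - 1) * \<delta>3 * (\<Sum>N\<in>mult_chars. b1 N * b2 N * b4 N * N (4 * z)) -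
      K' * ?E * (?q - 1) * \<delta>4 * (\<Sum>N\<in>mult_chars. b1 N * b2 N * b3 N * N (4 * z))"
      by (simp only: sum_subtractf sum_distrib_left)
    thus ?thesis unfolding F KK
      by (simp only: right_diff_distrib left_diff_distrib distrib_left distrib_right mult_ac) simp
  qed
  also have "\<dots> = ?q / (?q - 1) * (\<Sum>N\<in>mult_chars. N z * gauss_product a b C c' N / (?q ^ 3 * G))"
    by (rule arg_cong[where f = "\<lambda>s. ?q / (?q - 1) * s"]) (rule sum.cong[OF refl main])
  also have "\<dots> = (\<Sum>N\<in>mult_chars. N z * gauss_product a b C c' N) / (?q ^ 2 * (?q - 1) * G)"
    using q0 by (simp add: sum_divide_distrib[symmetric] power3_eq_cube power2_eq_square)
  finally show ?thesis
    by (simp only: \<delta>3_def \<delta>4_def E3_def E4_def)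
qed

end

section \<open>The degenerate characters and the assembly of the formula\<close>

lemma sum_chars_square_condition:
  fixes A B :: "'a::finite_field \<Rightarrow> complex" and F :: "('a \<Rightarrow> complex) \<Rightarrow> complex"
  assumes odd: "odd CARD('a)" and A: "A \<in> mult_chars" and B: "B \<in> mult_chars"
  shows "(\<Sum>N\<in>mult_chars. if N * N * (A * A) * (B * B) = \<epsilon> then F N else 0) =
    F (inverse A * inverse B) + F (inverse A * inverse B * \<phi>)"
proof -
  note \<phi> = quad_char_in[OF odd]
  note cm = A B \<phi>
  define M where "M = inverse A * inverse B"
  have M: "M \<in> mult_chars" "inverse M = A * B"
    by (simp_all add: M_def mult_char_closed cm inverse_char_distrib inverse_inverse_char)
  have MM: "M * inverse M = \<epsilon>" using inverse_char_mult[OF M(1)] by (simp add: mult.commute)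
  have M\<phi>: "M * \<phi> * inverse M = \<phi>"
    using triv_char_mult[OF \<phi>] unfolding mult.assoc mult.commute[of \<phi>] by (simp only: mult.assoc[symmetric] MM)
  have iff: "N * N * (A * A) * (B * B) = \<epsilon> \<longleftrightarrow> N = M \<or> N = M * \<phi>" if N: "N \<in> mult_chars" for N
  proof -
    \<comment> \<open>As \<open>inverse M\<close> is \<open>A * B\<close>, the condition says that N
      / M has trivial square, so N / M is \<epsilon> or \<phi>.\<close>
    have sq: "N * N * (A * A) * (B * B) = (N * inverse M) * (N * inverse M)"
      unfolding M(2) by (simp only: mult_ac)
    have in_mc: "N * inverse M \<in> mult_chars" by (simp add: mult_char_closed N M(1))
    have "N * N * (A * A) * (B * B) = \<epsilon> \<longleftrightarrow> N * inverse M = \<epsilon> \<or> N * inverse M = \<phi>"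
      unfolding sq using char_square_eq_triv[OF odd in_mc] triv_char_mult[OF triv_char_in] quad_char_sq by auto
    also have "N * inverse M = \<epsilon> \<longleftrightarrow> N = M"
      using N M(1) by (simp add: char_times_eq_triv_iff mult_char_closed inverse_inverse_char)
    also have "N * inverse M = \<phi> \<longleftrightarrow> N = M * \<phi>"
    proof
      have "N * inverse M * M = \<epsilon> * N"
        unfolding mult.assoc inverse_char_mult[OF M(1)] by (rule mult.commute)
      thus "N = M * \<phi>" if "N * inverse M = \<phi>"
        using that N by (simp add: triv_char_mult mult.commute)
      show "N * inverse M = \<phi>" if "N = M * \<phi>"
        using M\<phi> that by simp
    qed
    finally show ?thesis .
  qed
  have ne: "M \<noteq> M * \<phi>"
  proof
    assume "M = M * \<phi>"
    hence "M * inverse M = \<phi>" using M\<phi> by simp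
    thus False using quad_char_neq_triv[OF odd] unfolding MM by metis
  qed
  have "(\<Sum>N\<in>mult_chars. if N * N * (A * A) * (B * B) = \<epsilon> then F N else 0) =
      (\<Sum>N\<in>mult_chars. if N = M \<or> N = M * \<phi> then F N else 0)"
    by (intro sum.cong refl) (simp add: iff)
  also have "\<dots> = (\<Sum>N\<in>{M, M * \<phi>}. F N)"
    by (rule sum.mono_neutral_cong_right) (auto simp: finite_mult_chars M(1) mult_char_closed \<phi>)
  also have "\<dots> = F M + F (M * \<phi>)" using ne by simp
  finally show ?thesis by (simp only: M_def)
qed

text \<open>Meant for M = A B and M = A B \<phi>, with the correction taken at N = 1 / M. A nonzero
  \<open>delta_char M\<close> forces \<open>M (- 1) = 1\<close>, and a nonzero
  \<open>delta_char (M * inverse C)\<close> forces \<open>M (- 1) = C (- 1)\<close>; this trades the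
  uniform sign \<open>C (- 1)\<close> for the signs of the final formula.\<close>

lemma degenerate_term:
  fixes M C :: "'a::finite_field \<Rightarrow> complex" and q :: complex
  assumes M: "M \<in> mult_chars" and C: "C \<in> mult_chars" and q: "q \<noteq> 0"
  shows "C (- 1) * (q - 1)\<^sup>2 * (delta_char (inverse M) + delta_char (inverse M * C)
         - (q - 1) / q * delta_char (inverse M) * delta_char (inverse M * C)) =
    - ((q - 1)\<^sup>2 / q * ((q - 1) * delta_char M * delta_char (M * inverse C)
       - q * M (- 1) * delta_char (M * inverse C) - q * (M (- 1) * C (- 1)) * delta_char M))"
proof -
  define \<delta>1 where "\<delta>1 = delta_char M"
  define \<delta>2 where "\<delta>2 = delta_char (M * inverse C)"
  have "inverse M * C = inverse (M * inverse C)"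
    by (simp add: inverse_char_distrib inverse_inverse_char)
  hence 1: "delta_char (inverse M) = \<delta>1" "delta_char (inverse M * C) = \<delta>2"
    by (simp_all only: delta_inverse_char \<delta>1_def \<delta>2_def)
  have s1: "M (- 1) * \<delta>1 = \<delta>1" by (simp add: \<delta>1_def delta_char_def triv_char_def)
  have s2: "M (- 1) * \<delta>2 = C (- 1) * \<delta>2"
  proof (cases "M * inverse C = \<epsilon>")
    case True
    hence "M = C" using M C by (simp add: char_times_eq_triv_iff mult_char_closed inverse_inverse_char)
    thus ?thesis by simp
  qed (simp add: \<delta>2_def delta_char_def)
  have s3: "C (- 1) * (\<delta>1 * \<delta>2) = \<delta>1 * \<delta>2"
  proof -
    have "C (- 1) * (\<delta>1 * \<delta>2) = (M (- 1) * \<delta>1) * \<delta>2" using s2 by (simp only: mult_ac)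
    thus ?thesis by (simp only: s1)
  qed
  have "C (- 1) * (q - 1)\<^sup>2 * (\<delta>1 + \<delta>2 - (q - 1) / q * \<delta>1 * \<delta>2) =
      (q - 1)\<^sup>2 * (C (- 1) * \<delta>1 + C (- 1) * \<delta>2 - (q - 1) / q * (C (- 1) * (\<delta>1 * \<delta>2)))"
    by (simp add: algebra_simps)
  also have "\<dots> = (q - 1)\<^sup>2 * (C (- 1) * (M (- 1) * \<delta>1) + M (- 1) * \<delta>2 - (q - 1) / q * (\<delta>1 * \<delta>2))"
    by (simp only: s1 s2 s3)
  also have "\<dots> = - ((q - 1)\<^sup>2 / q * ((q - 1) * \<delta>1 * \<delta>2 - q * M (- 1) * \<delta>2 - q * (M (- 1) * C (- 1)) * \<delta>1))"
    using q by (simp add: field_simps)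
  finally show ?thesis unfolding 1 by (simp only: \<delta>1_def \<delta>2_def)
qed

text \<open>With \<open>r\<close> for q - 1: the coefficient r / q^2 of the degenerate terms is the
  r^2 / q of the correction divided by q r, where r stems from Mellin inversion and q from
  \<open>pair_sum_bessel\<close>.\<close>

lemma combine_terms:
  fixes q r G L S R T1 T2 E D1 D2 :: complex
  assumes "q \<noteq> 0" "r \<noteq> 0" "G \<noteq> 0"
    and "G * L = (S / q + (T1 * - (r\<^sup>2 / q * D1) + T2 * - (r\<^sup>2 / q * D2))) / (q * r) + E"
    and "R = S / (q\<^sup>2 * r * G)"
  shows "L = R + E / G - r * T1 / (q\<^sup>2 * G) * D1 - r * T2 / (q\<^sup>2 * G) * D2"
proof -
  have "(S / q + (T1 * - (r\<^sup>2 / q * D1) + T2 * - (r\<^sup>2 / q * D2))) / (q * r) + E =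
      S / (q\<^sup>2 * r) - r * T1 / q\<^sup>2 * D1 - r * T2 / q\<^sup>2 * D2 + E"
    using assms(1,2) by (simp add: field_simps power2_eq_square)
  hence "L = (S / (q\<^sup>2 * r) - r * T1 / q\<^sup>2 * D1 - r * T2 / q\<^sup>2 * D2 + E) / G"
    using assms(3,4) by (simp add: field_simps)
  thus ?thesis unfolding assms(5) by (simp add: add_divide_distrib diff_divide_distrib mult_ac)
qed

context additive_character
begin

theorem greene_product_formula:
  fixes A B C :: "'a \<Rightarrow> complex"
  assumes odd: "odd CARD('a)"
    and A: "A \<in> mult_chars" and B: "B \<in> mult_chars" and C: "C \<in> mult_chars"
    and a: "a = A * A" "a \<noteq> \<epsilon>" "a \<noteq> C" and b: "b = B * B" "b \<noteq> \<epsilon>" "b \<noteq> C"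
    and c': "c' = a * b * inverse C"
    and K: "K = (A * B) 4 * g (inverse a) * g (A * B * inverse C) * g (inverse A * inverse B * C * \<phi>) /
                (g (inverse b) * g (b * inverse C) * g (inverse a * C) * g \<phi>)"
    and G: "G = g a * g (inverse b) * g (b * inverse C) * g (inverse a * C)"
    and q: "q = of_nat CARD('a)" and x: "x \<noteq> 1"
  shows "greene_F a [b] [C] x * greene_F a [b] [c'] x =
       q * K * greene_F a [b, A * B, A * B * \<phi>] [a * b, C, c'] (4 * x * (1 - x))
     - (q - 1) * K *
         (greene_F a [b, A * B * \<phi>] [a * b, c'] (4 * x * (1 - x)) * delta_char (A * B * inverse C)
          + greene_F a [b, A * B] [a * b, C] (4 * x * (1 - x)) *
            delta_char (inverse A * inverse B * C * \<phi>))
     + q * (inverse C * inverse a) (1 - x) * (C * inverse b) x / G *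
         delta_elt ((1 - 2 * x) / (1 - x)\<^sup>2)
     - (q - 1) * g (A * inverse B) * g (inverse A * B) * (inverse A * inverse B) (x - x\<^sup>2) /
         (q\<^sup>2 * G) *
         ((q - 1) * delta_char (A * B) * delta_char (A * B * inverse C)
          - q * (A * B) (- 1) * delta_char (A * B * inverse C)
          - q * (A * B * C) (- 1) * delta_char (A * B))
     - (q - 1) * g (inverse A * B * \<phi>) * g (A * inverse B * \<phi>) * (inverse A * inverse B * \<phi>) (x - x\<^sup>2) /
         (q\<^sup>2 * G) *
         ((q - 1) * delta_char (A * B * inverse C * \<phi>) * delta_char (A * B * \<phi>)
          - q * (A * B * \<phi>) (- 1) * delta_char (A * B * inverse C * \<phi>)
          - q * (A * B * C * \<phi>) (- 1) * delta_char (A * B * \<phi>))"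
proof (cases "x = 0")
  case True
  \<comment> \<open>The integral representation needs x \<noteq> 0. At x = 0 every series and
    character value vanishes, and the argument of \<open>delta_elt\<close> is 1.\<close>
  have "greene_F F As Bs x = 0" "greene_F F As Bs (4 * x * (1 - x)) = 0" for F As Bs
    using True greene_F_0 by simp_all
  moreover have "delta_elt ((1 - 2 * x) / (1 - x)\<^sup>2) = 0" using True by (simp add: delta_elt_def)
  moreover have "(inverse A * inverse B) (x - x\<^sup>2) = 0" "(inverse A * inverse B * \<phi>) (x - x\<^sup>2) = 0"
    using True by (simp_all add: mult_char_0 A)
  ultimately show ?thesis by (simp only: mult_zero_left mult_zero_right div_0 diff_0_right add_0_right)
next
  case x0: False
  note \<phi> = quad_char_in[OF odd]
  note cm = A B C \<phi>
  note nz = mult_char_nonzero[OF A] mult_char_nonzero[OF B] mult_char_nonzero[OF C] mult_char_nonzero[OF \<phi>]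
  define z where "z = x * (1 - x)"
  have z: "x - x\<^sup>2 = z" "4 * x * (1 - x) = 4 * z"
    by (simp_all add: z_def power2_eq_square algebra_simps)
  have q0: "q \<noteq> 0" "q - 1 \<noteq> 0" using card_gt_1[where 'a = 'a] by (simp_all add: q)
  have ab: "a \<in> mult_chars" "a (- 1) = 1" "b \<in> mult_chars" "b (- 1) = 1"
    by (simp_all add: a(1) b(1) mult_char_closed cm mult_char_minus1_sq)
  have G0: "G \<noteq> 0"
    unfolding G by (simp add: gauss_nonzero mult_char_closed ab C)
  define M where "M = A * B"
  have M: "inverse A * inverse B = inverse M" "inverse A * inverse B * \<phi> = inverse (M * \<phi>)"
    "M \<in> mult_chars" "M * \<phi> \<in> mult_chars"
    by (simp_all add: M_def inverse_char_distrib inverse_quad_char mult_char_closed cm)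
  define corr where "corr N = C (- 1) * (q - 1)\<^sup>2 *
        (delta_char N + delta_char (N * C) - (q - 1) / q * delta_char N * delta_char (N * C))" for N
  define S where "S = (\<Sum>N\<in>mult_chars. N z * gauss_product a b C c' N)"
  define D1 where "D1 = (q - 1) * delta_char M * delta_char (M * inverse C)
          - q * M (- 1) * delta_char (M * inverse C) - q * (M (- 1) * C (- 1)) * delta_char M"
  define D2 where "D2 = (q - 1) * delta_char (M * \<phi>) * delta_char (M * \<phi> * inverse C)
          - q * (M * \<phi>) (- 1) * delta_char (M * \<phi> * inverse C) - q * ((M * \<phi>) (- 1) * C (- 1)) * delta_char (M * \<phi>)"
  define T1 where "T1 = g (A * inverse B) * g (inverse A * B) * inverse M z"
  define T2 where "T2 = g (inverse A * B * \<phi>) * g (A * inverse B * \<phi>) * inverse (M * \<phi>) z"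
  define E where "E = q * inverse (a x) * inverse (b x) * delta_elt (1 - 2 * x)"
  have "(\<Sum>N\<in>mult_chars. N z * (g (a * N) * g (b * N) * (\<Sum>u\<in>UNIV. inverse N u * bessel_pair C c' u))) =
      (\<Sum>N\<in>mult_chars. N z * gauss_product a b C c' N / q +
        (if N * N * (A * A) * (B * B) = \<epsilon> then N z * g (a * N) * g (b * N) * corr N else 0))"
  proof (rule sum.cong[OF refl])
    fix N :: "'a \<Rightarrow> complex" assume N: "N \<in> mult_chars"
    show "N z * (g (a * N) * g (b * N) * (\<Sum>u\<in>UNIV. inverse N u * bessel_pair C c' u)) =
      N z * gauss_product a b C c' N / q +
        (if N * N * (A * A) * (B * B) = \<epsilon> then N z * g (a * N) * g (b * N) * corr N else 0)"
      unfolding mellin_bessel_pair_eval[OF ab C c' N] gauss_product_def corr_def q a(1) b(1)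
      by (simp add: distrib_left mult_ac)
  qed
  also have "\<dots> = S / q + (inverse M z * g (a * inverse M) * g (b * inverse M) * corr (inverse M) +
      inverse (M * \<phi>) z * g (a * inverse (M * \<phi>)) * g (b * inverse (M * \<phi>)) * corr (inverse (M * \<phi>)))"
    unfolding sum.distrib sum_chars_square_condition[OF odd A B] M(2) unfolding M(1)
    by (simp only: S_def sum_divide_distrib)
  also have "inverse M z * g (a * inverse M) * g (b * inverse M) = T1"
  proof -
    have 1: "a * inverse M = A * inverse B" "b * inverse M = inverse A * B"
      by (rule_tac [!] char_eqI) (simp_all add: a(1) b(1) M_def mult_char_closed cm nz field_simps)
    show ?thesis unfolding T1_def 1 by (simp only: mult_ac)
  qed
  also have "inverse (M * \<phi>) z * g (a * inverse (M * \<phi>)) * g (b * inverse (M * \<phi>)) = T2"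
  proof -
    have 1: "a * inverse (M * \<phi>) = A * inverse B * \<phi>" "b * inverse (M * \<phi>) = inverse A * B * \<phi>"
      unfolding inverse_char_distrib inverse_quad_char
      by (rule_tac [!] char_eqI) (simp_all add: a(1) b(1) M_def mult_char_closed cm nz field_simps)
    show ?thesis unfolding T2_def 1 by (simp only: mult_ac)
  qed
  also have "corr (inverse M) = - ((q - 1)\<^sup>2 / q * D1)"
    unfolding corr_def D1_def by (rule degenerate_term[OF M(3) C q0(1)])
  also have "corr (inverse (M * \<phi>)) = - ((q - 1)\<^sup>2 / q * D2)"
    unfolding corr_def D2_def by (rule degenerate_term[OF M(4) C q0(1)])
  finally have L: "G * (greene_F a [b] [C] x * greene_F a [b] [c'] x) =
     (S / q + (T1 * - ((q - 1)\<^sup>2 / q * D1) + T2 * - ((q - 1)\<^sup>2 / q * D2))) / (q * (q - 1)) + E"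
    using greene_2F1_product[OF ab(1,2) a(2) ab(3,4) b(2) C c' a(3) b(3) x0 x]
    unfolding G E_def z_def q by (simp only:)
  have R: "q * K * greene_F a [b, A * B, A * B * \<phi>] [a * b, C, c'] (4 * z)
     - (q - 1) * K *
         (greene_F a [b, A * B * \<phi>] [a * b, c'] (4 * z) * delta_char (A * B * inverse C)
          + greene_F a [b, A * B] [a * b, C] (4 * z) * delta_char (inverse A * inverse B * C * \<phi>)) =
     S / (q\<^sup>2 * (q - 1) * G)"
    unfolding q S_def by (rule greene_4F3_gauss[OF odd A B C a(1,2) b(1) c' K G])
  \<comment> \<open>The delta is supported at x = 1/2; there 1 - x = x, so C cancels against its
    inverse.\<close>
  have E: "E / G = q * (inverse C * inverse a) (1 - x) * (C * inverse b) x / G *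
      delta_elt ((1 - 2 * x) / (1 - x)\<^sup>2)"
  proof (cases "1 - 2 * x = 0")
    case True
    hence 1: "1 - x = x" by (simp add: algebra_simps)
    show ?thesis using x0 unfolding E_def 1 True by (simp add: delta_elt_def nz)
  next
    case False
    thus ?thesis using x by (simp add: E_def delta_elt_def)
  qed
  have D1: "D1 = (q - 1) * delta_char (A * B) * delta_char (A * B * inverse C)
          - q * (A * B) (- 1) * delta_char (A * B * inverse C)
          - q * (A * B * C) (- 1) * delta_char (A * B)"
    by (simp add: D1_def M_def)
  have D2: "D2 = (q - 1) * delta_char (A * B * inverse C * \<phi>) * delta_char (A * B * \<phi>)
          - q * (A * B * \<phi>) (- 1) * delta_char (A * B * inverse C * \<phi>)
          - q * (A * B * C * \<phi>) (- 1) * delta_char (A * B * \<phi>)"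
    by (simp add: D2_def M_def mult_ac)
  show ?thesis
    using combine_terms[OF q0 G0 L R]
    unfolding z M(2) unfolding M(1) D1[symmetric] D2[symmetric] E[symmetric] T1_def T2_def by (simp only: mult.assoc)
qed

end

section \<open>The additive character given by the trace\<close>

context
  fixes p r :: nat and \<zeta> :: complex
  assumes p: "prime p" and r: "r \<ge> 1" and card: "CARD('a::finite_field) = p ^ r"
    and zeta: "primitive_root_of_unity p \<zeta>"
begin

lemma CHAR_eq_prime: "CHAR('a) = p"
proof -
  have "CHAR('a) dvd p ^ r" using CHAR_dvd_CARD[where 'a = 'a] card by simp
  hence "CHAR('a) dvd p" using prime_dvd_power CHAR_prime by blast
  thus ?thesis using primes_dvd_imp_eq CHAR_prime p by blast
qed

lemma prime_CHAR: "prime CHAR('a)" by (simp add: CHAR_eq_prime p)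

lemma field_trace_add: "field_trace p r (x + y) = field_trace p r x + field_trace p r (y :: 'a)"
  unfolding field_trace_def sum.distrib[symmetric]
  by (intro sum.cong refl freshmans_dream'[OF prime_CHAR]) (simp add: CHAR_eq_prime)

text \<open>Frobenius shifts the summands of the trace by one, and x^q = x closes the cycle.\<close>

lemma field_trace_power: "field_trace p r x ^ p = field_trace p r (x :: 'a)"
proof -
  have "field_trace p r x ^ p = (\<Sum>i<r. (x ^ p ^ i) ^ p)"
    unfolding field_trace_def by (rule freshmans_dream_sum[OF prime_CHAR]) (simp add: CHAR_eq_prime)
  also have "\<dots> = (\<Sum>i<r. x ^ p ^ Suc i)"
    by (simp add: mult.commute flip: power_mult)
  also have "\<dots> = (\<Sum>i<Suc r. x ^ p ^ i) - x ^ p ^ 0"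
    by (simp add: sum.lessThan_Suc_shift del: sum.lessThan_Suc)
  also have "\<dots> = field_trace p r x"
    using finite_field_power_card_eq_same[of x] by (simp add: card field_trace_def)
  finally show ?thesis .
qed

lemma of_nat_eq_iff_less_prime: "i < p \<Longrightarrow> j < p \<Longrightarrow> of_nat i = (of_nat j :: 'a) \<longleftrightarrow> i = j"
  by (simp add: of_nat_eq_iff_cong_CHAR CHAR_eq_prime cong_def)

lemma of_nat_power_prime: "of_nat k ^ p = (of_nat k :: 'a)"
proof (induction k)
  case 0
  thus ?case using prime_gt_1_nat[OF p] by simp
next
  case (Suc k)
  have "(1 + of_nat k) ^ p = 1 ^ p + (of_nat k :: 'a) ^ p"
    by (rule freshmans_dream[OF prime_CHAR]) (simp add: CHAR_eq_prime)
  thus ?case using Suc by simp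
qed

text \<open>The polynomial X^p - X has at most p roots, and the p distinct elements
  \<open>of_nat k\<close> with k < p are roots already.\<close>

lemma prime_subfield:
  assumes "y ^ p = (y :: 'a)"
  shows "\<exists>k<p. of_nat k = y"
proof -
  define P where "P = Polynomial.monom 1 p - Polynomial.monom (1 :: 'a) 1"
  have "Polynomial.coeff P p = 1" using prime_gt_1_nat[OF p] by (simp add: P_def)
  hence P0: "P \<noteq> 0" by auto
  have "Polynomial.degree P \<le> p"
    unfolding P_def using prime_gt_1_nat[OF p] by (intro degree_diff_le) (auto simp: degree_monom_eq)
  hence "card {y. poly P y = 0} \<le> p"
    using card_poly_roots_bound[OF P0] by simp
  moreover have roots: "{y. poly P y = 0} = {y. y ^ p = y}"
    by (simp add: P_def poly_monom)
  moreover have "card (of_nat ` {..<p} :: 'a set) = p"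
    by (subst card_image) (auto simp: inj_on_def of_nat_eq_iff_less_prime)
  moreover have "of_nat ` {..<p} \<subseteq> {y :: 'a. y ^ p = y}"
    by (auto simp: of_nat_power_prime)
  ultimately have "of_nat ` {..<p} = {y :: 'a. y ^ p = y}"
    by (intro card_seteq) simp_all
  hence "y \<in> of_nat ` {..<p}" using assms by blast
  thus ?thesis by auto
qed

text \<open>Makes the \<open>THE\<close> in \<open>add_char\<close> usable: the trace is fixed by
  Frobenius, hence lies in the prime subfield, where exponents below p are distinguished.\<close>

lemma add_char_exponent:
  fixes x :: 'a
  obtains k where "k < p" "of_nat k = field_trace p r x" "add_char p r \<zeta> x = \<zeta> ^ k"
proof -
  obtain k where k: "k < p" "of_nat k = field_trace p r x"
    using prime_subfield[OF field_trace_power] by blast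
  have "(THE k. k < p \<and> of_nat k = field_trace p r x) = k"
    using k of_nat_eq_iff_less_prime by (intro the_equality) metis+
  thus ?thesis using that[OF k] by (simp add: add_char_def)
qed

lemma zeta_power_eq: "i mod p = j mod p \<Longrightarrow> \<zeta> ^ i = \<zeta> ^ j"
proof -
  have "\<zeta> ^ p = 1" using zeta by (simp add: primitive_root_of_unity_def)
  hence "\<zeta> ^ (p * (i div p) + i mod p) = \<zeta> ^ (i mod p)" for i
    unfolding power_add power_mult by simp
  hence "\<zeta> ^ i = \<zeta> ^ (i mod p)" for i by simp
  thus "i mod p = j mod p \<Longrightarrow> \<zeta> ^ i = \<zeta> ^ j" by metis
qed

text \<open>The trace is a polynomial of degree at most p^(r-1), less than q, and its coefficient at
  X is 1; so it cannot vanish on the whole field.\<close>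

lemma field_trace_nonzero: "\<exists>x :: 'a. field_trace p r x \<noteq> 0"
proof (rule ccontr)
  assume zero: "\<nexists>x :: 'a. field_trace p r x \<noteq> 0"
  define P where "P = (\<Sum>i<r. Polynomial.monom (1 :: 'a) (p ^ i))"
  have "Polynomial.coeff P 1 = (\<Sum>i<r. if i = 0 then 1 else 0)"
    unfolding P_def coeff_sum using prime_gt_1_nat[OF p] by (intro sum.cong) (auto simp: power_eq_1_iff)
  hence P0: "P \<noteq> 0" using r by auto
  have "Polynomial.degree P \<le> p ^ (r - 1)"
    unfolding P_def
  proof (rule degree_sum_le)
    fix i assume "i \<in> {..<r}"
    hence "p ^ i \<le> p ^ (r - 1)" using prime_gt_1_nat[OF p] by (intro power_increasing) auto
    thus "Polynomial.degree (Polynomial.monom (1 :: 'a) (p ^ i)) \<le> p ^ (r - 1)" by (simp add: degree_monom_eq)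
  qed simp
  moreover have "{x. poly P x = 0} = UNIV"
    using zero by (simp add: P_def poly_sum poly_monom field_trace_def)
  ultimately have "p ^ r \<le> p ^ (r - 1)"
    using card_poly_roots_bound[OF P0] card by simp
  thus False using prime_gt_1_nat[OF p] r by simp
qed

lemma additive_character_add_char: "additive_character (add_char p r \<zeta> :: 'a \<Rightarrow> complex)"
proof
  show add: "add_char p r \<zeta> (x + y) = add_char p r \<zeta> x * add_char p r \<zeta> y" for x y :: 'a
  proof -
    obtain i where i: "of_nat i = field_trace p r x" "add_char p r \<zeta> x = \<zeta> ^ i"
      by (rule add_char_exponent)
    obtain j where j: "of_nat j = field_trace p r y" "add_char p r \<zeta> y = \<zeta> ^ j"
      by (rule add_char_exponent)
    obtain k where k: "of_nat k = field_trace p r (x + y)" "add_char p r \<zeta> (x + y) = \<zeta> ^ k"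
      by (rule add_char_exponent)
    have "of_nat k = (of_nat (i + j) :: 'a)" by (simp add: i j k field_trace_add)
    hence "k mod p = (i + j) mod p" by (simp only: of_nat_eq_iff_cong_CHAR CHAR_eq_prime cong_def)
    thus ?thesis unfolding i(2) j(2) k(2) power_add[symmetric] by (rule zeta_power_eq)
  qed
  show zero: "add_char p r \<zeta> (0 :: 'a) = 1"
  proof -
    obtain k where k: "k < p" "of_nat k = field_trace p r (0 :: 'a)" "add_char p r \<zeta> (0 :: 'a) = \<zeta> ^ k"
      by (rule add_char_exponent)
    have "field_trace p r (0 :: 'a) = 0"
      using prime_gt_1_nat[OF p] by (simp add: field_trace_def power_0_left)
    hence "k = 0" using of_nat_eq_iff_less_prime[of k 0] k prime_gt_1_nat[OF p] by simp
    thus ?thesis using k by simp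
  qed
  show "(\<Sum>x\<in>UNIV. add_char p r \<zeta> (x :: 'a)) = 0"
  proof -
    obtain a :: 'a where a: "field_trace p r a \<noteq> 0" using field_trace_nonzero by blast
    obtain k where k: "k < p" "of_nat k = field_trace p r a" "add_char p r \<zeta> a = \<zeta> ^ k"
      by (rule add_char_exponent)
    \<comment> \<open>Now 0 < k < p, so primitivity of \<zeta> gives a value different from 1;
      translating the sum by \<open>a\<close> multiplies it by this value.\<close>
    have "k \<noteq> 0" using a k by (metis of_nat_0)
    hence ne: "add_char p r \<zeta> a \<noteq> 1"
      using k zeta by (simp add: primitive_root_of_unity_def)
    have "(\<Sum>x\<in>UNIV. add_char p r \<zeta> (x :: 'a)) = (\<Sum>x\<in>UNIV. add_char p r \<zeta> (a + x))"
      by (rule sum.reindex_bij_witness[of _ "\<lambda>x. a + x" "\<lambda>x. x - a"]) auto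
    also have "\<dots> = add_char p r \<zeta> a * (\<Sum>x\<in>UNIV. add_char p r \<zeta> (x :: 'a))"
      by (simp add: add sum_distrib_left)
    finally show ?thesis using ne by simp
  qed
qed

end

theorem theorem1p1:
  fixes p r q :: nat and \<zeta> :: complex
    and A B C :: "'a::finite_field \<Rightarrow> complex"
    and g :: "('a \<Rightarrow> complex) \<Rightarrow> complex"
    and K G :: complex and x :: 'a
  assumes p: "prime p" "odd p" and r: "r \<ge> 1" and q: "q = p ^ r" and card: "CARD('a) = q"
    and zeta: "primitive_root_of_unity p \<zeta>"
    and g: "g = gauss_sum p r \<zeta>"
    and chars: "A \<in> mult_chars" "B \<in> mult_chars" "C \<in> mult_chars"
    and A2: "A\<^sup>2 \<noteq> \<epsilon>" and B2: "B\<^sup>2 \<noteq> \<epsilon>" and A2C: "A\<^sup>2 \<noteq> C" and B2C: "B\<^sup>2 \<noteq> C"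
    and K: "K = (A * B) 4 * g (inverse (A\<^sup>2)) * g (A * B * inverse C) * g (inverse A * inverse B * C * \<phi>) /
                (g (inverse (B\<^sup>2)) * g (B\<^sup>2 * inverse C) * g (inverse (A\<^sup>2) * C) * g \<phi>)"
    and G: "G = g (A\<^sup>2) * g (inverse (B\<^sup>2)) * g (B\<^sup>2 * inverse C) * g (inverse (A\<^sup>2) * C)"
    and x: "x \<noteq> 1"
  shows
    "greene_F (A\<^sup>2) [B\<^sup>2] [C] x * greene_F (A\<^sup>2) [B\<^sup>2] [A\<^sup>2 * B\<^sup>2 * inverse C] x =
       of_nat q * K *
         greene_F (A\<^sup>2) [B\<^sup>2, A * B, A * B * \<phi>] [A\<^sup>2 * B\<^sup>2, C, A\<^sup>2 * B\<^sup>2 * inverse C] (4 * x * (1 - x))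
     - (of_nat q - 1) * K *
         (greene_F (A\<^sup>2) [B\<^sup>2, A * B * \<phi>] [A\<^sup>2 * B\<^sup>2, A\<^sup>2 * B\<^sup>2 * inverse C] (4 * x * (1 - x)) *
            delta_char (A * B * inverse C)
          + greene_F (A\<^sup>2) [B\<^sup>2, A * B] [A\<^sup>2 * B\<^sup>2, C] (4 * x * (1 - x)) *
            delta_char (inverse A * inverse B * C * \<phi>))
     + of_nat q * (inverse C * inverse (A\<^sup>2)) (1 - x) * (C * inverse (B\<^sup>2)) x / G *
         delta_elt ((1 - 2 * x) / (1 - x)\<^sup>2)
     - (of_nat q - 1) * g (A * inverse B) * g (inverse A * B) * (inverse A * inverse B) (x - x\<^sup>2) /
         ((of_nat q)\<^sup>2 * G) *
         ((of_nat q - 1) * delta_char (A * B) * delta_char (A * B * inverse C)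
          - of_nat q * (A * B) (- 1) * delta_char (A * B * inverse C)
          - of_nat q * (A * B * C) (- 1) * delta_char (A * B))
     - (of_nat q - 1) * g (inverse A * B * \<phi>) * g (A * inverse B * \<phi>) * (inverse A * inverse B * \<phi>) (x - x\<^sup>2) /
         ((of_nat q)\<^sup>2 * G) *
         ((of_nat q - 1) * delta_char (A * B * inverse C * \<phi>) * delta_char (A * B * \<phi>)
          - of_nat q * (A * B * \<phi>) (- 1) * delta_char (A * B * inverse C * \<phi>)
          - of_nat q * (A * B * C * \<phi>) (- 1) * delta_char (A * B * \<phi>))"
proof -
  interpret additive_character "add_char p r \<zeta> :: 'a \<Rightarrow> complex"
    by (rule additive_character_add_char[OF p(1) r _ zeta]) (simp add: card q)
  have g_eq: "additive_character.g (add_char p r \<zeta>) = g"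
    by (simp add: assms(7) g_def gauss_sum_def fun_eq_iff)
  have odd: "odd CARD('a)" using p(2) r by (simp add: card q)
  note sq = power2_eq_square[of A] power2_eq_square[of B]
  show ?thesis
    unfolding sq
    by (rule greene_product_formula[OF odd chars refl _ _ refl _ _ refl, folded gauss_sum_def, unfolded g_eq])
      (use A2 B2 A2C B2C K G x in \<open>simp_all add: sq card\<close>)
qed

end
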